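(* Let $d$ and $m$ be positive integers. Let $X:=(X_k,k\in\mathbb{Z}^d)$ be a strictly stationary $\rho'$-mixing random field, where for each $k$, $X_k:=(X_{k1},X_{k2},\ldots,X_{km})$ is an $m$-dimensional random vector such that for every $i\in\{1,\ldots,m\}$, $X_{ki}$ is a real-valued random variable with $EX_{ki}=0$ and $EX_{ki}^2<\infty$. For $L=(L_1,\ldots,L_d)\in\mathbb{N}^d$ and $i\in\{1,\ldots,m\}$ let $$S_{L,i}:=\sum_k X_{ki},\qquad S(X,L):=\sum_k X_k=(S_{L,1},\ldots,S_{L,m}),$$ the sums being over all $k=(k_1,\ldots,k_d)\in\mathbb{N}^d$ with $1\le k_u\le L_u$ for all $u\in\{1,\ldots,d\}$. Then the following statements hold: (I) For every $i\in\{1,\ldots,m\}$, the quantity $$\sigma_{ii}=\lim_{\min\{L_1,\ldots,L_d\}\to\infty}\frac{E\,S_{L,i}^2}{L_1\cdot L_2\cdots L_d}$$ exists in $[0,\infty)$. (II) For any two distinct elements $i,j\in\{1,\ldots,m\}$, the quantity $$\gamma(i,j)=\lim_{\min\{L_1,\ldots,L_d\}\to\infty}\frac{E(S_{L,i}-S_{L,j})^2}{L_1\cdot L_2\cdots L_d}$$ exists in $[0,\infty)$. (III) Let $\Sigma:=(\sigma_{ij})_{1\le i,j\le m}$ be the $m\times m$ matrix with diagonal entries $\sigma_{ii}$ given in (I) and, for $i\ne j$, $$\sigma_{ij}=\tfrac12\big(\sigma_{ii}+\sigma_{jj}-\gamma(i,j)\big),$$ with $\gamma(i,j)$ given in (II).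 Then $\Sigma$ is symmetric and nonnegative definite, and as $\min\{L_1,L_2,\ldots,L_d\}\to\infty$, $$\frac{S(X,L)}{\sqrt{L_1\cdot L_2\cdots L_d}}\Rightarrow N(0_m,\Sigma),$$ where $\Rightarrow$ denotes convergence in distribution.
   Context: $\mathbb{N}=\{1,2,3,\ldots\}$. All random variables are defined on a probability space $(\Omega,\mathcal{F},P)$. A random field $X=(X_k,k\in\mathbb{Z}^d)$ is strictly stationary if its joint distributions are invariant under shifts of the index by elements of $\mathbb{Z}^d$. For $\sigma$-fields $\mathcal{A},\mathcal{B}\subseteq\mathcal{F}$, the maximal coefficient of correlation is $$\rho(\mathcal{A},\mathcal{B}):=\sup|\mathrm{Corr}(f,g)|,\quad f\in L^2_{\mathrm{real}}(\mathcal{A}),\ g\in L^2_{\mathrm{real}}(\mathcal{B}),$$ where $L^2_{\mathrm{real}}(\mathcal{A})$ is the set of real-valued, square-integrable, $\mathcal{A}$-measurable random variables (pairs with a degenerate member contribute $0$). For a strictly stationary random field $X=(X_k,k\in\mathbb{Z}^d)$ and a positive integer $n$, $$\rho'(n)=\rho'(X,n):=\sup\rho(\sigma(X_k,k\in Q),\sigma(X_k,k\in S)),$$ where the supremum is over all pairs of nonempty, finite, disjoint sets $Q,S\subset\mathbb{Z}^d$ with the following property: there exist $u\in\{1,\ldots,d\}$ and nonempty disjoint sets $A,B\subset\mathbb{Z}$ with $\mathrm{dist}(A,B):=\min_{a\in A,b\in B}|a-b|\ge n$ such that $Q\subset\{k=(k_1,\ldots,k_d)\in\mathbb{Z}^d: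 k_u\in A\}$ and $S\subset\{k=(k_1,\ldots,k_d)\in\mathbb{Z}^d: k_u\in B\}$. The random field $X$ is $\rho'$-mixing if $\rho'(n)\to0$ as $n\to\infty$. $0_m$ is the zero vector of $\mathbb{R}^m$, and $N(0_m,\Sigma)$ is the (possibly degenerate) centered normal law on $\mathbb{R}^m$ with covariance matrix $\Sigma$. For an array $(a(L),L\in\mathbb{N}^d)$, the limit as $\min\{L_1,\ldots,L_d\}\to\infty$ is taken along all $L\in\mathbb{N}^d$ with all coordinates tending to infinity, in an arbitrary manner relative to each other. *)

theory Defs
  imports "HOL-Probability.Probability"
begin

section \<open>Strictly stationary random fields\<close>

text \<open>Invariance of all finite-dimensional distributions, with the index set of the
  product measure kept at the unshifted \<open>J\<close>.\<close>

definition strictly_stationary ::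
    "'a measure \<Rightarrow> (int ^ 'd::finite \<Rightarrow> 'a \<Rightarrow> real ^ 'm::finite) \<Rightarrow> bool" where
  "strictly_stationary M X \<longleftrightarrow>
     (\<forall>k. X k \<in> borel_measurable M) \<and>
     (\<forall>h J. finite J \<longrightarrow>
        distr M (Pi\<^sub>M J (\<lambda>_. borel)) (\<lambda>\<omega>. \<lambda>k\<in>J. X (k + h) \<omega>) =
        distr M (Pi\<^sub>M J (\<lambda>_. borel)) (\<lambda>\<omega>. \<lambda>k\<in>J. X k \<omega>))"


section \<open>Maximal correlation\<close>

text \<open>If one of the variables is degenerate, the denominator vanishes and \<open>corr\<close> is \<open>0\<close>,
  because division by zero yields zero.\<close>

definition corr :: "'a measure \<Rightarrow> ('a \<Rightarrow> real) \<Rightarrow> ('a \<Rightarrow> real) \<Rightarrow> real" where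
  "corr M f g =
     prob_space.expectation M
       (\<lambda>\<omega>. (f \<omega> - prob_space.expectation M f) * (g \<omega> - prob_space.expectation M g)) /
     (sqrt (prob_space.variance M f) * sqrt (prob_space.variance M g))"

definition L2_real :: "'a measure \<Rightarrow> 'a measure \<Rightarrow> ('a \<Rightarrow> real) set" where
  "L2_real M A = {f \<in> borel_measurable A. integrable M (\<lambda>\<omega>. (f \<omega>)\<^sup>2)}"

text \<open>A sub-\<open>\<sigma>\<close>-field is represented by a measure on the same space of which only the
  measurable sets matter. The suprema are taken in \<^typ>\<open>ereal\<close>, where they always exist.\<close>

definition max_corr :: "'a measure \<Rightarrow> 'a measure \<Rightarrow> 'a measure \<Rightarrow> ereal" where
  "max_corr M A B = (SUP (f, g) \<in> L2_real M A \<times> L2_real M B. ereal \<bar>corr M f g\<bar>)"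

definition gen_field ::
    "'a measure \<Rightarrow> ('k \<Rightarrow> 'a \<Rightarrow> 'b::topological_space) \<Rightarrow> 'k set \<Rightarrow> 'a measure" where
  "gen_field M X Q = sigma (space M) (\<Union>k\<in>Q. {X k -` B \<inter> space M | B. B \<in> sets borel})"

definition separated_pairs :: "nat \<Rightarrow> ((int ^ 'd::finite) set \<times> (int ^ 'd) set) set" where
  "separated_pairs n =
     {(Q, S). Q \<noteq> {} \<and> finite Q \<and> S \<noteq> {} \<and> finite S \<and> Q \<inter> S = {} \<and>
        (\<exists>u A B. A \<noteq> {} \<and> B \<noteq> {} \<and> A \<inter> B = {} \<and>
           (\<forall>a\<in>A. \<forall>b\<in>B. int n \<le> \<bar>a - b\<bar>) \<and>
           Q \<subseteq> {k. k $ u \<in> A} \<and> S \<subseteq> {k. k $ u \<in> B})}"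

definition rho' ::
    "'a measure \<Rightarrow> (int ^ 'd::finite \<Rightarrow> 'a \<Rightarrow> real ^ 'm::finite) \<Rightarrow> nat \<Rightarrow> ereal" where
  "rho' M X n =
     (SUP (Q, S) \<in> separated_pairs n. max_corr M (gen_field M X Q) (gen_field M X S))"

definition rho'_mixing ::
    "'a measure \<Rightarrow> (int ^ 'd::finite \<Rightarrow> 'a \<Rightarrow> real ^ 'm::finite) \<Rightarrow> bool" where
  "rho'_mixing M X \<longleftrightarrow> rho' M X \<longlonglongrightarrow> 0"


section \<open>Partial sums over boxes\<close>

definition index_box :: "nat ^ 'd::finite \<Rightarrow> (int ^ 'd) set" where
  "index_box L = {k. \<forall>u. 1 \<le> k $ u \<and> k $ u \<le> int (L $ u)}"

definition partial_sum ::
    "(int ^ 'd::finite \<Rightarrow> 'a \<Rightarrow> real ^ 'm::finite) \<Rightarrow> nat ^ 'd \<Rightarrow> 'a \<Rightarrow> real ^ 'm" where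
  "partial_sum X L \<omega> = (\<Sum>k\<in>index_box L. X k \<omega>)"

definition box_volume :: "nat ^ 'd::finite \<Rightarrow> real" where
  "box_volume L = (\<Prod>u\<in>UNIV. real (L $ u))"

text \<open>The filter of \<open>min {L\<^sub>1, \<dots>, L\<^sub>d} \<rightarrow> \<infinity>\<close>. Multi-indices with a zero coordinate are
  eventually excluded.\<close>

definition min_at_top :: "(nat ^ 'd::finite) filter" where
  "min_at_top = filtercomap (\<lambda>L. Min (range (\<lambda>u. L $ u))) at_top"

lemma finite_index_box: "finite (index_box L)"
proof -
  have "index_box L \<subseteq> vec_lambda ` (\<Pi>\<^sub>E u\<in>UNIV. {1..int (L $ u)})"
  proof
    fix k assume "k \<in> index_box L"
    then have "(\<lambda>u. k $ u) \<in> (\<Pi>\<^sub>E u\<in>UNIV. {1..int (L $ u)})"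
      by (auto simp: index_box_def)
    moreover have "k = vec_lambda (\<lambda>u. k $ u)" by simp
    ultimately show "k \<in> vec_lambda ` (\<Pi>\<^sub>E u\<in>UNIV. {1..int (L $ u)})" by blast
  qed
  then show ?thesis
    by (rule finite_subset) (simp add: finite_PiE)
qed

lemma eventually_min_at_top:
  "eventually P min_at_top \<longleftrightarrow> (\<exists>N. \<forall>L. (\<forall>u. N \<le> L $ u) \<longrightarrow> P L)"
  unfolding min_at_top_def eventually_filtercomap_at_top_linorder by simp

lemma min_at_top_neq_bot: "(min_at_top :: (nat ^ 'd::finite) filter) \<noteq> bot"
proof -
  have "\<exists>L :: nat ^ 'd. \<forall>u. N \<le> L $ u" for N
    by (rule exI[of _ "\<chi> u. N"]) simp
  then show ?thesis
    by (auto simp: trivial_limit_def eventually_min_at_top)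
qed


section \<open>Weak convergence and centered normal laws on \<open>\<real>\<^sup>m\<close>\<close>

definition weakly_converges ::
    "('i \<Rightarrow> 'b::topological_space measure) \<Rightarrow> 'b measure \<Rightarrow> 'i filter \<Rightarrow> bool" where
  "weakly_converges \<mu> \<nu> F \<longleftrightarrow>
     (\<forall>f :: 'b \<Rightarrow> real. continuous_on UNIV f \<and> bounded (range f) \<longrightarrow>
        ((\<lambda>i. \<integral>x. f x \<partial>\<mu> i) \<longlongrightarrow> (\<integral>x. f x \<partial>\<nu>)) F)"

definition normal_law :: "real \<Rightarrow> real \<Rightarrow> real measure" where
  "normal_law c s = (if s = 0 then return borel c else density lborel (normal_density c s))"

text \<open>A law on \<open>\<real>\<^sup>m\<close> is normal iff all its one-dimensional projections are (possibly
  degenerate) normal laws; all moments of such a law exist.\<close>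

definition multivariate_normal :: "(real ^ 'm::finite) measure \<Rightarrow> bool" where
  "multivariate_normal \<nu> \<longleftrightarrow> prob_space \<nu> \<and> sets \<nu> = sets borel \<and>
     (\<forall>t. \<exists>c s. 0 \<le> s \<and> distr \<nu> borel (\<lambda>x. t \<bullet> x) = normal_law c s)"

definition is_centered_normal :: "(real ^ 'm::finite) measure \<Rightarrow> real ^ 'm ^ 'm \<Rightarrow> bool" where
  "is_centered_normal \<nu> \<Sigma> \<longleftrightarrow> multivariate_normal \<nu> \<and>
     (\<forall>i. (\<integral>x. x $ i \<partial>\<nu>) = 0) \<and>
     (\<forall>i j. (\<integral>x. x $ i * x $ j \<partial>\<nu>) = \<Sigma> $ i $ j)"

definition nonneg_definite :: "real ^ 'm ^ 'm::finite \<Rightarrow> bool" where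
  "nonneg_definite A \<longleftrightarrow> (\<forall>x. 0 \<le> x \<bullet> (A *v x))"

end

theory Submission
  imports Defs
begin

text \<open>
  The argument compares a sum \<open>A + B\<close> with the difference \<open>A - B\<close>. If the sites are grouped into
  slabs that are pairwise far apart in one coordinate, then for every bipartition of the slabs the two
  half sums \<open>A\<close> and \<open>B\<close> have small maximal correlation \<open>r\<close>, whatever the number of slabs and however
  the two halves are interlaced. For such a pair the second moments of \<open>A + B\<close> and \<open>A - B\<close> agree up
  to the factor \<open>(1 + r) / (1 - r)\<close>, and the fourth moment of \<open>A + B\<close> is at most a constant times
  that of \<open>A - B\<close> (\<open>corr_bound_power4\<close>). Averaging over all bipartitions turns \<open>A - B\<close> into a sum with
  random signs, for which the moments are explicit. So sums over separated slabs behave like sums of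
  orthogonal variables, with constants that tend to \<open>1\<close> with \<open>r \<rightarrow> 0\<close> in the case of second moments
  (\<open>family_square_bounds\<close>, \<open>family_power4_bound\<close>). Slicing along one coordinate after the other,
  inside a residue class modulo a fixed \<open>n\<close>, gives bounds for sums over arbitrary finite sets \<open>Q\<close>:
  the variance is \<open>O(|Q|)\<close>, and the fourth moment is \<open>O(|Q|\<^sup>2)\<close> for bounded observables
  (\<open>second_moment_bound\<close>, \<open>fourth_moment_bound\<close>).

  For the limiting variance of a scalar observable, a long side \<open>L\<^sub>u\<close> of the box is cut into slabs of
  thickness \<open>q\<close> with gaps \<open>n\<close>, where \<open>n\<close> is small compared with \<open>q\<close> and \<open>q\<close> with \<open>L\<^sub>u\<close>. The gaps are
  negligible and the slabs almost orthogonal, so the normalized variance hardly changes when \<open>L\<^sub>u\<close> is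
  replaced by \<open>q\<close>, uniformly in the other sides (\<open>variance_step\<close>). Doing this for each side compares
  every large box with the same cube, which is the Cauchy property (\<open>variance_limit\<close>).

  For the central limit theorem the side \<open>L\<^sub>u\<close> is cut into a fixed number \<open>p\<close> of slabs. As the box grows,
  the gap can grow too, and the characteristic function at \<open>L\<close> approaches the \<open>p\<close>-th power of that of
  one slab. By truncation and the two moment bounds, the squares of the normalized sums are uniformly
  integrable. Hence the second-order expansion of the characteristic function of a slab has an
  error \<open>o(1 / p)\<close> uniformly in the box, and \<open>p \<rightarrow> \<infinity>\<close> produces the Gaussian limit
  (\<open>char_slab_step\<close>, \<open>scalar_clt\<close>).

  The vector case is the scalar one for all \<open>x \<mapsto> t \<bullet> x\<close>: it identifies the limit of every
  characteristic function. Bounded second moments then give weak convergence, because a bounded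
  continuous function differs from some trigonometric polynomial by at most a small constant plus a
  small multiple of the squared norm (\<open>weakly_converges_of_char\<close>). The limit law is the image of
  independent standard normal variables under a linear map (\<open>ex_centered_normal\<close>).
\<close>


section \<open>Square-integrable random variables\<close>

lemma L2_real_iff:
  "f \<in> L2_real M M \<longleftrightarrow> f \<in> borel_measurable M \<and> integrable M (\<lambda>s. (f s)\<^sup>2)"
  by (simp add: L2_real_def)

lemma L2_borel [measurable_dest]: "f \<in> L2_real M M \<Longrightarrow> f \<in> borel_measurable M"
  by (simp add: L2_real_iff)

lemma L2_integrable_square: "f \<in> L2_real M M \<Longrightarrow> integrable M (\<lambda>s. (f s)\<^sup>2)"
  by (simp add: L2_real_iff)

lemma L2_integrable_mult:
  assumes "f \<in> L2_real M M" "g \<in> L2_real M M"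
  shows "integrable M (\<lambda>s. f s * g s)"
proof (rule Bochner_Integration.integrable_bound)
  show "integrable M (\<lambda>s. (f s)\<^sup>2 + (g s)\<^sup>2)"
    using assms by (simp add: L2_integrable_square)
  show "(\<lambda>s. f s * g s) \<in> borel_measurable M"
    using assms by (simp add: L2_borel)
  show "AE s in M. norm (f s * g s) \<le> norm ((f s)\<^sup>2 + (g s)\<^sup>2)"
  proof (rule AE_I2)
    fix s
    have "\<bar>f s * g s\<bar> \<le> (f s)\<^sup>2 + (g s)\<^sup>2"
      using sum_squares_bound[of "\<bar>f s\<bar>" "\<bar>g s\<bar>"] mult_nonneg_nonneg[OF abs_ge_zero[of "f s"] abs_ge_zero[of "g s"]]
      unfolding abs_mult power2_abs by linarith
    then show "norm (f s * g s) \<le> norm ((f s)\<^sup>2 + (g s)\<^sup>2)" by simp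
  qed
qed

lemma L2_add: "f \<in> L2_real M M \<Longrightarrow> g \<in> L2_real M M \<Longrightarrow> (\<lambda>s. f s + g s) \<in> L2_real M M"
  using L2_integrable_mult[of f M g]
  by (simp add: L2_real_iff power2_sum mult.assoc borel_measurable_add)

lemma L2_cmult: "f \<in> L2_real M M \<Longrightarrow> (\<lambda>s. c * f s) \<in> L2_real M M"
  by (simp add: L2_real_iff power_mult_distrib borel_measurable_times)

lemma L2_diff: "f \<in> L2_real M M \<Longrightarrow> g \<in> L2_real M M \<Longrightarrow> (\<lambda>s. f s - g s) \<in> L2_real M M"
  using L2_add[of f M "\<lambda>s. (-1) * g s"] L2_cmult[of g M "-1"] by simp

lemma L2_sum: "(\<And>i. i \<in> I \<Longrightarrow> f i \<in> L2_real M M) \<Longrightarrow> (\<lambda>s. \<Sum>i\<in>I. f i s) \<in> L2_real M M"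
proof (induction I rule: infinite_finite_induct)
  case (insert x F)
  then show ?case using L2_add[of "f x" M "\<lambda>s. \<Sum>i\<in>F. f i s"] by simp
qed (simp_all add: L2_real_iff)

context prob_space
begin

abbreviation E :: "('a \<Rightarrow> real) \<Rightarrow> real" where "E f \<equiv> expectation f"

abbreviation mean_sq :: "('a \<Rightarrow> real) \<Rightarrow> real" where "mean_sq f \<equiv> E (\<lambda>s. (f s)\<^sup>2)"

lemma L2_integrable: "f \<in> L2_real M M \<Longrightarrow> integrable M f"
  using square_integrable_imp_integrable by (auto simp: L2_real_iff)

lemma L2_bounded:
  assumes "f \<in> borel_measurable M" "\<And>s. \<bar>f s\<bar> \<le> c"
  shows "f \<in> L2_real M M"
proof -
  have "(f s)\<^sup>2 \<le> c\<^sup>2" for s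
    using assms(2)[of s] by (metis abs_ge_zero power2_abs power_mono)
  then show ?thesis
    using assms by (auto simp: L2_real_iff intro!: integrable_const_bound[where B="c\<^sup>2"])
qed

lemma L2_Cauchy_Schwarz:
  assumes f: "f \<in> L2_real M M" and g: "g \<in> L2_real M M"
  shows "(E (\<lambda>s. f s * g s))\<^sup>2 \<le> mean_sq f * mean_sq g"
proof -
  define a b c where "a = mean_sq f" and "b = E (\<lambda>s. f s * g s)"
    and "c = mean_sq g"
  have q: "0 \<le> x\<^sup>2 * a + 2 * x * y * b + y\<^sup>2 * c" for x y
  proof -
    have "0 \<le> E (\<lambda>s. (x * f s + y * g s)\<^sup>2)" by simp
    also have "\<dots> = E (\<lambda>s. x\<^sup>2 * (f s)\<^sup>2 + 2 * x * y * (f s * g s) + y\<^sup>2 * (g s)\<^sup>2)"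
      by (intro Bochner_Integration.integral_cong refl) (simp add: power2_eq_square algebra_simps)
    also have "\<dots> = x\<^sup>2 * a + 2 * x * y * b + y\<^sup>2 * c"
      using L2_integrable_square[OF f] L2_integrable_square[OF g] L2_integrable_mult[OF f g]
      by (simp add: a_def b_def c_def)
    finally show ?thesis .
  qed
  have "0 \<le> a" "0 \<le> c" by (simp_all add: a_def c_def)
  show ?thesis
  proof (cases "a = 0")
    case True
    \<comment> \<open>This choice turns the form into \<open>- 2 (c + 1) b\<^sup>2 + c b\<^sup>2\<close>.\<close>
    have "0 \<le> - ((c + 2) * b\<^sup>2)"
      using q[of "- (c + 1)" b] True by (simp add: power2_eq_square algebra_simps)
    then have "b = 0"
      using \<open>0 \<le> c\<close> by (auto simp: mult_le_0_iff)
    then show ?thesis using True by (simp add: a_def b_def)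
  next
    case False
    then have "0 < a" using \<open>0 \<le> a\<close> by simp
    have "0 \<le> b\<^sup>2 * a + 2 * b * (-a) * b + a\<^sup>2 * c" using q[of b "-a"] by simp
    then have "0 \<le> a * (a * c - b\<^sup>2)" by (simp add: power2_eq_square algebra_simps)
    then show ?thesis using \<open>0 < a\<close> by (simp add: zero_le_mult_iff a_def b_def c_def)
  qed
qed

lemma L2_Cauchy_Schwarz_sqrt:
  assumes "f \<in> L2_real M M" "g \<in> L2_real M M"
  shows "\<bar>E (\<lambda>s. f s * g s)\<bar> \<le>
    sqrt (mean_sq f) * sqrt (mean_sq g)"
  using real_sqrt_le_mono[OF L2_Cauchy_Schwarz[OF assms]] by (simp add: real_sqrt_mult)

lemma L2_expectation_square_le:
  assumes "f \<in> L2_real M M"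
  shows "(E f)\<^sup>2 \<le> mean_sq f"
  using L2_Cauchy_Schwarz[OF assms L2_bounded[of "\<lambda>_. 1" 1]] by (simp add: prob_space)

lemma L2_square_add_le:
  assumes "f \<in> L2_real M M" "g \<in> L2_real M M"
  shows "E (\<lambda>s. (f s + g s)\<^sup>2) \<le> 2 * mean_sq f + 2 * mean_sq g"
proof -
  have "E (\<lambda>s. (f s + g s)\<^sup>2) \<le> E (\<lambda>s. 2 * (f s)\<^sup>2 + 2 * (g s)\<^sup>2)"
  proof (rule integral_mono)
    show "integrable M (\<lambda>s. (f s + g s)\<^sup>2)" using L2_integrable_square[OF L2_add[OF assms]] .
    show "integrable M (\<lambda>s. 2 * (f s)\<^sup>2 + 2 * (g s)\<^sup>2)" using assms by (simp add: L2_integrable_square)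
    show "(f s + g s)\<^sup>2 \<le> 2 * (f s)\<^sup>2 + 2 * (g s)\<^sup>2" for s
      using sum_squares_bound[of "f s" "g s"] by (simp add: power2_sum)
  qed
  then show ?thesis using assms by (simp add: L2_integrable_square)
qed

end

section \<open>Averaging over signs\<close>

text \<open>A choice of signs is encoded by the set \<open>A\<close> of the indices with sign plus, so that taking the mean over
  independent random signs becomes summation over \<open>Pow J\<close>.\<close>

definition signed_sum :: "('j \<Rightarrow> real) \<Rightarrow> 'j set \<Rightarrow> 'j set \<Rightarrow> real" where
  "signed_sum x J A = (\<Sum>j\<in>A. x j) - (\<Sum>j\<in>J - A. x j)"

lemma sum_Pow_insert:
  assumes "finite F" "a \<notin> F"
  shows "(\<Sum>A\<in>Pow (insert a F). f A) = (\<Sum>A\<in>Pow F. f A + f (insert a A))"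
proof -
  have "inj_on (insert a) (Pow F)" using assms(2) by (auto simp: inj_on_def) 
  moreover have "Pow F \<inter> insert a ` Pow F = {}" using assms(2) by auto
  ultimately show ?thesis
    using assms by (simp add: Pow_insert sum.union_disjoint sum.reindex sum.distrib)
qed

lemma signed_sum_insert:
  assumes "finite F" "a \<notin> F" "A \<subseteq> F"
  shows "signed_sum x (insert a F) A = signed_sum x F A - x a"
    and "signed_sum x (insert a F) (insert a A) = signed_sum x F A + x a"
proof -
  have "finite A" "a \<notin> A" using assms finite_subset by auto
  moreover have "insert a F - A = insert a (F - A)" "insert a F - insert a A = F - A"
    using assms by auto
  ultimately show "signed_sum x (insert a F) A = signed_sum x F A - x a"
    and "signed_sum x (insert a F) (insert a A) = signed_sum x F A + x a"
    using assms by (simp_all add: signed_sum_def)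
qed

lemma sum_signed_sum_power2:
  "finite J \<Longrightarrow> (\<Sum>A\<in>Pow J. (signed_sum x J A)\<^sup>2) = 2 ^ card J * (\<Sum>j\<in>J. (x j)\<^sup>2)"
proof (induction J rule: finite_induct)
  case empty
  then show ?case by (simp add: signed_sum_def)
next
  case (insert a F)
  have "(\<Sum>A\<in>Pow (insert a F). (signed_sum x (insert a F) A)\<^sup>2)
      = (\<Sum>A\<in>Pow F. 2 * (signed_sum x F A)\<^sup>2 + 2 * (x a)\<^sup>2)"
    unfolding sum_Pow_insert[OF insert.hyps]
    by (rule sum.cong) (auto simp: signed_sum_insert insert.hyps power2_eq_square algebra_simps)
  also have "\<dots> = 2 * (\<Sum>A\<in>Pow F. (signed_sum x F A)\<^sup>2) + 2 * 2 ^ card F * (x a)\<^sup>2"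
    using insert.hyps by (simp add: sum.distrib sum_distrib_left card_Pow)
  finally show ?case using insert by (simp add: algebra_simps)
qed

text \<open>Khinchine's inequality for the fourth power. The constant \<open>3\<close> is the one for which
  the mixed terms in the induction step agree.\<close>

lemma sum_signed_sum_power4:
  "finite J \<Longrightarrow> (\<Sum>A\<in>Pow J. (signed_sum x J A)^4) \<le> 3 * 2 ^ card J * (\<Sum>j\<in>J. (x j)\<^sup>2)\<^sup>2"
proof (induction J rule: finite_induct)
  case empty
  then show ?case by (simp add: signed_sum_def)
next
  case (insert a F)
  have "(\<Sum>A\<in>Pow (insert a F). (signed_sum x (insert a F) A)^4)
      = (\<Sum>A\<in>Pow F. 2 * (signed_sum x F A)^4 + 12 * (x a)\<^sup>2 * (signed_sum x F A)\<^sup>2 + 2 * (x a)^4)"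
    unfolding sum_Pow_insert[OF insert.hyps]
    by (rule sum.cong) (auto simp: signed_sum_insert insert.hyps eval_nat_numeral algebra_simps)
  also have "\<dots> = 2 * (\<Sum>A\<in>Pow F. (signed_sum x F A)^4)
      + 12 * (x a)\<^sup>2 * (2 ^ card F * (\<Sum>j\<in>F. (x j)\<^sup>2)) + 2 * 2 ^ card F * (x a)^4"
    using insert.hyps by (simp add: sum.distrib sum_distrib_left[symmetric] card_Pow sum_signed_sum_power2)
  also have "\<dots> \<le> 6 * 2 ^ card F * (\<Sum>j\<in>F. (x j)\<^sup>2)\<^sup>2
      + 12 * (x a)\<^sup>2 * (2 ^ card F * (\<Sum>j\<in>F. (x j)\<^sup>2)) + 6 * 2 ^ card F * (x a)^4"
  proof -
    have "0 \<le> 2 ^ card F * x a ^ 4" by simp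
    then show ?thesis using insert.IH by linarith
  qed
  also have "\<dots> = 3 * 2 ^ card (insert a F) * (\<Sum>j\<in>insert a F. (x j)\<^sup>2)\<^sup>2"
    using insert.hyps by (simp add: eval_nat_numeral algebra_simps)
  finally show ?case .
qed

section \<open>Pairs of random variables with small maximal correlation\<close>

text \<open>The maximal correlation of the \<open>\<sigma>\<close>-fields generated by \<open>U\<close> and \<open>V\<close> is at most \<open>r\<close>. Second moments stand
  in for variances, which is equivalent (subtract constants from \<open>f\<close> and \<open>g\<close>), and the product
  form gives degenerate variables no special status.\<close>

definition corr_bound :: "'a measure \<Rightarrow> real \<Rightarrow> ('a \<Rightarrow> real) \<Rightarrow> ('a \<Rightarrow> real) \<Rightarrow> bool" where
  "corr_bound M r U V \<longleftrightarrow>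
     (\<forall>f \<in> borel_measurable borel. \<forall>g \<in> borel_measurable borel.
        (\<lambda>s. f (U s)) \<in> L2_real M M \<longrightarrow> (\<lambda>s. g (V s)) \<in> L2_real M M \<longrightarrow>
        \<bar>(\<integral>s. f (U s) * g (V s) \<partial>M) - (\<integral>s. f (U s) \<partial>M) * (\<integral>s. g (V s) \<partial>M)\<bar> \<le>
          r * (sqrt (\<integral>s. (f (U s))\<^sup>2 \<partial>M) * sqrt (\<integral>s. (g (V s))\<^sup>2 \<partial>M)))"

lemma corr_boundD:
  assumes "corr_bound M r U V" "f \<in> borel_measurable borel" "g \<in> borel_measurable borel"
    and "(\<lambda>s. f (U s)) \<in> L2_real M M" "(\<lambda>s. g (V s)) \<in> L2_real M M"
  shows "\<bar>(\<integral>s. f (U s) * g (V s) \<partial>M) - (\<integral>s. f (U s) \<partial>M) * (\<integral>s. g (V s) \<partial>M)\<bar> \<le>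
          r * (sqrt (\<integral>s. (f (U s))\<^sup>2 \<partial>M) * sqrt (\<integral>s. (g (V s))\<^sup>2 \<partial>M))"
  using assms unfolding corr_bound_def by blast

context prob_space
begin

lemma corr_bound_sym:
  assumes "corr_bound M r U V"
  shows "corr_bound M r V U"
  unfolding corr_bound_def
proof (intro ballI impI)
  fix f g :: "real \<Rightarrow> real"
  assume "f \<in> borel_measurable borel" "g \<in> borel_measurable borel"
    "(\<lambda>s. f (V s)) \<in> L2_real M M" "(\<lambda>s. g (U s)) \<in> L2_real M M"
  from corr_boundD[OF assms this(2,1,4,3)]
  show "\<bar>E (\<lambda>s. f (V s) * g (U s)) - E (\<lambda>s. f (V s)) * E (\<lambda>s. g (U s))\<bar>
    \<le> r * (sqrt (E (\<lambda>s. (f (V s))\<^sup>2)) * sqrt (E (\<lambda>s. (g (U s))\<^sup>2)))"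
    by (simp add: mult.commute)
qed

lemma corr_bound_product:
  assumes "corr_bound M r U V" "0 \<le> r" "U \<in> L2_real M M" "V \<in> L2_real M M" "E U = 0"
  shows "\<bar>E (\<lambda>s. U s * V s)\<bar> \<le>
    r * (mean_sq U + mean_sq V) / 2"
proof -
  define a b where "a = mean_sq U" and "b = mean_sq V"
  have "\<bar>E (\<lambda>s. U s * V s)\<bar> \<le> r * (sqrt a * sqrt b)"
    using corr_boundD[OF assms(1), of "\<lambda>x. x" "\<lambda>x. x"] assms by (simp add: a_def b_def)
  also have "sqrt a * sqrt b \<le> (a + b) / 2"
    using arith_geo_mean_sqrt[of a b] by (simp add: a_def b_def real_sqrt_mult)
  finally show ?thesis using \<open>0 \<le> r\<close> by (simp add: a_def b_def mult_left_mono)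
qed

lemma corr_bound_square_add:
  assumes "corr_bound M r U V" "0 \<le> r" "U \<in> L2_real M M" "V \<in> L2_real M M" "E U = 0"
  shows "E (\<lambda>s. (U s + V s)\<^sup>2) \<le>
      (1 + r) * (mean_sq U + mean_sq V)"
    and "E (\<lambda>s. (U s - V s)\<^sup>2) \<le>
      (1 + r) * (mean_sq U + mean_sq V)"
    and "(1 - r) * (mean_sq U + mean_sq V) \<le>
      E (\<lambda>s. (U s + V s)\<^sup>2)"
    and "(1 - r) * (mean_sq U + mean_sq V) \<le>
      E (\<lambda>s. (U s - V s)\<^sup>2)"
proof -
  note int = L2_integrable_square[OF assms(3)] L2_integrable_square[OF assms(4)]
    L2_integrable_mult[OF assms(3,4)]
  have 1: "E (\<lambda>s. (U s + V s)\<^sup>2) = mean_sq U +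
      mean_sq V + 2 * E (\<lambda>s. U s * V s)"
    using int by (simp add: power2_sum mult.assoc)
  have 2: "E (\<lambda>s. (U s - V s)\<^sup>2) = mean_sq U +
      mean_sq V - 2 * E (\<lambda>s. U s * V s)"
    using int by (simp add: power2_diff mult.assoc)
  note 3 = corr_bound_product[OF assms]
  show "E (\<lambda>s. (U s + V s)\<^sup>2) \<le>
      (1 + r) * (mean_sq U + mean_sq V)"
    "E (\<lambda>s. (U s - V s)\<^sup>2) \<le>
      (1 + r) * (mean_sq U + mean_sq V)"
    "(1 - r) * (mean_sq U + mean_sq V) \<le>
      E (\<lambda>s. (U s + V s)\<^sup>2)"
    "(1 - r) * (mean_sq U + mean_sq V) \<le>
      E (\<lambda>s. (U s - V s)\<^sup>2)"
    using 3 unfolding 1 2 by (simp_all add: distrib_right left_diff_distrib abs_le_iff)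
qed

text \<open>The layer-cake formula, with the weight \<open>4 x\<^sup>3\<close> as the derivative of \<open>x\<^sup>4\<close>.\<close>

lemma nn_integral_tail_power4:
  assumes [measurable]: "Z \<in> borel_measurable M" and nonneg: "\<And>s. 0 \<le> Z s"
  shows "(\<integral>\<^sup>+x. ennreal (4 * x ^ 3) * indicator {0..} x * emeasure M {s \<in> space M. x \<le> Z s} \<partial>lborel)
    = (\<integral>\<^sup>+s. ennreal (Z s ^ 4) \<partial>M)"
proof -
  interpret L: pair_sigma_finite lborel M by standard
  have inner: "(\<integral>\<^sup>+x. ennreal (4 * x ^ 3) * indicator {0..z} x \<partial>lborel) = ennreal (z ^ 4)"
    if "0 \<le> z" for z :: real
  proof -
    have "(\<integral>\<^sup>+x. ennreal (4 * x ^ 3) * indicator {0..z} x \<partial>lborel) = ennreal (z ^ 4 - 0 ^ 4)"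
      by (rule nn_integral_FTC_Icc) (use that in \<open>auto intro!: derivative_eq_intros\<close>)
    then show ?thesis by simp
  qed
  have "(\<integral>\<^sup>+x. ennreal (4 * x ^ 3) * indicator {0..} x * emeasure M {s \<in> space M. x \<le> Z s} \<partial>lborel)
     = (\<integral>\<^sup>+x. (\<integral>\<^sup>+s. ennreal (4 * x ^ 3) * indicator {0..} x * indicator {s \<in> space M. x \<le> Z s} s \<partial>M) \<partial>lborel)"
    by (intro nn_integral_cong) (simp add: nn_integral_cmult_indicator)
  also have "\<dots> = (\<integral>\<^sup>+s. (\<integral>\<^sup>+x. ennreal (4 * x ^ 3) * indicator {0..} x * indicator {s \<in> space M. x \<le> Z s} s \<partial>lborel) \<partial>M)"
    by (rule L.Fubini'[symmetric]) measurable
  also have "\<dots> = (\<integral>\<^sup>+s. (\<integral>\<^sup>+x. ennreal (4 * x ^ 3) * indicator {0..Z s} x \<partial>lborel) \<partial>M)"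
    by (intro nn_integral_cong) (auto simp: indicator_def)
  also have "\<dots> = (\<integral>\<^sup>+s. ennreal (Z s ^ 4) \<partial>M)"
    by (intro nn_integral_cong) (simp add: inner nonneg)
  finally show ?thesis .
qed

text \<open>If \<open>|U| \<ge> 2 x\<close> but \<open>|U - V| < x\<close>, then \<open>|V| \<ge> x\<close>. With \<open>a\<close> and \<open>b\<close> the probabilities of
  \<open>|U| \<ge> 2 x\<close> and \<open>|V| \<ge> x\<close>, both events occur together with probability at most
  \<open>a b + r sqrt (a b)\<close>. Beyond twice the \<open>L\<^sup>2\<close>-norm of \<open>V\<close>, Chebyshev's inequality gives \<open>b \<le> 1 / 4\<close>; below it
  the indicator on the right makes the inequality trivial.\<close>

lemma tail_le_of_corr_bound:
  assumes cb: "corr_bound M r U V" and r: "0 \<le> r"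
    and U: "U \<in> borel_measurable M" and V: "V \<in> L2_real M M"
    and x: "0 \<le> x"
  shows "prob {s \<in> space M. x \<le> \<bar>U s\<bar> / 2} \<le>
    prob {s \<in> space M. x \<le> \<bar>U s - V s\<bar>} + prob {s \<in> space M. x \<le> \<bar>U s\<bar> / 2} / 4
    + indicator {0..2 * sqrt (mean_sq V)} x
    + r / 2 * (prob {s \<in> space M. x \<le> \<bar>U s\<bar> / 2} + prob {s \<in> space M. x \<le> \<bar>V s\<bar>})"
    (is "?a \<le> ?d + ?a / 4 + ?i + r / 2 * (?a + ?b)")
proof -
  have [measurable]: "U \<in> borel_measurable M" "V \<in> borel_measurable M"
    using U V by (auto simp: L2_real_iff)
  define f where "f = (indicator {u. x \<le> \<bar>u\<bar> / 2} :: real \<Rightarrow> real)"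
  define g where "g = (indicator {v. x \<le> \<bar>v\<bar>} :: real \<Rightarrow> real)"
  have [measurable]: "f \<in> borel_measurable borel" "g \<in> borel_measurable borel"
    unfolding f_def g_def by measurable
  have fU: "f (U s) = indicator {s \<in> space M. x \<le> \<bar>U s\<bar> / 2} s" if "s \<in> space M" for s
    using that by (simp add: f_def indicator_def)
  have gV: "g (V s) = indicator {s \<in> space M. x \<le> \<bar>V s\<bar>} s" if "s \<in> space M" for s
    using that by (simp add: g_def indicator_def)
  have sq: "(f u)\<^sup>2 = f u" "(g u)\<^sup>2 = g u" for u by (simp_all add: f_def g_def indicator_def)
  have Ef: "E (\<lambda>s. f (U s)) = ?a"
    by (subst Bochner_Integration.integral_cong[OF refl fU]) simp_all
  have Eg: "E (\<lambda>s. g (V s)) = ?b"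
    by (subst Bochner_Integration.integral_cong[OF refl gV]) simp_all
  have Efg: "E (\<lambda>s. f (U s) * g (V s)) = prob {s \<in> space M. x \<le> \<bar>U s\<bar> / 2 \<and> x \<le> \<bar>V s\<bar>}" (is "_ = ?j")
  proof -
    have "E (\<lambda>s. f (U s) * g (V s)) =
      E (indicator {s \<in> space M. x \<le> \<bar>U s\<bar> / 2 \<and> x \<le> \<bar>V s\<bar>})"
      by (intro Bochner_Integration.integral_cong refl) (auto simp: f_def g_def indicator_def)
    then show ?thesis by simp
  qed
  have "(\<lambda>s. f (U s)) \<in> L2_real M M" "(\<lambda>s. g (V s)) \<in> L2_real M M"
    by (rule L2_bounded[where c=1]; simp add: f_def g_def indicator_def)+
  from corr_boundD[OF cb _ _ this]
  have "\<bar>?j - ?a * ?b\<bar> \<le> r * (sqrt ?a * sqrt ?b)"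
    by (simp add: sq Ef Eg Efg)
  moreover have "sqrt ?a * sqrt ?b \<le> (?a + ?b) / 2"
    using arith_geo_mean_sqrt[of ?a ?b] by (simp add: real_sqrt_mult)
  ultimately have j: "?j \<le> ?a * ?b + r / 2 * (?a + ?b)"
  proof -
    assume 1: "\<bar>?j - ?a * ?b\<bar> \<le> r * (sqrt ?a * sqrt ?b)" and 2: "sqrt ?a * sqrt ?b \<le> (?a + ?b) / 2"
    have "r * (sqrt ?a * sqrt ?b) \<le> r * ((?a + ?b) / 2)" by (rule mult_left_mono[OF 2 r])
    also have "\<dots> = r / 2 * (?a + ?b)" by simp
    finally show ?thesis using 1 by linarith
  qed
  have "?a \<le> prob ({s \<in> space M. x \<le> \<bar>U s - V s\<bar>} \<union> {s \<in> space M. x \<le> \<bar>U s\<bar> / 2 \<and> x \<le> \<bar>V s\<bar>})"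
    by (intro finite_measure_mono) auto
  also have "\<dots> \<le> ?d + ?j" by (intro measure_Un_le) auto
  finally have a: "?a \<le> ?d + ?j" .
  have "?a * ?b \<le> ?a / 4 + ?i"
  proof (cases "x \<le> 2 * sqrt (mean_sq V)")
    case True
    have "?a * ?b \<le> 1 * 1" by (intro mult_mono) auto
    moreover have "0 \<le> ?a" by simp
    ultimately show ?thesis using True x by (simp only: indicator_simps atLeastAtMost_iff)
  next
    case False
    define v where "v = mean_sq V"
    have v: "0 \<le> v" by (simp add: v_def)
    have x0: "2 * sqrt v < x" using False by (simp add: v_def)
    have "0 < x" using x0 v by (smt (verit) real_sqrt_ge_zero)
    have "4 * v \<le> x\<^sup>2"
      using power_mono[of "2 * sqrt v" x 2] x0 v by (simp add: power_mult_distrib)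
    have "?b = prob {s \<in> space M. x\<^sup>2 \<le> (V s)\<^sup>2}"
      using \<open>0 < x\<close> by (simp add: abs_le_square_iff[symmetric])
    also have "\<dots> \<le> v / x\<^sup>2"
      using integral_Markov_inequality_measure[OF L2_integrable_square[OF V], of "{}" "x\<^sup>2"] \<open>0 < x\<close>
      by (simp add: v_def)
    also have "\<dots> \<le> 1 / 4"
      using \<open>4 * v \<le> x\<^sup>2\<close> \<open>0 < x\<close> by (simp add: field_simps)
    finally have "?a * ?b \<le> ?a * (1 / 4)" by (intro mult_left_mono) auto
    then show ?thesis by (simp add: indicator_def)
  qed
  then show ?thesis using a j by linarith
qed

lemma bounded_power4_integrable:
  fixes U :: "'a \<Rightarrow> real"
  assumes "U \<in> borel_measurable M" "\<And>s. \<bar>U s\<bar> \<le> c"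
  shows "integrable M (\<lambda>s. U s ^ 4)"
proof (rule integrable_const_bound[where B="c ^ 4"])
  show "AE s in M. norm (U s ^ 4) \<le> c ^ 4"
    unfolding real_norm_def power_abs by (intro AE_I2 power_mono assms(2) abs_ge_zero)
qed (use assms in measurable)

text \<open>The tail inequality integrated against \<open>4 x\<^sup>3\<close>. The level \<open>2 x\<close> for \<open>U\<close> costs the factor \<open>2\<^sup>4\<close>, and the
  indicator contributes the fourth power of twice the \<open>L\<^sup>2\<close>-norm of \<open>V\<close>. It pays to work with tails:
  expanding \<open>(U - V)\<^sup>4\<close> would leave \<open>E U\<^sup>3 V\<close>, which a correlation bound controls directly only through a
  sixth moment of \<open>U\<close>.\<close>

lemma corr_bound_power4_half:
  assumes cb: "corr_bound M r U V" and r: "0 \<le> r"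
    and U: "U \<in> borel_measurable M" "\<And>s. \<bar>U s\<bar> \<le> c"
    and V: "V \<in> borel_measurable M" "\<And>s. \<bar>V s\<bar> \<le> c"
  shows "E (\<lambda>s. U s ^ 4) / 16 \<le>
    E (\<lambda>s. (U s - V s) ^ 4) + E (\<lambda>s. U s ^ 4) / 64
    + 16 * (mean_sq V)\<^sup>2
    + r / 2 * (E (\<lambda>s. U s ^ 4) / 16 + E (\<lambda>s. V s ^ 4))"
proof -
  note [measurable] = U(1) V(1)
  have VL: "V \<in> L2_real M M" using L2_bounded[OF V] .
  define v where "v = mean_sq V"
  have v: "0 \<le> v" by (simp add: v_def)
  define w where "w x = ennreal (4 * x ^ 3) * indicator {0..} x" for x :: real
  have [measurable]: "w \<in> borel_measurable borel" unfolding w_def by measurable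
  define T where "T Z x = emeasure M {s \<in> space M. x \<le> Z s}" for Z :: "'a \<Rightarrow> real" and x :: real
  have [measurable]: "T Z \<in> borel_measurable borel" if [measurable]: "Z \<in> borel_measurable M" for Z
    unfolding T_def by measurable
  have tail: "(\<integral>\<^sup>+x. w x * T Z x \<partial>lborel) = ennreal (E (\<lambda>s. Z s ^ 4))"
    if [measurable]: "Z \<in> borel_measurable M" and "\<And>s. 0 \<le> Z s" "integrable M (\<lambda>s. Z s ^ 4)" for Z
    using nn_integral_tail_power4[OF that(1,2)] that(3)
    by (simp add: w_def T_def nn_integral_eq_integral)
  define I where "I = {0..2 * sqrt v}"
  have "(\<integral>\<^sup>+x. w x * T (\<lambda>s. \<bar>U s\<bar> / 2) x \<partial>lborel) \<le>
    (\<integral>\<^sup>+x. w x * T (\<lambda>s. \<bar>U s - V s\<bar>) x + ennreal (1 / 4) * (w x * T (\<lambda>s. \<bar>U s\<bar> / 2) x)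
       + ennreal (4 * x ^ 3) * indicator I x
       + ennreal (r / 2) * (w x * T (\<lambda>s. \<bar>U s\<bar> / 2) x + w x * T (\<lambda>s. \<bar>V s\<bar>) x) \<partial>lborel)"
  proof (intro nn_integral_mono)
    fix x :: real
    show "w x * T (\<lambda>s. \<bar>U s\<bar> / 2) x \<le>
       w x * T (\<lambda>s. \<bar>U s - V s\<bar>) x + ennreal (1 / 4) * (w x * T (\<lambda>s. \<bar>U s\<bar> / 2) x)
       + ennreal (4 * x ^ 3) * indicator I x
       + ennreal (r / 2) * (w x * T (\<lambda>s. \<bar>U s\<bar> / 2) x + w x * T (\<lambda>s. \<bar>V s\<bar>) x)"
    proof (cases "0 \<le> x")
      case True
      define a d b where "a = prob {s \<in> space M. x \<le> \<bar>U s\<bar> / 2}"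
        and "d = prob {s \<in> space M. x \<le> \<bar>U s - V s\<bar>}" and "b = prob {s \<in> space M. x \<le> \<bar>V s\<bar>}"
      have T: "T (\<lambda>s. \<bar>U s\<bar> / 2) x = ennreal a" "T (\<lambda>s. \<bar>U s - V s\<bar>) x = ennreal d"
        "T (\<lambda>s. \<bar>V s\<bar>) x = ennreal b"
        by (simp_all add: T_def a_def b_def d_def emeasure_eq_measure)
      have nn: "0 \<le> a" "0 \<le> d" "0 \<le> b" by (simp_all add: a_def b_def d_def)
      have "a \<le> d + a / 4 + indicator I x + r / 2 * (a + b)"
        using tail_le_of_corr_bound[OF cb r U(1) VL True] by (simp add: a_def b_def d_def I_def v_def)
      then have k: "4 * x ^ 3 * a \<le> 4 * x ^ 3 * (d + a / 4 + indicator I x + r / 2 * (a + b))"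
        using True by (intro mult_left_mono) auto
      have *: "ennreal (4 * x ^ 3 * a) \<le> ennreal (4 * x ^ 3 * d + 1 / 4 * (4 * x ^ 3 * a)
        + 4 * x ^ 3 * indicator I x + r / 2 * (4 * x ^ 3 * a + 4 * x ^ 3 * b))"
      proof (intro ennreal_leI)
        have "4 * x ^ 3 * (d + a / 4 + indicator I x + r / 2 * (a + b)) = 4 * x ^ 3 * d + 1 / 4 * (4 * x ^ 3 * a)
        + 4 * x ^ 3 * indicator I x + r / 2 * (4 * x ^ 3 * a + 4 * x ^ 3 * b)"
          by (simp add: field_simps)
        then show "4 * x ^ 3 * a \<le> 4 * x ^ 3 * d + 1 / 4 * (4 * x ^ 3 * a)
          + 4 * x ^ 3 * indicator I x + r / 2 * (4 * x ^ 3 * a + 4 * x ^ 3 * b)"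
          using k by linarith
      qed
      have ind: "ennreal (4 * x ^ 3) * indicator I x = ennreal (4 * x ^ 3 * indicator I x)"
        by (simp add: indicator_def)
      have wx: "w x * ennreal y = ennreal (4 * x ^ 3 * y)" if "0 \<le> y" for y
        using True that by (simp add: w_def ennreal_mult)
      have i0: "0 \<le> 4 * x ^ 3 * (indicator I x :: real)" using True by simp
      show ?thesis unfolding T wx[OF nn(1)] wx[OF nn(2)] wx[OF nn(3)] ind
        using * nn r True i0
        by (simp add: ennreal_plus[symmetric] ennreal_mult[symmetric] del: ennreal_plus)
    qed (simp add: w_def)
  qed
  also have "\<dots> = (\<integral>\<^sup>+x. w x * T (\<lambda>s. \<bar>U s - V s\<bar>) x \<partial>lborel)
      + ennreal (1 / 4) * (\<integral>\<^sup>+x. w x * T (\<lambda>s. \<bar>U s\<bar> / 2) x \<partial>lborel)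
      + (\<integral>\<^sup>+x. ennreal (4 * x ^ 3) * indicator I x \<partial>lborel)
      + ennreal (r / 2) * ((\<integral>\<^sup>+x. w x * T (\<lambda>s. \<bar>U s\<bar> / 2) x \<partial>lborel) + (\<integral>\<^sup>+x. w x * T (\<lambda>s. \<bar>V s\<bar>) x \<partial>lborel))"
    by (simp add: nn_integral_add nn_integral_cmult I_def)
  also have "(\<integral>\<^sup>+x. ennreal (4 * x ^ 3) * indicator I x \<partial>lborel) = ennreal ((2 * sqrt v) ^ 4 - 0 ^ 4)"
    unfolding I_def by (rule nn_integral_FTC_Icc) (use v in \<open>auto intro!: derivative_eq_intros\<close>)
  also have "(2 * sqrt v) ^ 4 - 0 ^ 4 = 16 * v\<^sup>2"
    using v by (simp add: power_mult_distrib power4_eq_xxxx power2_eq_square)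
  finally have main: "(\<integral>\<^sup>+x. w x * T (\<lambda>s. \<bar>U s\<bar> / 2) x \<partial>lborel) \<le>
      (\<integral>\<^sup>+x. w x * T (\<lambda>s. \<bar>U s - V s\<bar>) x \<partial>lborel)
      + ennreal (1 / 4) * (\<integral>\<^sup>+x. w x * T (\<lambda>s. \<bar>U s\<bar> / 2) x \<partial>lborel)
      + ennreal (16 * v\<^sup>2)
      + ennreal (r / 2) * ((\<integral>\<^sup>+x. w x * T (\<lambda>s. \<bar>U s\<bar> / 2) x \<partial>lborel) + (\<integral>\<^sup>+x. w x * T (\<lambda>s. \<bar>V s\<bar>) x \<partial>lborel))" .
  have bd: "\<bar>U s - V s\<bar> \<le> 2 * c" for s using U(2)[of s] V(2)[of s] by linarith
  have i: "integrable M (\<lambda>s. U s ^ 4)" "integrable M (\<lambda>s. V s ^ 4)" "integrable M (\<lambda>s. (U s - V s) ^ 4)"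
    using bounded_power4_integrable[OF U] bounded_power4_integrable[OF V]
      bounded_power4_integrable[OF _ bd] by simp_all
  have 4: "\<bar>y\<bar> ^ 4 = y ^ 4" for y :: real by (simp add: power4_eq_xxxx)
  have t1: "(\<integral>\<^sup>+x. w x * T (\<lambda>s. \<bar>U s\<bar> / 2) x \<partial>lborel) = ennreal (E (\<lambda>s. U s ^ 4) / 16)"
    using tail[of "\<lambda>s. \<bar>U s\<bar> / 2"] i by (simp add: power_divide 4)
  have t2: "(\<integral>\<^sup>+x. w x * T (\<lambda>s. \<bar>U s - V s\<bar>) x \<partial>lborel) = ennreal (E (\<lambda>s. (U s - V s) ^ 4))"
    using tail[of "\<lambda>s. \<bar>U s - V s\<bar>"] i by (simp add: 4)
  have t3: "(\<integral>\<^sup>+x. w x * T (\<lambda>s. \<bar>V s\<bar>) x \<partial>lborel) = ennreal (E (\<lambda>s. V s ^ 4))"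
    using tail[of "\<lambda>s. \<bar>V s\<bar>"] i by (simp add: 4)
  define eU eV eD where "eU = E (\<lambda>s. U s ^ 4)" and "eV = E (\<lambda>s. V s ^ 4)"
    and "eD = E (\<lambda>s. (U s - V s) ^ 4)"
  have nn: "0 \<le> eU" "0 \<le> eV" "0 \<le> eD" by (simp_all add: eU_def eV_def eD_def)
  have "ennreal (eU / 16) \<le> ennreal (eD + 1 / 4 * (eU / 16) + 16 * v\<^sup>2 + r / 2 * (eU / 16 + eV))"
    using main nn r v unfolding t1 t2 t3 eU_def[symmetric] eV_def[symmetric] eD_def[symmetric]
    by (simp add: ennreal_plus[symmetric] ennreal_mult[symmetric] del: ennreal_plus)
  then have "eU / 16 \<le> eD + 1 / 4 * (eU / 16) + 16 * v\<^sup>2 + r / 2 * (eU / 16 + eV)"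
    using nn r v by (subst (asm) ennreal_le_iff) auto
  then show ?thesis by (simp add: eU_def eV_def eD_def v_def)
qed

text \<open>The fourth moment of \<open>U - V\<close> can be small compared with those of \<open>U\<close> and \<open>V\<close> only if the two variables
  nearly cancel, which weak dependence excludes. In the sum of the one-sided inequalities for \<open>U\<close> and
  for \<open>V\<close>, the bound on \<open>r\<close> keeps the coefficient of \<open>E U\<^sup>4 + E V\<^sup>4\<close> on the right below the
  \<open>1 / 16\<close> on the left, and the squared variances are dominated by that of \<open>U - V\<close>, hence by its
  fourth moment.\<close>

lemma corr_bound_power4:
  assumes cb: "corr_bound M r U V" and r: "0 \<le> r" "r \<le> 1 / 32"
    and U: "U \<in> borel_measurable M" "\<And>s. \<bar>U s\<bar> \<le> c" "E U = 0"
    and V: "V \<in> borel_measurable M" "\<And>s. \<bar>V s\<bar> \<le> c"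
  shows "E (\<lambda>s. (U s + V s) ^ 4) \<le> 32768 * E (\<lambda>s. (U s - V s) ^ 4)"
proof -
  note [measurable] = U(1) V(1)
  define eU eV eD where "eU = E (\<lambda>s. U s ^ 4)" and "eV = E (\<lambda>s. V s ^ 4)"
    and "eD = E (\<lambda>s. (U s - V s) ^ 4)"
  define u v where "u = mean_sq U" and "v = mean_sq V"
  have nn: "0 \<le> eU" "0 \<le> eV" "0 \<le> eD" "0 \<le> u" "0 \<le> v"
    by (simp_all add: eU_def eV_def eD_def u_def v_def)
  have bd: "\<bar>U s - V s\<bar> \<le> 2 * c" "\<bar>U s + V s\<bar> \<le> 2 * c" for s using U(2)[of s] V(2)[of s] by linarith+
  have UL: "U \<in> L2_real M M" and VL: "V \<in> L2_real M M" using L2_bounded[OF U(1,2)] L2_bounded[OF V] .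
  have swap: "E (\<lambda>s. (V s - U s) ^ 4) = eD"
    unfolding eD_def by (intro Bochner_Integration.integral_cong refl)
      (metis abs_minus_commute even_numeral power_even_abs)
  have h1: "eU / 16 \<le> eD + eU / 64 + 16 * v\<^sup>2 + r / 2 * (eU / 16 + eV)"
    unfolding eU_def eV_def eD_def v_def by (rule corr_bound_power4_half[OF cb r(1) U(1,2) V])
  have h2: "eV / 16 \<le> eD + eV / 64 + 16 * u\<^sup>2 + r / 2 * (eV / 16 + eU)"
    using corr_bound_power4_half[OF corr_bound_sym[OF cb] r(1) V U(1,2)]
    unfolding swap eU_def[symmetric] eV_def[symmetric] u_def[symmetric] .
  have "(1 - r) * (u + v) \<le> E (\<lambda>s. (U s - V s)\<^sup>2)"
    using corr_bound_square_add(4)[OF cb r(1) UL VL U(3)] by (simp add: u_def v_def)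
  moreover have "31 / 32 * (u + v) \<le> (1 - r) * (u + v)"
    using nn r by (intro mult_right_mono) auto
  ultimately have "31 / 32 * (u + v) \<le> E (\<lambda>s. (U s - V s)\<^sup>2)" by linarith
  then have "(31 / 32 * (u + v))\<^sup>2 \<le> (E (\<lambda>s. (U s - V s)\<^sup>2))\<^sup>2"
    using nn by (intro power_mono) auto
  also have "\<dots> \<le> E (\<lambda>s. ((U s - V s)\<^sup>2)\<^sup>2)"
  proof (rule L2_expectation_square_le)
    show "(\<lambda>s. (U s - V s)\<^sup>2) \<in> L2_real M M"
      using bounded_power4_integrable[OF _ bd(1)] by (simp add: L2_real_iff power4_eq_xxxx power2_eq_square mult.assoc)
  qed
  also have "\<dots> = eD" by (simp add: eD_def power4_eq_xxxx power2_eq_square mult.assoc)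
  finally have "(31 / 32)\<^sup>2 * (u + v)\<^sup>2 \<le> eD" by (simp only: power_mult_distrib)
  moreover have "u\<^sup>2 + v\<^sup>2 \<le> (u + v)\<^sup>2" using nn by (simp add: power2_sum)
  ultimately have uv: "u\<^sup>2 + v\<^sup>2 \<le> 2 * eD" using nn by (simp add: power2_eq_square)
  have "r / 2 * (eU / 16 + eV) + r / 2 * (eV / 16 + eU) = r * (17 / 32 * (eU + eV))" by (simp add: algebra_simps)
  also have "\<dots> \<le> 1 / 32 * (17 / 32 * (eU + eV))" using nn r by (intro mult_right_mono) auto
  finally have pq: "r / 2 * (eU / 16 + eV) + r / 2 * (eV / 16 + eU) \<le> 1 / 32 * (17 / 32 * (eU + eV))" .
  define p q where "p = r / 2 * (eU / 16 + eV)" and "q = r / 2 * (eV / 16 + eU)"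
  have "eU + eV \<le> 2176 * eD"
    using h1 h2 uv nn pq unfolding p_def[symmetric] q_def[symmetric] by (simp add: field_simps)
  \<comment> \<open>\<open>32768\<close> is a convenient number above \<open>8 * 2176\<close>.\<close>
  have "E (\<lambda>s. (U s + V s) ^ 4) \<le> E (\<lambda>s. 8 * U s ^ 4 + 8 * V s ^ 4)"
  proof (rule integral_mono)
    show "integrable M (\<lambda>s. (U s + V s) ^ 4)" by (rule bounded_power4_integrable[OF _ bd(2)]) simp
    show "integrable M (\<lambda>s. 8 * U s ^ 4 + 8 * V s ^ 4)"
      using bounded_power4_integrable[OF U(1,2)] bounded_power4_integrable[OF V] by simp
    fix s
    have 2: "(a + b)\<^sup>2 \<le> 2 * (a\<^sup>2 + b\<^sup>2)" for a b :: real
      using sum_squares_bound[of a b] by (simp add: power2_sum)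
    have "((U s + V s)\<^sup>2)\<^sup>2 \<le> (2 * ((U s)\<^sup>2 + (V s)\<^sup>2))\<^sup>2" by (intro power_mono 2) simp
    also have "\<dots> = 4 * ((U s)\<^sup>2 + (V s)\<^sup>2)\<^sup>2" unfolding power_mult_distrib by simp
    also have "\<dots> \<le> 8 * (((U s)\<^sup>2)\<^sup>2 + ((V s)\<^sup>2)\<^sup>2)"
      using 2[of "(U s)\<^sup>2" "(V s)\<^sup>2"] by linarith
    finally show "(U s + V s) ^ 4 \<le> 8 * U s ^ 4 + 8 * V s ^ 4"
      by (simp add: power4_eq_xxxx power2_eq_square mult.assoc)
  qed
  also have "\<dots> = 8 * (eU + eV)"
    using bounded_power4_integrable[OF U(1,2)] bounded_power4_integrable[OF V] by (simp add: eU_def eV_def)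
  finally show ?thesis using \<open>eU + eV \<le> 2176 * eD\<close> nn by (simp add: eD_def)
qed

text \<open>Real and imaginary part of the difference combine two covariances of sines and cosines each,
  and each of these covariances is at most \<open>r\<close>.\<close>

lemma corr_bound_char:
  assumes cb: "corr_bound M r U V" and r: "0 \<le> r"
    and [measurable]: "U \<in> borel_measurable M" "V \<in> borel_measurable M"
  shows "cmod ((CLINT s|M. iexp (U s + V s)) - (CLINT s|M. iexp (U s)) * (CLINT s|M. iexp (V s))) \<le> 4 * r"
proof -
  have cov: "\<bar>E (\<lambda>s. f (U s) * g (V s)) - E (\<lambda>s. f (U s)) * E (\<lambda>s. g (V s))\<bar> \<le> r"
    if [measurable]: "f \<in> borel_measurable borel" "g \<in> borel_measurable borel"
      and bd: "\<And>x. \<bar>f x\<bar> \<le> 1" "\<And>x. \<bar>g x\<bar> \<le> 1" for f g :: "real \<Rightarrow> real"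
  proof -
    have L: "(\<lambda>s. f (U s)) \<in> L2_real M M" "(\<lambda>s. g (V s)) \<in> L2_real M M"
      using bd by (auto intro!: L2_bounded[where c=1])
    have le1: "mean_sq h \<le> 1" if "h \<in> L2_real M M" "\<And>s. \<bar>h s\<bar> \<le> 1" for h
    proof -
      have "mean_sq h \<le> E (\<lambda>s. 1)"
        using that by (intro integral_mono) (auto simp: L2_real_iff abs_square_le_1)
      then show ?thesis by (simp add: prob_space)
    qed
    have "sqrt (E (\<lambda>s. (f (U s))\<^sup>2)) * sqrt (E (\<lambda>s. (g (V s))\<^sup>2)) \<le> 1 * 1"
      using le1[OF L(1)] le1[OF L(2)] bd by (intro mult_mono) auto
    then have "r * (sqrt (E (\<lambda>s. (f (U s))\<^sup>2)) * sqrt (E (\<lambda>s. (g (V s))\<^sup>2))) \<le> r * 1"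
      using r by (intro mult_left_mono) auto
    then show ?thesis using corr_boundD[OF cb that(1,2) L] by linarith
  qed
  have int: "integrable M (\<lambda>s. cos (W s))" "integrable M (\<lambda>s. sin (W s))" "integrable M (\<lambda>s. iexp (W s))"
    if [measurable]: "W \<in> borel_measurable M" for W :: "'a \<Rightarrow> real"
    by (auto intro!: integrable_const_bound[where B=1])
  have ReIm: "Re (CLINT s|M. iexp (W s)) = E (\<lambda>s. cos (W s))"
    "Im (CLINT s|M. iexp (W s)) = E (\<lambda>s. sin (W s))"
    if "W \<in> borel_measurable M" for W :: "'a \<Rightarrow> real"
    using integral_Re[OF int(3)[OF that]] integral_Im[OF int(3)[OF that]] by (simp_all add: Re_exp Im_exp)
  have ip: "integrable M (\<lambda>s. cos (U s) * cos (V s))" "integrable M (\<lambda>s. sin (U s) * sin (V s))"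
    "integrable M (\<lambda>s. sin (U s) * cos (V s))" "integrable M (\<lambda>s. cos (U s) * sin (V s))"
    by (auto intro!: L2_integrable_mult L2_bounded[where c=1])
  have c: "E (\<lambda>s. cos (U s + V s)) = E (\<lambda>s. cos (U s) * cos (V s)) - E (\<lambda>s. sin (U s) * sin (V s))"
    using ip by (simp add: cos_add)
  have s: "E (\<lambda>s. sin (U s + V s)) = E (\<lambda>s. sin (U s) * cos (V s)) + E (\<lambda>s. cos (U s) * sin (V s))"
    using ip by (simp add: sin_add)
  have ReW: "Re (CLINT s|M. iexp (U s + V s)) = E (\<lambda>s. cos (U s + V s))"
    "Im (CLINT s|M. iexp (U s + V s)) = E (\<lambda>s. sin (U s + V s))"
    by (rule ReIm; measurable)+
  have mc: "(cos :: real \<Rightarrow> real) \<in> borel_measurable borel" "(sin :: real \<Rightarrow> real) \<in> borel_measurable borel"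
    by measurable
  note cos = mc(1) abs_cos_le_one and sin = mc(2) abs_sin_le_one
  let ?z = "(CLINT s|M. iexp (U s + V s)) - (CLINT s|M. iexp (U s)) * (CLINT s|M. iexp (V s))"
  have "\<bar>Re ?z\<bar> \<le> 2 * r"
    using cov[OF cos(1) cos(1) cos(2) cos(2)] cov[OF sin(1) sin(1) sin(2) sin(2)] unfolding minus_complex.sel times_complex.sel ReW ReIm[OF assms(3)] ReIm[OF assms(4)] c by linarith
  moreover have "\<bar>Im ?z\<bar> \<le> 2 * r"
    using cov[OF cos(1) sin(1) cos(2) sin(2)] cov[OF sin(1) cos(1) sin(2) cos(2)] unfolding minus_complex.sel times_complex.sel ReW ReIm[OF assms(3)] ReIm[OF assms(4)] s by linarith
  ultimately show ?thesis using cmod_le[of ?z] by linarith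
qed

end

section \<open>Moment inequalities for families split into weakly correlated halves\<close>

text \<open>Only the two halves of a bipartition are required to be weakly correlated; so the error in
  the moment inequalities does not accumulate with the number of members.\<close>

definition corr_bound_family :: "'a measure \<Rightarrow> real \<Rightarrow> ('j \<Rightarrow> 'a \<Rightarrow> real) \<Rightarrow> 'j set \<Rightarrow> bool" where
  "corr_bound_family M r \<xi> J \<longleftrightarrow>
     (\<forall>A\<subseteq>J. corr_bound M r (\<lambda>s. \<Sum>j\<in>A. \<xi> j s) (\<lambda>s. \<Sum>j\<in>J - A. \<xi> j s))"

context prob_space
begin

text \<open>For a single bipartition the second moments of the sum \<open>A + B\<close> and of the difference \<open>A - B\<close> have a
  ratio between \<open>(1 - r) / (1 + r)\<close> and its inverse. The sum is the same for all bipartitions, and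
  the mean of the squared differences is the sum of the squares.\<close>

lemma family_square_bounds:
  assumes J: "finite J" and L: "\<And>j. j \<in> J \<Longrightarrow> \<xi> j \<in> L2_real M M"
    and E0: "\<And>j. j \<in> J \<Longrightarrow> E (\<xi> j) = 0"
    and cb: "corr_bound_family M r \<xi> J" and r: "0 \<le> r" "r \<le> 1"
  shows "(1 - r) * E (\<lambda>s. (\<Sum>j\<in>J. \<xi> j s)\<^sup>2) \<le> (1 + r) * (\<Sum>j\<in>J. mean_sq (\<xi> j))"
    and "(1 - r) * (\<Sum>j\<in>J. mean_sq (\<xi> j)) \<le> (1 + r) * E (\<lambda>s. (\<Sum>j\<in>J. \<xi> j s)\<^sup>2)"
proof -
  define S where "S = E (\<lambda>s. (\<Sum>j\<in>J. \<xi> j s)\<^sup>2)"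
  define D where "D A = E (\<lambda>s. (signed_sum (\<lambda>j. \<xi> j s) J A)\<^sup>2)" for A
  define T where "T = (\<Sum>j\<in>J. mean_sq (\<xi> j))"
  have split: "(1 - r) * S \<le> (1 + r) * D A" "(1 - r) * D A \<le> (1 + r) * S" if A: "A \<subseteq> J" for A
  proof -
    define U V where "U s = (\<Sum>j\<in>A. \<xi> j s)" and "V s = (\<Sum>j\<in>J - A. \<xi> j s)" for s
    have UL: "U \<in> L2_real M M" and VL: "V \<in> L2_real M M"
      unfolding U_def V_def using A L by (auto intro!: L2_sum)
    have "E U = (\<Sum>j\<in>A. E (\<xi> j))"
      unfolding U_def using A L by (intro Bochner_Integration.integral_sum) (auto intro: L2_integrable)
    also have "\<dots> = 0" using A E0 by (intro sum.neutral) auto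
    finally have EU: "E U = 0" .
    have "corr_bound M r U V" using cb A unfolding corr_bound_family_def U_def V_def by blast
    note sq = corr_bound_square_add[OF this r(1) UL VL EU]
    have S: "S = E (\<lambda>s. (U s + V s)\<^sup>2)"
      unfolding S_def U_def V_def by (simp add: sum.subset_diff[OF A J] add.commute)
    have D: "D A = E (\<lambda>s. (U s - V s)\<^sup>2)"
      by (simp add: D_def signed_sum_def U_def V_def)
    define uv where "uv = mean_sq U + mean_sq V"
    have "(1 - r) * S \<le> (1 - r) * ((1 + r) * uv)"
      using sq(1) r unfolding S uv_def by (intro mult_left_mono) auto
    also have "\<dots> = (1 + r) * ((1 - r) * uv)" by simp
    also have "\<dots> \<le> (1 + r) * D A"
      using sq(4) r unfolding D uv_def by (intro mult_left_mono) auto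
    finally show "(1 - r) * S \<le> (1 + r) * D A" .
    have "(1 - r) * D A \<le> (1 - r) * ((1 + r) * uv)"
      using sq(2) r unfolding D uv_def by (intro mult_left_mono) auto
    also have "\<dots> = (1 + r) * ((1 - r) * uv)" by simp
    also have "\<dots> \<le> (1 + r) * S"
      using sq(3) r unfolding S uv_def by (intro mult_left_mono) auto
    finally show "(1 - r) * D A \<le> (1 + r) * S" .
  qed
  have "(\<Sum>A\<in>Pow J. D A) = E (\<lambda>s. \<Sum>A\<in>Pow J. (signed_sum (\<lambda>j. \<xi> j s) J A)\<^sup>2)"
    unfolding D_def signed_sum_def using L
    by (intro Bochner_Integration.integral_sum[symmetric] L2_integrable_square L2_diff L2_sum) auto
  also have "\<dots> = 2 ^ card J * T"
    unfolding T_def using L J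
    by (simp add: sum_signed_sum_power2 L2_integrable_square)
  finally have avg: "(\<Sum>A\<in>Pow J. D A) = 2 ^ card J * T" .
  have pos: "0 < (2::real) ^ card J" by simp
  have "(\<Sum>A\<in>Pow J. (1 - r) * S) \<le> (\<Sum>A\<in>Pow J. (1 + r) * D A)"
    using split by (intro sum_mono) auto
  then have "2 ^ card J * ((1 - r) * S) \<le> 2 ^ card J * ((1 + r) * T)"
    using J by (simp add: card_Pow sum_distrib_left[symmetric] avg mult.left_commute)
  then show "(1 - r) * S \<le> (1 + r) * T" unfolding mult_le_cancel_left_pos[OF pos] .
  have "(\<Sum>A\<in>Pow J. (1 - r) * D A) \<le> (\<Sum>A\<in>Pow J. (1 + r) * S)"
    using split by (intro sum_mono) auto
  then have "2 ^ card J * ((1 - r) * T) \<le> 2 ^ card J * ((1 + r) * S)"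
    using J by (simp add: card_Pow sum_distrib_left[symmetric] avg mult.left_commute)
  then show "(1 - r) * T \<le> (1 + r) * S" unfolding mult_le_cancel_left_pos[OF pos] .
qed

text \<open>The averaging argument for fourth moments, followed by Khinchine's inequality and the triangle
  inequality in \<open>L\<^sup>2\<close> for the squares. Because the right side is again built from fourth moments, the
  bound can be applied to slices of slices. The constant is \<open>3 * 32768\<close>.\<close>

lemma family_power4_bound:
  fixes \<xi> :: "'j \<Rightarrow> 'a \<Rightarrow> real"
  assumes J: "finite J" and meas: "\<And>j. j \<in> J \<Longrightarrow> \<xi> j \<in> borel_measurable M"
    and bd: "\<And>j s. j \<in> J \<Longrightarrow> \<bar>\<xi> j s\<bar> \<le> c"
    and E0: "\<And>j. j \<in> J \<Longrightarrow> E (\<xi> j) = 0"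
    and cb: "corr_bound_family M r \<xi> J" and r: "0 \<le> r" "r \<le> 1 / 32"
  shows "E (\<lambda>s. (\<Sum>j\<in>J. \<xi> j s) ^ 4) \<le>
    98304 * (\<Sum>j\<in>J. sqrt (E (\<lambda>s. \<xi> j s ^ 4)))\<^sup>2"
proof (cases "J = {}")
  case False
  then have "0 \<le> c" using bd by (metis abs_ge_zero ex_in_conv order_trans)
  define S where "S = E (\<lambda>s. (\<Sum>j\<in>J. \<xi> j s) ^ 4)"
  define D where "D A = E (\<lambda>s. (signed_sum (\<lambda>j. \<xi> j s) J A) ^ 4)" for A
  have sumbd: "\<bar>\<Sum>j\<in>A. \<xi> j s\<bar> \<le> card J * c" if A: "A \<subseteq> J" for A s
  proof -
    have "\<bar>\<Sum>j\<in>A. \<xi> j s\<bar> \<le> (\<Sum>j\<in>A. \<bar>\<xi> j s\<bar>)" by (rule sum_abs)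
    also have "\<dots> \<le> card A * c" using A bd by (intro sum_bounded_above) auto
    also have "\<dots> \<le> card J * c" using A J \<open>0 \<le> c\<close> by (intro mult_right_mono) (auto intro: card_mono)
    finally show ?thesis .
  qed
  have summeas: "(\<lambda>s. \<Sum>j\<in>A. \<xi> j s) \<in> borel_measurable M" if "A \<subseteq> J" for A
    using that meas by (intro borel_measurable_sum) auto
  have split: "S \<le> 32768 * D A" if A: "A \<subseteq> J" for A
  proof -
    define U V where "U s = (\<Sum>j\<in>A. \<xi> j s)" and "V s = (\<Sum>j\<in>J - A. \<xi> j s)" for s
    have "E U = (\<Sum>j\<in>A. E (\<xi> j))"
      unfolding U_def using A meas bd
      by (intro Bochner_Integration.integral_sum) (auto intro!: L2_integrable L2_bounded[where c=c])
    also have "\<dots> = 0" using A E0 by (intro sum.neutral) auto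
    finally have EU: "E U = 0" .
    have cb': "corr_bound M r U V" using cb A unfolding corr_bound_family_def U_def V_def by blast
    have U: "U \<in> borel_measurable M" "\<And>s. \<bar>U s\<bar> \<le> card J * c"
      unfolding U_def using summeas sumbd A by auto
    have V: "V \<in> borel_measurable M" "\<And>s. \<bar>V s\<bar> \<le> card J * c"
      unfolding V_def using summeas sumbd by auto
    have S: "S = E (\<lambda>s. (U s + V s) ^ 4)"
      unfolding S_def U_def V_def by (simp add: sum.subset_diff[OF A J] add.commute)
    have D: "D A = E (\<lambda>s. (U s - V s) ^ 4)"
      by (simp add: D_def signed_sum_def U_def V_def)
    show ?thesis unfolding S D by (rule corr_bound_power4[OF cb' r U EU V])
  qed
  have i4: "integrable M (\<lambda>s. \<xi> j s ^ 4)" if "j \<in> J" for j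
    using bounded_power4_integrable[OF meas[OF that] bd[OF that]] .
  have sqL: "(\<lambda>s. (\<xi> j s)\<^sup>2) \<in> L2_real M M" if "j \<in> J" for j
    using i4[OF that] meas[OF that] by (simp add: L2_real_iff borel_measurable_power)
  have "2 ^ card J * S = (\<Sum>A\<in>Pow J. S)" using J by (simp add: card_Pow)
  also have "\<dots> \<le> (\<Sum>A\<in>Pow J. 32768 * D A)" using split by (intro sum_mono) auto
  also have "\<dots> = 32768 * (\<Sum>A\<in>Pow J. D A)" by (simp add: sum_distrib_left)
  also have "(\<Sum>A\<in>Pow J. D A) = E (\<lambda>s. \<Sum>A\<in>Pow J. (signed_sum (\<lambda>j. \<xi> j s) J A) ^ 4)"
    unfolding D_def
  proof (intro Bochner_Integration.integral_sum[symmetric])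
    fix A assume A: "A \<in> Pow J"
    have 1: "(\<lambda>s. signed_sum (\<lambda>j. \<xi> j s) J A) \<in> borel_measurable M"
      unfolding signed_sum_def using A summeas by (intro borel_measurable_diff) auto
    have 2: "\<bar>signed_sum (\<lambda>j. \<xi> j s) J A\<bar> \<le> 2 * (card J * c)" for s
      using sumbd[of A s] sumbd[of "J - A" s] A unfolding signed_sum_def by auto
    show "integrable M (\<lambda>s. (signed_sum (\<lambda>j. \<xi> j s) J A) ^ 4)"
      by (rule bounded_power4_integrable[OF 1 2])
  qed
  also have "\<dots> \<le> E (\<lambda>s. 3 * 2 ^ card J * (\<Sum>j\<in>J. (\<xi> j s)\<^sup>2)\<^sup>2)"
  proof (rule integral_mono')
    show "integrable M (\<lambda>s. 3 * 2 ^ card J * (\<Sum>j\<in>J. (\<xi> j s)\<^sup>2)\<^sup>2)"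
      using L2_integrable_square[OF L2_sum[of J "\<lambda>j s. (\<xi> j s)\<^sup>2" M]] sqL by simp
  qed (use J in \<open>auto intro: sum_signed_sum_power4\<close>)
  also have "\<dots> = 3 * 2 ^ card J * E (\<lambda>s. (\<Sum>j\<in>J. (\<xi> j s)\<^sup>2)\<^sup>2)" by simp
  also have "E (\<lambda>s. (\<Sum>j\<in>J. (\<xi> j s)\<^sup>2)\<^sup>2) =
      (\<Sum>i\<in>J. \<Sum>j\<in>J. E (\<lambda>s. (\<xi> i s)\<^sup>2 * (\<xi> j s)\<^sup>2))"
    using L2_integrable_mult[OF sqL sqL] by (simp add: power2_eq_square[of "sum _ _"] sum_product)
  also have "\<dots> \<le> (\<Sum>i\<in>J. \<Sum>j\<in>J. sqrt (E (\<lambda>s. \<xi> i s ^ 4)) * sqrt (E (\<lambda>s. \<xi> j s ^ 4)))"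
  proof (intro sum_mono)
    fix i j assume "i \<in> J" "j \<in> J"
    then show "E (\<lambda>s. (\<xi> i s)\<^sup>2 * (\<xi> j s)\<^sup>2) \<le> sqrt (E (\<lambda>s. \<xi> i s ^ 4)) * sqrt (E (\<lambda>s. \<xi> j s ^ 4))"
      using L2_Cauchy_Schwarz_sqrt[OF sqL[of i] sqL[of j]] by simp
  qed
  also have "\<dots> = (\<Sum>j\<in>J. sqrt (E (\<lambda>s. \<xi> j s ^ 4)))\<^sup>2"
    by (simp add: power2_eq_square sum_product)
  finally have "2 ^ card J * S \<le> 2 ^ card J * (98304 * (\<Sum>j\<in>J. sqrt (E (\<lambda>s. \<xi> j s ^ 4)))\<^sup>2)"
    by simp
  then show ?thesis by (simp add: S_def)
qed simp

text \<open>One member is split off at a time; the errors add up because characteristic functions are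
  bounded by \<open>1\<close>.\<close>

lemma family_char_product:
  assumes meas: "\<And>j. j < p \<Longrightarrow> \<xi> j \<in> borel_measurable M" and r: "0 \<le> r"
    and cb: "\<And>k. k < p \<Longrightarrow> corr_bound M r (\<lambda>s. \<Sum>j<k. \<xi> j s) (\<xi> k)"
  shows "cmod ((CLINT s|M. iexp (\<Sum>j<p. \<xi> j s)) - (\<Prod>j<p. CLINT s|M. iexp (\<xi> j s))) \<le> 4 * r * real p"
  using meas cb
proof (induction p)
  case 0
  then show ?case by (simp add: prob_space)
next
  case (Suc p)
  define U where "U s = (\<Sum>j<p. \<xi> j s)" for s
  have [measurable]: "U \<in> borel_measurable M" "\<xi> p \<in> borel_measurable M"
    unfolding U_def using Suc.prems by (auto intro!: borel_measurable_sum)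
  let ?e = "\<lambda>W. CLINT s|M. iexp (W s)"
  have "cmod (?e (\<xi> p)) \<le> (LINT s|M. cmod (iexp (\<xi> p s)))" by (rule integral_norm_bound)
  then have le1: "cmod (?e (\<xi> p)) \<le> 1" by (simp add: prob_space)
  have 1: "cmod (?e (\<lambda>s. U s + \<xi> p s) - ?e U * ?e (\<xi> p)) \<le> 4 * r"
  proof (rule corr_bound_char[OF _ r])
    show "corr_bound M r U (\<xi> p)" using Suc.prems(2)[of p] by (simp add: U_def[abs_def])
  qed measurable
  have IH: "cmod (?e U - (\<Prod>j<p. ?e (\<xi> j))) \<le> 4 * r * real p"
    using Suc by (simp add: U_def)
  have "cmod ((?e U - (\<Prod>j<p. ?e (\<xi> j))) * ?e (\<xi> p)) \<le> (4 * r * real p) * 1"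
    unfolding norm_mult using IH le1 r by (intro mult_mono) auto
  then have "cmod ((?e (\<lambda>s. U s + \<xi> p s) - ?e U * ?e (\<xi> p)) + (?e U - (\<Prod>j<p. ?e (\<xi> j))) * ?e (\<xi> p)) \<le> 4 * r + 4 * r * real p"
    using 1 norm_triangle_ineq by (smt (verit))
  also have "(?e (\<lambda>s. U s + \<xi> p s) - ?e U * ?e (\<xi> p)) + (?e U - (\<Prod>j<p. ?e (\<xi> j))) * ?e (\<xi> p)
    = ?e (\<lambda>s. \<Sum>j<Suc p. \<xi> j s) - (\<Prod>j<Suc p. ?e (\<xi> j))"
    by (simp add: U_def left_diff_distrib)
  finally show ?case by (simp add: algebra_simps)
qed

end

section \<open>Moment bounds for sums over finite sets of sites\<close>

definition field_sum ::
    "('k \<Rightarrow> 'a \<Rightarrow> 'b) \<Rightarrow> ('b \<Rightarrow> real) \<Rightarrow> 'k set \<Rightarrow> 'a \<Rightarrow> real" where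
  "field_sum X y Q s = (\<Sum>k\<in>Q. y (X k s))"

lemma field_sum_empty [simp]: "field_sum X y {} = (\<lambda>s. 0)"
  by (simp add: field_sum_def fun_eq_iff)

lemma field_sum_Union:
  assumes "finite Q" "A \<subseteq> c ` Q"
  shows "(\<Sum>j\<in>A. field_sum X y {k \<in> Q. c k = j} s) = field_sum X y {k \<in> Q. c k \<in> A} s"
proof -
  have "finite A" using assms finite_subset by blast
  have eq: "{k \<in> Q. c k \<in> A} = (\<Union>j\<in>A. {k \<in> Q. c k = j})" by auto
  show ?thesis
    unfolding field_sum_def eq using \<open>finite A\<close> assms
    by (subst sum.UNION_disjoint) auto
qed

lemma field_sum_slices:
  assumes "finite Q"
  shows "field_sum X y Q s = (\<Sum>j\<in>c ` Q. field_sum X y {k \<in> Q. c k = j} s)"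
proof -
  have "{k \<in> Q. c k \<in> c ` Q} = Q" by auto
  then show ?thesis by (simp add: field_sum_Union[OF assms])
qed

lemma abs_field_sum_le:
  fixes b :: real
  assumes "\<And>x. \<bar>y x\<bar> \<le> b"
  shows "\<bar>field_sum X y Q s\<bar> \<le> card Q * b"
  unfolding field_sum_def by (rule order_trans[OF sum_abs sum_bounded_above]) (rule assms)

lemma gen_field_measurable:
  assumes "k \<in> Q"
  shows "X k \<in> borel_measurable (gen_field M X Q)"
proof (rule measurableI)
  have sub: "(\<Union>k\<in>Q. {X k -` B \<inter> space M | B. B \<in> sets borel}) \<subseteq> Pow (space M)" by auto
  show "X k -` B \<inter> space (gen_field M X Q) \<in> sets (gen_field M X Q)" if "B \<in> sets borel" for B
    using assms that unfolding gen_field_def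
    by (auto simp: sets_measure_of[OF sub] space_measure_of[OF sub] intro!: sigma_sets.Basic)
qed simp

lemma field_sum_gen_field_measurable:
  assumes "y \<in> borel_measurable borel" "finite Q"
  shows "field_sum X y Q \<in> borel_measurable (gen_field M X Q)"
  unfolding field_sum_def
  by (intro borel_measurable_sum measurable_compose[OF gen_field_measurable assms(1)])

locale mixing_field = prob_space M for M :: "'a measure" +
  fixes X :: "int ^ 'd::finite \<Rightarrow> 'a \<Rightarrow> real ^ 'm::finite"
  assumes stationary: "strictly_stationary M X"
    and mixing: "rho'_mixing M X"
begin

lemma X_measurable [measurable]: "X k \<in> borel_measurable M"
  using stationary by (simp add: strictly_stationary_def)

lemma field_sum_measurable [measurable]:
  assumes [measurable]: "y \<in> borel_measurable borel"
  shows "field_sum X y Q \<in> borel_measurable M"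
  unfolding field_sum_def by measurable

lemma ex_rho'_le:
  assumes "0 < r"
  shows "\<exists>n\<ge>1. rho' M X n \<le> ereal r"
proof -
  have "eventually (\<lambda>n. rho' M X n < ereal r) sequentially"
    using mixing assms unfolding rho'_mixing_def by (intro order_tendstoD(2)) auto
  then obtain N where "\<And>n. n \<ge> N \<Longrightarrow> rho' M X n < ereal r"
    by (auto simp: eventually_sequentially)
  then have "rho' M X (max N 1) \<le> ereal r" by (intro less_imp_le) simp
  then show ?thesis by (intro exI[of _ "max N 1"]) simp
qed

lemma distr_field_sum_shift:
  assumes [measurable]: "y \<in> borel_measurable borel" and J: "finite J"
  shows "distr M borel (field_sum X y ((\<lambda>k. k + h) ` J)) = distr M borel (field_sum X y J)"
proof -
  have eq: "distr M (Pi\<^sub>M J (\<lambda>_. borel)) (\<lambda>s. \<lambda>k\<in>J. X (k + h) s) =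
        distr M (Pi\<^sub>M J (\<lambda>_. borel)) (\<lambda>s. \<lambda>k\<in>J. X k s)"
    using stationary J by (simp add: strictly_stationary_def)
  define g where "g x = (\<Sum>k\<in>J. y (x k))" for x :: "int ^ 'd \<Rightarrow> real ^ 'm"
  have [measurable]: "g \<in> borel_measurable (Pi\<^sub>M J (\<lambda>_. borel))"
    unfolding g_def by measurable
  have 1: "distr (distr M (Pi\<^sub>M J (\<lambda>_. borel)) (\<lambda>s. \<lambda>k\<in>J. X (k + h) s)) borel g
    = distr M borel (g \<circ> (\<lambda>s. \<lambda>k\<in>J. X (k + h) s))" for h
    by (rule distr_distr) measurable
  have 2: "(g \<circ> (\<lambda>s. \<lambda>k\<in>J. X (k + h) s)) = field_sum X y ((\<lambda>k. k + h) ` J)" for h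
    by (simp add: fun_eq_iff g_def field_sum_def sum.reindex inj_on_def)
  show ?thesis using 1[of h] 1[of 0] eq unfolding 2 by simp
qed

lemma expectation_field_sum_shift:
  fixes g :: "real \<Rightarrow> 'e::{banach, second_countable_topology}"
  assumes [measurable]: "y \<in> borel_measurable borel" "g \<in> borel_measurable borel" and J: "finite J"
  shows "(\<integral>s. g (field_sum X y ((\<lambda>k. k + h) ` J) s) \<partial>M) = (\<integral>s. g (field_sum X y J s) \<partial>M)"
  using distr_field_sum_shift[OF assms(1) J, of h]
    integral_distr[of "field_sum X y J" M borel g]
    integral_distr[of "field_sum X y ((\<lambda>k. k + h) ` J)" M borel g]
  by simp

text \<open>A function of the sum over \<open>Q\<close> is measurable with respect to the \<open>\<sigma>\<close>-field of \<open>Q\<close>, so the suprema that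
  define \<open>rho'\<close> apply to it. For a degenerate variable the quotient \<open>corr\<close> is zero by convention and says
  nothing, but then the covariance vanishes by the Cauchy-Schwarz inequality. Empty sets, which the
  definition of \<open>rho'\<close> leaves out, give constant sums.\<close>

lemma separated_corr_bound:
  assumes n: "1 \<le> n" and rho: "rho' M X n \<le> ereal r" and r: "0 \<le> r"
    and fin: "finite Q" "finite S" and sep: "\<And>k l. k \<in> Q \<Longrightarrow> l \<in> S \<Longrightarrow> int n \<le> \<bar>k $ u - l $ u\<bar>"
    and y: "y \<in> borel_measurable borel"
  shows "corr_bound M r (field_sum X y Q) (field_sum X y S)"
  unfolding corr_bound_def
proof (intro ballI impI)
  fix f g :: "real \<Rightarrow> real"
  assume [measurable]: "f \<in> borel_measurable borel" "g \<in> borel_measurable borel"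
    and LF: "(\<lambda>s. f (field_sum X y Q s)) \<in> L2_real M M"
    and LG: "(\<lambda>s. g (field_sum X y S s)) \<in> L2_real M M"
  define F G where "F s = f (field_sum X y Q s)" and "G s = g (field_sum X y S s)" for s
  have FG: "F \<in> L2_real M M" "G \<in> L2_real M M" using LF LG by (simp_all add: F_def[abs_def] G_def[abs_def])
  let ?R = "sqrt (mean_sq F) * sqrt (mean_sq G)"
  have "\<bar>E (\<lambda>s. F s * G s) - E F * E G\<bar> \<le> r * ?R"
  proof (cases "Q = {} \<or> S = {}")
    case True
    then have "E (\<lambda>s. F s * G s) = E F * E G"
      by (auto simp: F_def[abs_def] G_def[abs_def] prob_space)
    then show ?thesis using r by simp
  next
    case False
    define F' G' where "F' s = F s - E F" and "G' s = G s - E G" for s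
    have const: "(\<lambda>s. c) \<in> L2_real M M" for c by (simp add: L2_real_iff)
    have L': "F' \<in> L2_real M M" "G' \<in> L2_real M M"
      unfolding F'_def G'_def using FG const by (auto intro!: L2_diff)
    have cov: "E (\<lambda>s. F' s * G' s) = E (\<lambda>s. F s * G s) - E F * E G"
      unfolding F'_def G'_def using FG
      by (simp add: left_diff_distrib right_diff_distrib L2_integrable L2_integrable_mult prob_space)
    have var: "mean_sq F' \<le> mean_sq F"
      "mean_sq G' \<le> mean_sq G"
      unfolding F'_def G'_def using FG
      by (simp_all add: variance_eq L2_integrable L2_integrable_square)
    have "(Q, S) \<in> separated_pairs n"
    proof -
      have d: "(\<lambda>k. k $ u) ` Q \<inter> (\<lambda>k. k $ u) ` S = {}"
      proof (rule ccontr)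
        assume "\<not> ?thesis"
        then obtain k l where "k \<in> Q" "l \<in> S" "k $ u = l $ u" by auto
        then show False using sep[of k l] n by simp
      qed
      have "Q \<inter> S = {}" using d by blast
      moreover have "\<exists>u A B. A \<noteq> {} \<and> B \<noteq> {} \<and> A \<inter> B = {} \<and> (\<forall>a\<in>A. \<forall>b\<in>B. int n \<le> \<bar>a - b\<bar>) \<and>
           Q \<subseteq> {k. k $ u \<in> A} \<and> S \<subseteq> {k. k $ u \<in> B}"
        using False d sep by (intro exI[of _ u] exI[of _ "(\<lambda>k. k $ u) ` Q"] exI[of _ "(\<lambda>k. k $ u) ` S"]) auto
      ultimately show ?thesis using False fin by (simp add: separated_pairs_def)
    qed
    then have "max_corr M (gen_field M X Q) (gen_field M X S) \<le> rho' M X n"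
      unfolding rho'_def by (rule SUP_upper2) simp
    moreover have "ereal \<bar>corr M F G\<bar> \<le> max_corr M (gen_field M X Q) (gen_field M X S)"
    proof -
      have "F \<in> L2_real M (gen_field M X Q)" "G \<in> L2_real M (gen_field M X S)"
        using FG field_sum_gen_field_measurable[OF y fin(1), of X M] field_sum_gen_field_measurable[OF y fin(2), of X M]
        by (auto simp: L2_real_def F_def[abs_def] G_def[abs_def] intro: measurable_compose)
      then have "(F, G) \<in> L2_real M (gen_field M X Q) \<times> L2_real M (gen_field M X S)" by simp
      then show ?thesis unfolding max_corr_def by (rule SUP_upper2) simp
    qed
    ultimately have "ereal \<bar>corr M F G\<bar> \<le> ereal r" using rho by (metis order_trans)
    then have corr: "\<bar>E (\<lambda>s. F' s * G' s) / (sqrt (mean_sq F') * sqrt (mean_sq G'))\<bar> \<le> r"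
      by (simp add: corr_def F'_def G'_def)
    let ?R' = "sqrt (mean_sq F') * sqrt (mean_sq G')"
    have CS: "\<bar>E (\<lambda>s. F' s * G' s)\<bar> \<le> ?R'" by (rule L2_Cauchy_Schwarz_sqrt[OF L'])
    have R0: "0 \<le> ?R'" by simp
    have "\<bar>E (\<lambda>s. F' s * G' s)\<bar> \<le> r * ?R'"
    proof (cases "?R' = 0")
      case True
      then show ?thesis using CS unfolding True by simp
    next
      case False
      then have "0 < ?R'" using R0 by linarith
      then show ?thesis using corr unfolding abs_divide by (simp add: pos_divide_le_eq)
    qed
    also have "?R' \<le> ?R" using var by (intro mult_mono real_sqrt_le_mono) auto
    finally show ?thesis using r by (simp add: cov mult_left_mono)
  qed
  then show "\<bar>E (\<lambda>s. f (field_sum X y Q s) * g (field_sum X y S s)) -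
           E (\<lambda>s. f (field_sum X y Q s)) * E (\<lambda>s. g (field_sum X y S s))\<bar>
          \<le> r * (sqrt (E (\<lambda>s. (f (field_sum X y Q s))\<^sup>2)) *
             sqrt (E (\<lambda>s. (g (field_sum X y S s))\<^sup>2)))"
    by (simp add: F_def[abs_def] G_def[abs_def])
qed

lemma slices_corr_bound_family:
  assumes n: "1 \<le> n" and rho: "rho' M X n \<le> ereal r" and r: "0 \<le> r" and Q: "finite Q"
    and sep: "\<And>k l. k \<in> Q \<Longrightarrow> l \<in> Q \<Longrightarrow> c k \<noteq> c l \<Longrightarrow> int n \<le> \<bar>k $ u - l $ u\<bar>"
    and y: "y \<in> borel_measurable borel"
  shows "corr_bound_family M r (\<lambda>j. field_sum X y {k \<in> Q. c k = j}) (c ` Q)"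
  unfolding corr_bound_family_def
proof (intro allI impI)
  fix A assume A: "A \<subseteq> c ` Q"
  have "corr_bound M r (field_sum X y {k \<in> Q. c k \<in> A}) (field_sum X y {k \<in> Q. c k \<in> c ` Q - A})"
    using Q by (intro separated_corr_bound[OF n rho r _ _ sep y]) auto
  moreover have "c ` Q - A \<subseteq> c ` Q" by auto
  ultimately show "corr_bound M r (\<lambda>s. \<Sum>j\<in>A. field_sum X y {k \<in> Q. c k = j} s)
    (\<lambda>s. \<Sum>j\<in>c ` Q - A. field_sum X y {k \<in> Q. c k = j} s)"
    by (simp only: field_sum_Union[OF Q A] field_sum_Union[OF Q])
qed

end

lemma sum_card_slices:
  assumes "finite Q"
  shows "(\<Sum>j\<in>c ` Q. real (card {k \<in> Q. c k = j})) = real (card Q)"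
  using sum.image_gen[OF assms, of "\<lambda>_. 1::real" c] by simp

text \<open>Points may share coordinates, but different values of the same coordinate are far apart. This
  holds in a residue class modulo \<open>n\<close>.\<close>

definition coord_sparse :: "nat \<Rightarrow> (int ^ 'd::finite) set \<Rightarrow> bool" where
  "coord_sparse n Q \<longleftrightarrow> (\<forall>k\<in>Q. \<forall>l\<in>Q. \<forall>w. k $ w \<noteq> l $ w \<longrightarrow> int n \<le> \<bar>k $ w - l $ w\<bar>)"

lemma coord_sparse_subset: "coord_sparse n Q \<Longrightarrow> R \<subseteq> Q \<Longrightarrow> coord_sparse n R"
  unfolding coord_sparse_def by blast

context mixing_field
begin

text \<open>The mixing coefficient separates sets along one coordinate only, so a sparse set is treated one
  coordinate after the other: the slices with constant \<open>u\<close>-th coordinate are separated in direction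
  \<open>u\<close>, and each slice has one free coordinate less. Every coordinate costs the factor
  \<open>(1 + 1/32) / (1 - 1/32) \<le> 2\<close>.\<close>

lemma sparse_second_moment:
  assumes n: "1 \<le> n" and rho: "rho' M X n \<le> ereal (1 / 32)"
    and y: "y \<in> borel_measurable borel" and L: "\<And>k. (\<lambda>s. y (X k s)) \<in> L2_real M M"
    and E0: "\<And>k. E (\<lambda>s. y (X k s)) = 0"
    and v: "\<And>k. E (\<lambda>s. (y (X k s))\<^sup>2) \<le> v"
  shows "finite Q \<Longrightarrow> coord_sparse n Q \<Longrightarrow> (\<And>k l w. k \<in> Q \<Longrightarrow> l \<in> Q \<Longrightarrow> w \<notin> U \<Longrightarrow> k $ w = l $ w) \<Longrightarrow>
    E (\<lambda>s. (field_sum X y Q s)\<^sup>2) \<le> 2 ^ card U * v * card Q"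
  using finite[of U]
proof (induction U arbitrary: Q rule: finite_induct)
  case empty
  have "\<forall>k\<in>Q. \<forall>l\<in>Q. k = l" using empty.prems(3) unfolding vec_eq_iff by blast
  then consider "Q = {}" | k where "Q = {k}" by blast
  then show ?case using v by cases (auto simp: field_sum_def)
next
  case (insert u U)
  define \<xi> where "\<xi> j = field_sum X y {k \<in> Q. k $ u = j}" for j
  define J where "J = (\<lambda>k. k $ u) ` Q"
  have "finite J" using insert.prems(1) by (simp add: J_def)
  have L\<xi>: "\<xi> j \<in> L2_real M M" for j
    unfolding \<xi>_def field_sum_def[abs_def] by (intro L2_sum L)
  have E\<xi>: "E (\<xi> j) = 0" for j
    unfolding \<xi>_def field_sum_def[abs_def] by (simp add: L2_integrable[OF L] E0)
  have cb: "corr_bound_family M (1 / 32) \<xi> J"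
    unfolding \<xi>_def[abs_def] J_def
    using insert.prems(2) by (intro slices_corr_bound_family[OF n rho _ insert.prems(1) _ y]) (auto simp: coord_sparse_def)
  have sum: "field_sum X y Q s = (\<Sum>j\<in>J. \<xi> j s)" for s
    unfolding \<xi>_def J_def by (rule field_sum_slices[OF insert.prems(1)])
  have "31 / 32 * E (\<lambda>s. (field_sum X y Q s)\<^sup>2) \<le> 33 / 32 * (\<Sum>j\<in>J. mean_sq (\<xi> j))"
    using family_square_bounds(1)[OF \<open>finite J\<close> L\<xi> E\<xi> cb] by (simp add: sum)
  moreover have "(\<Sum>j\<in>J. mean_sq (\<xi> j)) \<le> (\<Sum>j\<in>J. 2 ^ card U * v * card {k \<in> Q. k $ u = j})"
    unfolding \<xi>_def
  proof (intro sum_mono insert.IH)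
    fix j k l w assume "k \<in> {k \<in> Q. k $ u = j}" "l \<in> {k \<in> Q. k $ u = j}" "w \<notin> U"
    then show "k $ w = l $ w" using insert.prems(3)[of k l w] by (cases "w = u") auto
  qed (use insert.prems(1,2) in \<open>auto intro: coord_sparse_subset\<close>)
  moreover have "\<dots> = 2 ^ card U * v * card Q"
    unfolding sum_distrib_left[symmetric] J_def by (simp only: sum_card_slices[OF insert.prems(1)])
  moreover have "0 \<le> (\<Sum>j\<in>J. mean_sq (\<xi> j))" by (intro sum_nonneg) simp
  ultimately show ?case using insert.hyps by simp
qed

text \<open>The same induction. The bound for a slice is quadratic in its cardinality, so its square root is
  linear and sums up over the slices.\<close>

lemma sparse_fourth_moment:
  assumes n: "1 \<le> n" and rho: "rho' M X n \<le> ereal (1 / 32)"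
    and y: "y \<in> borel_measurable borel" and b: "\<And>x. \<bar>y x\<bar> \<le> b"
    and E0: "\<And>k. E (\<lambda>s. y (X k s)) = 0"
  shows "finite Q \<Longrightarrow> coord_sparse n Q \<Longrightarrow> (\<And>k l w. k \<in> Q \<Longrightarrow> l \<in> Q \<Longrightarrow> w \<notin> U \<Longrightarrow> k $ w = l $ w) \<Longrightarrow>
    E (\<lambda>s. (field_sum X y Q s) ^ 4) \<le> 98304 ^ card U * b ^ 4 * (real (card Q))\<^sup>2"
  using finite[of U]
proof (induction U arbitrary: Q rule: finite_induct)
  case empty
  have b4: "E (\<lambda>s. y (X k s) ^ 4) \<le> b ^ 4" for k
  proof -
    have "y x ^ 4 \<le> b ^ 4" for x using power_mono[OF b[of x] abs_ge_zero, of 4] by (simp add: power_even_abs)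
    then have "E (\<lambda>s. y (X k s) ^ 4) \<le> E (\<lambda>s. b ^ 4)"
      by (intro integral_mono' ) auto
    then show ?thesis by (simp add: prob_space)
  qed
  have "\<forall>k\<in>Q. \<forall>l\<in>Q. k = l" using empty.prems(3) unfolding vec_eq_iff by blast
  then consider "Q = {}" | k where "Q = {k}" by blast
  then show ?case using b4 by cases (auto simp: field_sum_def)
next
  case (insert u U)
  define \<xi> where "\<xi> j = field_sum X y {k \<in> Q. k $ u = j}" for j
  define J where "J = (\<lambda>k. k $ u) ` Q"
  have b0: "0 \<le> b" using b abs_ge_zero order_trans by blast
  have "finite J" using insert.prems(1) by (simp add: J_def)
  have m\<xi>: "\<xi> j \<in> borel_measurable M" for j
    unfolding \<xi>_def using y by measurable
  have bd: "\<bar>\<xi> j s\<bar> \<le> card Q * b" for j s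
    unfolding \<xi>_def using insert.prems(1) b0
    by (intro order_trans[OF abs_field_sum_le[OF b] mult_right_mono]) (auto intro!: card_mono)
  have L: "(\<lambda>s. y (X k s)) \<in> L2_real M M" for k 
    using b measurable_compose[OF X_measurable y] by (intro L2_bounded[where c=b]) auto
  have E\<xi>: "E (\<xi> j) = 0" for j
    unfolding \<xi>_def field_sum_def[abs_def] by (simp add: L2_integrable[OF L] E0)
  have cb: "corr_bound_family M (1 / 32) \<xi> J"
    unfolding \<xi>_def[abs_def] J_def
    using insert.prems(2) by (intro slices_corr_bound_family[OF n rho _ insert.prems(1) _ y]) (auto simp: coord_sparse_def)
  have sum: "field_sum X y Q s = (\<Sum>j\<in>J. \<xi> j s)" for s
    unfolding \<xi>_def J_def by (rule field_sum_slices[OF insert.prems(1)])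
  define K where "K = 98304 ^ card U * b ^ 4"
  have K0: "0 \<le> K" by (simp add: K_def)
  have "sqrt (E (\<lambda>s. \<xi> j s ^ 4)) \<le> sqrt K * card {k \<in> Q. k $ u = j}" for j
  proof -
    have "E (\<lambda>s. \<xi> j s ^ 4) \<le> K * (real (card {k \<in> Q. k $ u = j}))\<^sup>2"
      unfolding \<xi>_def K_def
    proof (intro insert.IH)
      fix k l w assume "k \<in> {k \<in> Q. k $ u = j}" "l \<in> {k \<in> Q. k $ u = j}" "w \<notin> U"
      then show "k $ w = l $ w" using insert.prems(3)[of k l w] by (cases "w = u") auto
    qed (use insert.prems(1,2) in \<open>auto intro: coord_sparse_subset\<close>)
    then have "sqrt (E (\<lambda>s. \<xi> j s ^ 4)) \<le> sqrt (K * (real (card {k \<in> Q. k $ u = j}))\<^sup>2)"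
      by (rule real_sqrt_le_mono)
    then show ?thesis by (simp add: real_sqrt_mult)
  qed
  then have "(\<Sum>j\<in>J. sqrt (E (\<lambda>s. \<xi> j s ^ 4))) \<le> (\<Sum>j\<in>J. sqrt K * card {k \<in> Q. k $ u = j})"
    by (intro sum_mono)
  also have "\<dots> = sqrt K * card Q"
    unfolding sum_distrib_left[symmetric] J_def by (simp only: sum_card_slices[OF insert.prems(1)])
  finally have "(\<Sum>j\<in>J. sqrt (E (\<lambda>s. \<xi> j s ^ 4)))\<^sup>2 \<le> (sqrt K * card Q)\<^sup>2"
    by (intro power_mono sum_nonneg) auto
  also have "\<dots> = K * (real (card Q))\<^sup>2" using K0 by (simp add: power_mult_distrib)
  finally have "98304 * (\<Sum>j\<in>J. sqrt (E (\<lambda>s. \<xi> j s ^ 4)))\<^sup>2 \<le> 98304 * (K * (real (card Q))\<^sup>2)" by simp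
  moreover have "E (\<lambda>s. (field_sum X y Q s) ^ 4) \<le> 98304 * (\<Sum>j\<in>J. sqrt (E (\<lambda>s. \<xi> j s ^ 4)))\<^sup>2"
    unfolding sum by (rule family_power4_bound[OF \<open>finite J\<close> m\<xi> bd E\<xi> cb]) simp_all
  ultimately show ?case using insert.hyps by (simp add: K_def mult.assoc)
qed

end

definition residue :: "nat \<Rightarrow> int ^ 'd \<Rightarrow> int ^ 'd::finite" where
  "residue n k = (\<chi> w. k $ w mod int n)"

lemma card_residues_le:
  fixes Q :: "(int ^ 'd::finite) set"
  assumes "1 \<le> n"
  shows "card (residue n ` Q) \<le> n ^ CARD('d)"
proof -
  have "residue n ` Q \<subseteq> vec_lambda ` (\<Pi>\<^sub>E w\<in>(UNIV :: 'd set). {0..<int n})"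
  proof (intro image_subsetI)
    fix k assume "k \<in> Q"
    have "(\<lambda>w. k $ w mod int n) \<in> (\<Pi>\<^sub>E w\<in>(UNIV :: 'd set). {0..<int n})" using assms by auto
    then show "residue n k \<in> vec_lambda ` (\<Pi>\<^sub>E w\<in>(UNIV :: 'd set). {0..<int n})"
      unfolding residue_def by blast
  qed
  then have "card (residue n ` Q) \<le> card (vec_lambda ` (\<Pi>\<^sub>E w\<in>(UNIV :: 'd set). {0..<int n}))"
    by (intro card_mono finite_imageI finite_PiE) auto
  also have "\<dots> \<le> card (\<Pi>\<^sub>E w\<in>(UNIV :: 'd set). {0..<int n})"
    by (intro card_image_le finite_PiE) auto
  also have "\<dots> = n ^ CARD('d)" by (simp add: card_PiE)
  finally show ?thesis .
qed

lemma residue_class_sparse: "coord_sparse n {k \<in> Q. residue n k = j}"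
  unfolding coord_sparse_def
proof (intro ballI allI impI)
  fix k l w assume "k \<in> {k \<in> Q. residue n k = j}" "l \<in> {k \<in> Q. residue n k = j}" and ne: "k $ w \<noteq> l $ w"
  then have "residue n k $ w = residue n l $ w" by simp
  then have "int n dvd k $ w - l $ w" by (simp add: residue_def mod_eq_dvd_iff)
  then show "int n \<le> \<bar>k $ w - l $ w\<bar>" using ne by (intro zdvd_imp_le) auto
qed

context mixing_field
begin

text \<open>Any finite set is the union of at most \<open>n ^ d\<close> sparse ones. The constant does not depend on the observable,
  so that it can be applied to the remainder of a truncation.\<close>

lemma second_moment_bound:
  obtains C where "0 < C"
    and "\<And>y v Q. y \<in> borel_measurable borel \<Longrightarrow> (\<And>k. (\<lambda>s. y (X k s)) \<in> L2_real M M) \<Longrightarrow>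
      (\<And>k. E (\<lambda>s. y (X k s)) = 0) \<Longrightarrow> (\<And>k. E (\<lambda>s. (y (X k s))\<^sup>2) \<le> v) \<Longrightarrow>
      finite Q \<Longrightarrow> E (\<lambda>s. (field_sum X y Q s)\<^sup>2) \<le> C * v * card Q"
proof -
  obtain n where n: "1 \<le> n" and rho: "rho' M X n \<le> ereal (1 / 32)"
    using ex_rho'_le[of "1 / 32"] by auto
  define N where "N = real (n ^ CARD('d))"
  show ?thesis
  proof (rule that[of "N * 2 ^ CARD('d)"])
    show "0 < N * 2 ^ CARD('d)" using n by (simp add: N_def)
    fix y :: "real ^ 'm \<Rightarrow> real" and v and Q :: "(int ^ 'd) set"
    assume y: "y \<in> borel_measurable borel" and L: "\<And>k. (\<lambda>s. y (X k s)) \<in> L2_real M M"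
      and E0: "\<And>k. E (\<lambda>s. y (X k s)) = 0"
      and v: "\<And>k. E (\<lambda>s. (y (X k s))\<^sup>2) \<le> v" and Q: "finite Q"
    define W where "W = residue n ` Q"
    define \<xi> where "\<xi> j = field_sum X y {k \<in> Q. residue n k = j}" for j
    have L\<xi>: "\<xi> j \<in> L2_real M M" for j
      unfolding \<xi>_def field_sum_def[abs_def] by (intro L2_sum L)
    have v0: "0 \<le> v" using order_trans[OF _ v] by (metis Bochner_Integration.integral_nonneg zero_le_power2)
    have sum: "field_sum X y Q s = (\<Sum>j\<in>W. \<xi> j s)" for s
      unfolding \<xi>_def W_def by (rule field_sum_slices[OF Q])
    have W: "real (card W) \<le> N" unfolding N_def W_def using card_residues_le[OF n] by simp
    have "E (\<lambda>s. (field_sum X y Q s)\<^sup>2) \<le> E (\<lambda>s. (\<Sum>j\<in>W. (\<xi> j s)\<^sup>2) * card W)"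
      unfolding sum by (intro integral_mono' sum_squared_le_sum_of_squares)
        (auto simp: L2_integrable_square L\<xi> sum_nonneg)
    also have "\<dots> = (\<Sum>j\<in>W. mean_sq (\<xi> j)) * card W"
      by (simp add: L2_integrable_square L\<xi>)
    also have "\<dots> \<le> (\<Sum>j\<in>W. 2 ^ CARD('d) * v * card {k \<in> Q. residue n k = j}) * N"
      unfolding \<xi>_def using Q v0 W
      by (intro mult_mono sum_mono sparse_second_moment[OF n rho y L E0 v] residue_class_sparse sum_nonneg) auto
    also have "\<dots> = N * 2 ^ CARD('d) * v * card Q"
      unfolding sum_distrib_left[symmetric] W_def by (simp only: sum_card_slices[OF Q]) simp
    finally show "E (\<lambda>s. (field_sum X y Q s)\<^sup>2) \<le> N * 2 ^ CARD('d) * v * card Q" .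
  qed
qed

lemma fourth_moment_bound:
  obtains C where "0 < C"
    and "\<And>y b Q. y \<in> borel_measurable borel \<Longrightarrow> (\<And>x. \<bar>y x\<bar> \<le> b) \<Longrightarrow>
      (\<And>k. E (\<lambda>s. y (X k s)) = 0) \<Longrightarrow>
      finite Q \<Longrightarrow> E (\<lambda>s. (field_sum X y Q s) ^ 4) \<le> C * b ^ 4 * (real (card Q))\<^sup>2"
proof -
  obtain n where n: "1 \<le> n" and rho: "rho' M X n \<le> ereal (1 / 32)"
    using ex_rho'_le[of "1 / 32"] by auto
  define N where "N = real (n ^ CARD('d))"
  have N0: "0 < N" using n by (simp add: N_def)
  show ?thesis
  proof (rule that[of "N ^ 3 * 98304 ^ CARD('d)"])
    show "0 < N ^ 3 * 98304 ^ CARD('d)" using N0 by simp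
    fix y :: "real ^ 'm \<Rightarrow> real" and b and Q :: "(int ^ 'd) set"
    assume y: "y \<in> borel_measurable borel" and b: "\<And>x. \<bar>y x\<bar> \<le> b"
      and E0: "\<And>k. E (\<lambda>s. y (X k s)) = 0" and Q: "finite Q"
    define W where "W = residue n ` Q"
    define \<xi> where "\<xi> j = field_sum X y {k \<in> Q. residue n k = j}" for j
    have b0: "0 \<le> b" using b abs_ge_zero order_trans by blast
    have bd: "\<bar>\<xi> j s\<bar> \<le> card Q * b" for j s
      unfolding \<xi>_def using Q b0
      by (intro order_trans[OF abs_field_sum_le[OF b] mult_right_mono]) (auto intro!: card_mono)
    have i4: "integrable M (\<lambda>s. \<xi> j s ^ 4)" for j
      by (rule bounded_power4_integrable[OF _ bd]) (use y in \<open>simp add: \<xi>_def\<close>)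
    have sum: "field_sum X y Q s = (\<Sum>j\<in>W. \<xi> j s)" for s
      unfolding \<xi>_def W_def by (rule field_sum_slices[OF Q])
    have W: "real (card W) \<le> N" unfolding N_def W_def using card_residues_le[OF n] by simp
    have pow: "(\<Sum>j\<in>W. \<xi> j s) ^ 4 \<le> N ^ 3 * (\<Sum>j\<in>W. \<xi> j s ^ 4)" for s
    proof -
      have "((\<Sum>j\<in>W. \<xi> j s)\<^sup>2)\<^sup>2 \<le> ((\<Sum>j\<in>W. (\<xi> j s)\<^sup>2) * card W)\<^sup>2"
        by (intro power_mono sum_squared_le_sum_of_squares) auto
      also have "\<dots> = (\<Sum>j\<in>W. (\<xi> j s)\<^sup>2)\<^sup>2 * (real (card W))\<^sup>2" by (simp add: power_mult_distrib)
      also have "\<dots> \<le> ((\<Sum>j\<in>W. ((\<xi> j s)\<^sup>2)\<^sup>2) * card W) * (real (card W))\<^sup>2"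
        by (intro mult_right_mono sum_squared_le_sum_of_squares) auto
      also have "\<dots> = real (card W) ^ 3 * (\<Sum>j\<in>W. \<xi> j s ^ 4)"
        by (simp add: power3_eq_cube power2_eq_square power4_eq_xxxx mult.assoc)
      also have "\<dots> \<le> N ^ 3 * (\<Sum>j\<in>W. \<xi> j s ^ 4)"
        using W by (intro mult_right_mono power_mono sum_nonneg) auto
      finally show ?thesis by simp
    qed
    have "E (\<lambda>s. (field_sum X y Q s) ^ 4) \<le> E (\<lambda>s. N ^ 3 * (\<Sum>j\<in>W. \<xi> j s ^ 4))"
      unfolding sum using N0 by (intro integral_mono' pow) (auto simp: i4 intro!: mult_nonneg_nonneg sum_nonneg)
    also have "\<dots> = N ^ 3 * (\<Sum>j\<in>W. E (\<lambda>s. \<xi> j s ^ 4))" by (simp add: i4)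
    also have "\<dots> \<le> N ^ 3 * (\<Sum>j\<in>W. 98304 ^ CARD('d) * b ^ 4 * card Q * card {k \<in> Q. residue n k = j})"
    proof (intro mult_left_mono sum_mono)
      fix j
      let ?q = "real (card {k \<in> Q. residue n k = j})"
      have "E (\<lambda>s. \<xi> j s ^ 4) \<le> 98304 ^ CARD('d) * b ^ 4 * ?q\<^sup>2"
        unfolding \<xi>_def using Q
        by (intro sparse_fourth_moment[OF n rho y b E0] residue_class_sparse) auto
      also have "\<dots> \<le> 98304 ^ CARD('d) * b ^ 4 * (card Q * ?q)"
      proof -
        have "?q \<le> card Q" using Q by (auto intro!: card_mono)
        then have "?q * ?q \<le> card Q * ?q" by (intro mult_right_mono) auto
        then show ?thesis unfolding power2_eq_square by (intro mult_left_mono) auto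
      qed
      finally show "E (\<lambda>s. \<xi> j s ^ 4) \<le> 98304 ^ CARD('d) * b ^ 4 * card Q * ?q" by (simp add: mult.assoc)
    qed (use N0 in auto)
    also have "\<dots> = N ^ 3 * 98304 ^ CARD('d) * b ^ 4 * (real (card Q))\<^sup>2"
      unfolding sum_distrib_left[symmetric] W_def by (simp only: sum_card_slices[OF Q]) (simp add: power2_eq_square)
    finally show "E (\<lambda>s. (field_sum X y Q s) ^ 4) \<le> N ^ 3 * 98304 ^ CARD('d) * b ^ 4 * (real (card Q))\<^sup>2" .
  qed
qed

end

section \<open>Cutting a box into slabs\<close>

lemma card_index_box: "real (card (index_box L)) = box_volume L"
proof -
  have "index_box L = vec_lambda ` (\<Pi>\<^sub>E u\<in>UNIV. {1..int (L $ u)})"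
  proof (intro equalityI subsetI)
    fix k assume "k \<in> index_box L"
    then have "(\<lambda>u. k $ u) \<in> (\<Pi>\<^sub>E u\<in>UNIV. {1..int (L $ u)})"
      by (auto simp: index_box_def)
    moreover have "k = vec_lambda (\<lambda>u. k $ u)" by simp
    ultimately show "k \<in> vec_lambda ` (\<Pi>\<^sub>E u\<in>UNIV. {1..int (L $ u)})" by blast
  qed (auto simp: index_box_def)
  moreover have "inj_on vec_lambda (\<Pi>\<^sub>E u\<in>(UNIV :: 'a set). {1..int (L $ u)})"
    by (rule inj_onI) (metis vec_lambda_inverse UNIV_I)
  ultimately have "card (index_box L) = card (\<Pi>\<^sub>E u\<in>UNIV. {1..int (L $ u)})"
    by (simp add: card_image)
  then show ?thesis by (simp add: card_PiE box_volume_def)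
qed

definition set_coord :: "nat ^ 'd \<Rightarrow> 'd \<Rightarrow> nat \<Rightarrow> nat ^ 'd::finite" where
  "set_coord L u q = (\<chi> w. if w = u then q else L $ w)"

lemma box_volume_set_coord: "box_volume (set_coord L u q) * real (L $ u) = box_volume L * real q"
proof -
  have "box_volume (set_coord L u q) = real q * (\<Prod>w\<in>UNIV - {u}. real (L $ w))"
    unfolding box_volume_def by (subst prod.remove[of _ u]) (auto simp: set_coord_def intro!: prod.cong)
  moreover have "box_volume L = real (L $ u) * (\<Prod>w\<in>UNIV - {u}. real (L $ w))"
    unfolding box_volume_def by (subst prod.remove[of _ u]) auto
  ultimately show ?thesis by simp
qed

lemma box_volume_pos: "(\<And>w. 1 \<le> L $ w) \<Longrightarrow> 0 < box_volume L"
  unfolding box_volume_def by (intro prod_pos) (metis One_nat_def of_nat_0_less_iff Suc_le_lessD)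

definition axis_shift :: "'d \<Rightarrow> int \<Rightarrow> int ^ 'd::finite" where
  "axis_shift u a = (\<chi> w. if w = u then a else 0)"

text \<open>Slab \<open>j\<close> takes \<open>q\<close> consecutive values of the \<open>u\<close>-th coordinate and is followed by a gap of length
  \<open>n\<close>. Being a translate of the box with side \<open>u\<close> replaced by \<open>q\<close>, it carries a sum with the law of the sum
  over that box.\<close>

definition slab :: "nat ^ 'd \<Rightarrow> 'd \<Rightarrow> nat \<Rightarrow> nat \<Rightarrow> nat \<Rightarrow> (int ^ 'd::finite) set" where
  "slab L u q n j = (\<lambda>k. k + axis_shift u (int (j * (q + n)))) ` index_box (set_coord L u q)"

lemma mem_slab_iff:
  "k \<in> slab L u q n j \<longleftrightarrow>
     (\<forall>w. w \<noteq> u \<longrightarrow> 1 \<le> k $ w \<and> k $ w \<le> int (L $ w)) \<and>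
     int (j * (q + n)) + 1 \<le> k $ u \<and> k $ u \<le> int (j * (q + n)) + int q"
proof -
  have "k \<in> slab L u q n j \<longleftrightarrow> k - axis_shift u (int (j * (q + n))) \<in> index_box (set_coord L u q)"
    unfolding slab_def by (auto simp: image_iff) (metis add_diff_cancel diff_add_cancel)
  also have "\<dots> \<longleftrightarrow> (\<forall>w. 1 \<le> (k - axis_shift u (int (j * (q + n)))) $ w \<and>
      (k - axis_shift u (int (j * (q + n)))) $ w \<le> int (set_coord L u q $ w))"
    by (simp add: index_box_def)
  also have "\<dots> \<longleftrightarrow> (\<forall>w. w \<noteq> u \<longrightarrow> 1 \<le> k $ w \<and> k $ w \<le> int (L $ w)) \<and>
     int (j * (q + n)) + 1 \<le> k $ u \<and> k $ u \<le> int (j * (q + n)) + int q"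
    by (auto simp: axis_shift_def set_coord_def algebra_simps split: if_splits)
  finally show ?thesis .
qed

lemma finite_slab [simp]: "finite (slab L u q n j)"
  unfolding slab_def by (intro finite_imageI finite_index_box)

lemma slab_separated_less:
  assumes "i < j" "k \<in> slab L u q n i" "l \<in> slab L u q n j"
  shows "int n < l $ u - k $ u"
proof -
  have "int ((i + 1) * (q + n)) \<le> int (j * (q + n))"
    using assms(1) by (intro of_nat_mono mult_right_mono) auto
  moreover have "k $ u \<le> int (i * (q + n)) + int q" "int (j * (q + n)) + 1 \<le> l $ u"
    using assms by (auto simp: mem_slab_iff)
  ultimately show ?thesis by (simp add: algebra_simps)
qed

lemma slab_separated:
  assumes "i \<noteq> j" "k \<in> slab L u q n i" "l \<in> slab L u q n j"
  shows "int n < \<bar>k $ u - l $ u\<bar>"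
  using assms slab_separated_less[of i j k L u q n l] slab_separated_less[of j i l L u q n k]
  by (cases "i < j") auto

lemma slab_disjoint: "i \<noteq> j \<Longrightarrow> slab L u q n i \<inter> slab L u q n j = {}"
  using slab_separated[of i j _ L u q n] by fastforce

lemma slab_subset:
  assumes "j < p" "p * (q + n) \<le> L $ u"
  shows "slab L u q n j \<subseteq> index_box L"
proof
  fix k assume k: "k \<in> slab L u q n j"
  have "(j + 1) * (q + n) \<le> p * (q + n)" using assms(1) by (intro mult_right_mono) auto
  then have "int (j * (q + n)) + int q \<le> int (L $ u)"
    using assms(2) by (simp add: algebra_simps flip: of_nat_add of_nat_mult)
  moreover have "0 \<le> int (j * (q + n))" by simp
  ultimately have "1 \<le> k $ u \<and> k $ u \<le> int (L $ u)"
    using k unfolding mem_slab_iff by linarith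
  then have "1 \<le> k $ w \<and> k $ w \<le> int (L $ w)" for w
    using k by (cases "w = u") (auto simp: mem_slab_iff)
  then show "k \<in> index_box L" by (simp add: index_box_def)
qed

lemma card_slab: "real (card (slab L u q n j)) = box_volume (set_coord L u q)"
  unfolding slab_def by (subst card_image) (auto simp: card_index_box)

lemma field_sum_slabs:
  "finite A \<Longrightarrow> (\<Sum>j\<in>A. field_sum X y (slab L u q n j) s) = field_sum X y (\<Union>j\<in>A. slab L u q n j) s"
  unfolding field_sum_def by (subst sum.UNION_disjoint) (simp_all add: slab_disjoint)

lemma card_Union_slabs:
  "real (card (\<Union>j<p. slab L u q n j)) = real p * box_volume (set_coord L u q)"
  by (subst card_UN_disjoint) (simp_all add: slab_disjoint card_slab)

lemma card_slab_remainder: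
  assumes "p * (q + n) \<le> L $ u" "0 < L $ u"
  shows "real (card (index_box L - (\<Union>j<p. slab L u q n j))) =
    box_volume L * (1 - real (p * q) / real (L $ u))"
proof -
  have sub: "(\<Union>j<p. slab L u q n j) \<subseteq> index_box L" using slab_subset[OF _ assms(1)] by blast
  have "real (card (index_box L - (\<Union>j<p. slab L u q n j))) =
     real (card (index_box L)) - real (card (\<Union>j<p. slab L u q n j))"
    using sub by (subst card_Diff_subset) (auto simp: finite_index_box card_mono of_nat_diff)
  also have "\<dots> = box_volume L - real p * box_volume (set_coord L u q)"
    unfolding card_Union_slabs card_index_box ..
  also have "box_volume (set_coord L u q) = box_volume L * real q / real (L $ u)"
    using box_volume_set_coord[of L u q] assms(2) by (simp add: field_simps)
  finally show ?thesis by (simp add: field_simps)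
qed

section \<open>The limiting variance\<close>

locale scalar_field = mixing_field M X
  for M :: "'a measure" and X :: "int ^ 'd::finite \<Rightarrow> 'a \<Rightarrow> real ^ 'm::finite" +
  fixes y :: "real ^ 'm \<Rightarrow> real"
  assumes y_borel [measurable]: "y \<in> borel_measurable borel"
    and y_L2: "\<And>k. (\<lambda>s. y (X k s)) \<in> L2_real M M"
    and y_mean: "\<And>k. E (\<lambda>s. y (X k s)) = 0"
begin

abbreviation S :: "(int ^ 'd) set \<Rightarrow> 'a \<Rightarrow> real" where "S \<equiv> field_sum X y"

definition V :: "nat ^ 'd \<Rightarrow> real" where
  "V L = mean_sq (S (index_box L)) / box_volume L"

lemma S_L2: "S Q \<in> L2_real M M"
  unfolding field_sum_def[abs_def] by (intro L2_sum y_L2)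

lemma S_mean: "E (S Q) = 0"
  unfolding field_sum_def[abs_def] by (simp add: L2_integrable[OF y_L2] y_mean)

lemma stationary_single:
  fixes g :: "real \<Rightarrow> 'e::{banach, second_countable_topology}"
  assumes "z \<in> borel_measurable borel" "g \<in> borel_measurable borel"
  shows "(\<integral>s. g (z (X k s)) \<partial>M) = (\<integral>s. g (z (X 0 s)) \<partial>M)"
  using expectation_field_sum_shift[OF assms, of "{0}" k] by (simp add: field_sum_def)

lemma S_second_moment: obtains K :: real where "0 < K"
  "\<And>Q. finite Q \<Longrightarrow> mean_sq (S Q) \<le> K * card Q"
proof -
  define v where "v = E (\<lambda>s. (y (X 0 s))\<^sup>2)"
  have v: "E (\<lambda>s. (y (X k s))\<^sup>2) \<le> v + 1" for k
    using stationary_single[OF y_borel, of "\<lambda>x. x\<^sup>2" k] by (simp add: v_def)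
  have "0 \<le> v" by (simp add: v_def)
  obtain C where C: "0 < C" "\<And>y v Q. y \<in> borel_measurable borel \<Longrightarrow> (\<And>k. (\<lambda>s. y (X k s)) \<in> L2_real M M) \<Longrightarrow>
      (\<And>k. E (\<lambda>s. y (X k s)) = 0) \<Longrightarrow> (\<And>k. E (\<lambda>s. (y (X k s))\<^sup>2) \<le> v) \<Longrightarrow>
      finite Q \<Longrightarrow> E (\<lambda>s. (field_sum X y Q s)\<^sup>2) \<le> C * v * card Q"
    using second_moment_bound by blast
  show ?thesis
    by (rule that[of "C * (v + 1)"]) (use C \<open>0 \<le> v\<close> C(2)[OF y_borel y_L2 y_mean v] in auto)
qed

lemma slab_corr_bound:
  assumes n: "1 \<le> n" and rho: "rho' M X n \<le> ereal r" and r: "0 \<le> r"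
    and A: "finite A" "finite B" "A \<inter> B = {}"
  shows "corr_bound M r (\<lambda>s. \<Sum>j\<in>A. S (slab L u q n j) s) (\<lambda>s. \<Sum>j\<in>B. S (slab L u q n j) s)"
proof -
  have "corr_bound M r (S (\<Union>j\<in>A. slab L u q n j)) (S (\<Union>j\<in>B. slab L u q n j))"
  proof (rule separated_corr_bound[OF n rho r _ _ _ y_borel])
    fix k l assume "k \<in> (\<Union>j\<in>A. slab L u q n j)" "l \<in> (\<Union>j\<in>B. slab L u q n j)"
    then obtain i j where ij: "i \<in> A" "j \<in> B" "k \<in> slab L u q n i" "l \<in> slab L u q n j" by auto
    then have "i \<noteq> j" using A by auto
    then show "int n \<le> \<bar>k $ u - l $ u\<bar>" using slab_separated[OF _ ij(3,4)] by simp
  qed (use A in auto)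
  then show ?thesis using A by (simp add: field_sum_slabs)
qed

lemma slab_expectation:
  fixes g :: "real \<Rightarrow> 'e::{banach, second_countable_topology}"
  assumes "g \<in> borel_measurable borel"
  shows "(\<integral>s. g (S (slab L u q n j) s) \<partial>M) = (\<integral>s. g (S (index_box (set_coord L u q)) s) \<partial>M)"
  unfolding slab_def by (rule expectation_field_sum_shift[OF y_borel assms finite_index_box])

lemma slab_remainder_second_moment:
  fixes K :: real
  assumes K: "\<And>Q. finite Q \<Longrightarrow> mean_sq (S Q) \<le> K * card Q"
    and pq: "p * (q + n) \<le> L $ u" "0 < L $ u"
  shows "E (\<lambda>s. (S (index_box L) s - (\<Sum>j<p. S (slab L u q n j) s))\<^sup>2) \<le>
    K * (box_volume L * (1 - real (p * q) / real (L $ u)))"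
proof -
  let ?B = "\<Union>j<p. slab L u q n j"
  have sub: "?B \<subseteq> index_box L" using slab_subset[OF _ pq(1)] by blast
  have "S (index_box L) s - (\<Sum>j<p. S (slab L u q n j) s) = S (index_box L - ?B) s" for s
    unfolding field_sum_slabs[OF finite_lessThan]
    by (simp add: field_sum_def sum_diff[OF finite_index_box sub])
  then show ?thesis
    using K[of "index_box L - ?B"] card_slab_remainder[OF pq] by (simp add: finite_index_box)
qed

text \<open>The sites outside the \<open>p\<close> slabs form the fraction \<open>1 - p q / L\<^sub>u\<close> of the box and contribute the
  square root of this fraction, since they enter through the Cauchy-Schwarz inequality; the
  almost orthogonality of the slabs contributes the multiple of \<open>r\<close>.\<close>

lemma variance_step:
  fixes K :: real
  assumes K: "0 < K" "\<And>Q. finite Q \<Longrightarrow> mean_sq (S Q) \<le> K * card Q"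
    and n: "1 \<le> n" and rho: "rho' M X n \<le> ereal r" and r: "0 \<le> r" "r \<le> 1"
    and pq: "p * (q + n) \<le> L $ u" "1 \<le> q" and L: "\<And>w. 1 \<le> L $ w"
  shows "\<bar>V L - V (set_coord L u q)\<bar> \<le> K * (3 * sqrt (1 - real (p * q) / real (L $ u)) + 2 * r)"
proof -
  let ?L' = "set_coord L u q"
  define T where "T s = (\<Sum>j<p. S (slab L u q n j) s)" for s
  define \<delta> where "\<delta> = 1 - real (p * q) / real (L $ u)"
  have Lu: "0 < L $ u" using L[of u] by simp
  have vol: "0 < box_volume L" "0 < box_volume ?L'"
    using L pq(2) by (auto intro!: box_volume_pos simp: set_coord_def)
  have pqL: "real (p * q) \<le> real (L $ u)"
    using pq(1) unfolding of_nat_le_iff by (simp add: algebra_simps)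
  have \<delta>: "0 \<le> \<delta>" "\<delta> \<le> 1" using pqL Lu by (auto simp: \<delta>_def)
  have TL: "T \<in> L2_real M M" unfolding T_def[abs_def] by (intro L2_sum S_L2)
  define t where "t = mean_sq T / box_volume L"
  have TS: "T s = S (\<Union>j<p. slab L u q n j) s" for s
    unfolding T_def by (rule field_sum_slabs) simp
  have volp: "real p * box_volume ?L' = box_volume L * (1 - \<delta>)"
    using box_volume_set_coord[of L u q] Lu by (simp add: \<delta>_def field_simps)
  have ET: "mean_sq T \<le> K * box_volume L"
  proof -
    have "mean_sq T \<le> K * (box_volume L * (1 - \<delta>))"
      unfolding TS using K(2)[of "\<Union>j<p. slab L u q n j"] by (simp add: card_Union_slabs volp)
    also have "\<dots> \<le> K * box_volume L" using K vol \<delta> by (intro mult_left_mono) (auto simp: mult_le_cancel_left1)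
    finally show ?thesis .
  qed
  have ES: "mean_sq (S (index_box L)) \<le> K * box_volume L" for L :: "nat ^ 'd"
    using K(2)[of "index_box L"] by (simp add: finite_index_box card_index_box)
  have V': "0 \<le> V ?L'" "V ?L' \<le> K" using ES[of ?L'] vol by (auto simp: V_def field_simps)
  have t: "0 \<le> t" "t \<le> K" using ET vol by (auto simp: t_def field_simps)
  have 1: "\<bar>V L - t\<bar> \<le> 2 * K * sqrt \<delta>"
  proof -
    have L2: "(\<lambda>s. S (index_box L) s - T s) \<in> L2_real M M" "(\<lambda>s. S (index_box L) s + T s) \<in> L2_real M M"
      by (intro L2_diff L2_add S_L2 TL)+
    have "E (\<lambda>s. (S (index_box L) s - T s) * (S (index_box L) s + T s)) =
       E (\<lambda>s. (S (index_box L) s)\<^sup>2 - (T s)\<^sup>2)"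
      by (intro Bochner_Integration.integral_cong refl) (simp add: power2_eq_square algebra_simps)
    also have "\<dots> = mean_sq (S (index_box L)) - mean_sq T"
      by (simp add: L2_integrable_square S_L2 TL)
    finally have "\<bar>mean_sq (S (index_box L)) - mean_sq T\<bar> \<le>
      sqrt (E (\<lambda>s. (S (index_box L) s - T s)\<^sup>2)) * sqrt (E (\<lambda>s. (S (index_box L) s + T s)\<^sup>2))"
      using L2_Cauchy_Schwarz_sqrt[OF L2] by simp
    also have "\<dots> \<le> sqrt (K * (box_volume L * \<delta>)) * sqrt (4 * (K * box_volume L))"
    proof (intro mult_mono real_sqrt_le_mono)
      show "E (\<lambda>s. (S (index_box L) s - T s)\<^sup>2) \<le> K * (box_volume L * \<delta>)"
        unfolding T_def \<delta>_def by (rule slab_remainder_second_moment[OF K(2) pq(1) Lu])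
      show "E (\<lambda>s. (S (index_box L) s + T s)\<^sup>2) \<le> 4 * (K * box_volume L)"
        using L2_square_add_le[OF S_L2 TL, of "index_box L"] ES[of L] ET by linarith
    qed (use K vol \<delta> in auto)
    also have "\<dots> = sqrt ((2 * K * box_volume L)\<^sup>2 * \<delta>)"
      unfolding real_sqrt_mult[symmetric] by (simp add: power2_eq_square algebra_simps)
    also have "\<dots> = 2 * K * box_volume L * sqrt \<delta>"
      using K vol by (simp add: real_sqrt_mult)
    finally have "\<bar>mean_sq (S (index_box L)) - mean_sq T\<bar> / box_volume L \<le>
      2 * K * sqrt \<delta>"
      using vol by (simp add: field_simps)
    then show ?thesis using vol by (simp add: V_def t_def diff_divide_distrib[symmetric] abs_divide)
  qed
  define m where "m = V ?L' * (1 - \<delta>)"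
  have m: "0 \<le> m" "m \<le> K" using V' \<delta> mult_mono[of "V ?L'" K "1 - \<delta>" 1] by (auto simp: m_def)
  have mE: "(\<Sum>j<p. E (\<lambda>s. (S (slab L u q n j) s)\<^sup>2)) / box_volume L = m"
  proof -
    have "(\<Sum>j<p. E (\<lambda>s. (S (slab L u q n j) s)\<^sup>2)) = real p * E (\<lambda>s. (S (index_box ?L') s)\<^sup>2)"
      using slab_expectation[of "\<lambda>x. x\<^sup>2" L u q n] by simp
    also have "\<dots> = V ?L' * (real p * box_volume ?L')" using vol by (simp add: V_def)
    finally show ?thesis unfolding volp m_def using vol by simp
  qed
  have cb: "corr_bound_family M r (\<lambda>j. S (slab L u q n j)) {..<p}"
    unfolding corr_bound_family_def
    using finite_subset by (intro allI impI slab_corr_bound[OF n rho r(1)]) auto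
  note fam = family_square_bounds[OF finite_lessThan S_L2 S_mean cb r]
  have "(1 - r) * mean_sq T / box_volume L \<le> (1 + r) * (\<Sum>j<p. E (\<lambda>s. (S (slab L u q n j) s)\<^sup>2)) / box_volume L"
    using fam(1) vol unfolding T_def by (intro divide_right_mono) auto
  then have 2: "(1 - r) * t \<le> (1 + r) * m"
    unfolding t_def mE[symmetric] by simp
  have "(1 - r) * (\<Sum>j<p. E (\<lambda>s. (S (slab L u q n j) s)\<^sup>2)) / box_volume L \<le> (1 + r) * mean_sq T / box_volume L"
    using fam(2) vol unfolding T_def by (intro divide_right_mono) auto
  then have 3: "(1 - r) * m \<le> (1 + r) * t"
    unfolding t_def mE[symmetric] by simp
  have "\<bar>t - m\<bar> \<le> r * t + r * m" using 2 3 by (simp add: algebra_simps abs_le_iff)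
  also have "\<dots> \<le> r * K + r * K" using r t m by (intro add_mono mult_left_mono) auto
  finally have 4: "\<bar>t - m\<bar> \<le> 2 * r * K" by (simp add: mult.commute mult.left_commute)
  have "\<bar>m - V ?L'\<bar> = \<delta> * V ?L'" using V' \<delta> by (simp add: m_def algebra_simps)
  also have "\<dots> \<le> sqrt \<delta> * K"
  proof (intro mult_mono)
    have "\<delta> * \<delta> \<le> 1 * \<delta>" using \<delta> by (intro mult_right_mono) auto
    then show "\<delta> \<le> sqrt \<delta>" using \<delta> by (intro real_le_rsqrt) (simp add: power2_eq_square)
  qed (use V' \<delta> in auto)
  finally have "\<bar>m - V ?L'\<bar> \<le> K * sqrt \<delta>" by (simp add: mult.commute)
  then have "\<bar>V L - V ?L'\<bar> \<le> K * (3 * sqrt \<delta> + 2 * r)"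
    using 1 4 by (simp add: algebra_simps abs_le_iff)
  then show ?thesis by (simp add: \<delta>_def)
qed

text \<open>A large \<open>q\<close> makes the gaps negligible against the slabs, and a large \<open>N\<close> makes an incomplete last slab
  negligible against \<open>L\<^sub>u\<close>. Neither depends on the other sides of the box.\<close>

lemma variance_reduce_coord:
  assumes "0 < \<epsilon>"
  obtains q N where "1 \<le> q" "1 \<le> N"
    "\<And>L u. (\<And>w. 1 \<le> L $ w) \<Longrightarrow> N \<le> L $ u \<Longrightarrow> \<bar>V L - V (set_coord L u q)\<bar> \<le> \<epsilon>"
proof -
  obtain K :: real where K: "0 < K" "\<And>Q. finite Q \<Longrightarrow> mean_sq (S Q) \<le> K * card Q"
    using S_second_moment by blast
  define r where "r = min 1 (\<epsilon> / (4 * K))"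
  have r: "0 < r" "r \<le> 1" "r \<le> \<epsilon> / (4 * K)" using assms K(1) by (simp_all add: r_def)
  have rK: "K * (2 * r) \<le> \<epsilon> / 2" using r(3) K(1) by (simp add: field_simps)
  obtain n where n: "1 \<le> n" "rho' M X n \<le> ereal r" using ex_rho'_le[OF r(1)] by auto
  define \<eta> where "\<eta> = (\<epsilon> / (6 * K))\<^sup>2"
  have \<eta>: "0 < \<eta>" using assms K by (simp add: \<eta>_def)
  obtain q where q: "1 \<le> q" "real n / \<eta> * 2 \<le> real q"
    using eventually_conj[OF eventually_ge_at_top[of 1]
      filterlim_at_top[THEN iffD1, OF filterlim_real_sequentially, rule_format, of "real n / \<eta> * 2"]]
    by (auto simp: eventually_at_top_linorder)
  obtain N where N: "1 \<le> N" "real (q + n) / \<eta> * 2 \<le> real N"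
    using eventually_conj[OF eventually_ge_at_top[of 1]
      filterlim_at_top[THEN iffD1, OF filterlim_real_sequentially, rule_format, of "real (q + n) / \<eta> * 2"]]
    by (auto simp: eventually_at_top_linorder)
  show ?thesis
  proof (rule that[OF q(1) N(1)])
    fix L :: "nat ^ 'd" and u assume L: "\<And>w. 1 \<le> L $ w" and LN: "N \<le> L $ u"
    define p where "p = L $ u div (q + n)"
    have pq: "p * (q + n) \<le> L $ u" by (simp add: p_def div_times_less_eq_dividend)
    have Lu: "0 < real (L $ u)" using L[of u] by simp
    have "L $ u mod (q + n) < q + n" using q(1) by simp
    moreover have "L $ u = p * (q + n) + L $ u mod (q + n)" by (simp only: p_def div_mult_mod_eq)
    ultimately have "L $ u \<le> p * (q + n) + (q + n)" by linarith
    from of_nat_mono[OF this, where 'a=real]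
    have "real (L $ u) \<le> real p * real (q + n) + real (q + n)"
      by (simp only: of_nat_add of_nat_mult)
    then have "real (L $ u) - real (p * q) \<le> real p * real n + real (q + n)"
      by (simp add: algebra_simps)
    moreover have "real p * real n \<le> \<eta> / 2 * real (L $ u)"
    proof -
      have "real n \<le> \<eta> / 2 * real q" using q(2) \<eta> by (simp add: field_simps)
      then have "real p * real n \<le> real p * (\<eta> / 2 * real q)" by (intro mult_left_mono) auto
      also have "\<dots> = \<eta> / 2 * real (p * q)" by simp
      also have "\<dots> \<le> \<eta> / 2 * real (L $ u)"
        using pq \<eta> by (intro mult_left_mono) (auto simp: algebra_simps simp flip: of_nat_mult of_nat_add)
      finally show ?thesis .
    qed
    moreover have "real (q + n) \<le> \<eta> / 2 * real (L $ u)"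
    proof -
      have "real (q + n) \<le> \<eta> / 2 * real N" using N(2) \<eta> by (simp add: field_simps)
      also have "\<dots> \<le> \<eta> / 2 * real (L $ u)" using LN \<eta> by (intro mult_left_mono) auto
      finally show ?thesis .
    qed
    ultimately have "real (L $ u) - real (p * q) \<le> \<eta> * real (L $ u)" by linarith
    then have "1 - real (p * q) / real (L $ u) \<le> \<eta>" using Lu by (simp add: field_simps)
    then have "sqrt (1 - real (p * q) / real (L $ u)) \<le> sqrt \<eta>" by (rule real_sqrt_le_mono)
    also have "sqrt \<eta> = \<epsilon> / (6 * K)" using assms K by (simp add: \<eta>_def)
    finally have "K * (3 * sqrt (1 - real (p * q) / real (L $ u))) \<le> K * (3 * (\<epsilon> / (6 * K)))"
      using K by (intro mult_left_mono) auto
    also have "\<dots> = \<epsilon> / 2" using K by simp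
    finally show "\<bar>V L - V (set_coord L u q)\<bar> \<le> \<epsilon>"
      using variance_step[OF K n less_imp_le[OF r(1)] r(2) pq q(1) L] rK by (simp add: algebra_simps)
  qed
qed

text \<open>The sides are replaced by \<open>q\<close> one after the other. The estimate for one side holds whether the others
  are still long or already short.\<close>

lemma variance_near_cube:
  assumes "0 < \<epsilon>"
  obtains N c where "1 \<le> N" "\<And>L. (\<And>w. N \<le> L $ w) \<Longrightarrow> \<bar>V L - c\<bar> \<le> \<epsilon>"
proof -
  define \<epsilon>' where "\<epsilon>' = \<epsilon> / CARD('d)"
  have "0 < \<epsilon>'" using assms by (simp add: \<epsilon>'_def)
  then obtain q N where qN: "1 \<le> q" "1 \<le> N"
    "\<And>L u. (\<And>w. 1 \<le> L $ w) \<Longrightarrow> N \<le> L $ u \<Longrightarrow> \<bar>V L - V (set_coord L u q)\<bar> \<le> \<epsilon>'"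
    using variance_reduce_coord by blast
  show ?thesis
  proof (rule that[OF qN(2), of "V (\<chi> w. q)"])
    fix L :: "nat ^ 'd" assume L: "\<And>w. N \<le> L $ w"
    define R where "R U = (\<chi> w. if w \<in> U then q else L $ w)" for U :: "'d set"
    have "\<bar>V L - V (R U)\<bar> \<le> card U * \<epsilon>'" for U
      using finite[of U]
    proof (induction U rule: finite_induct)
      case empty
      have "R {} = L" by (simp add: R_def vec_eq_iff)
      then show ?case by simp
    next
      case (insert u U)
      have "R (insert u U) = set_coord (R U) u q"
        by (auto simp: R_def set_coord_def vec_eq_iff)
      moreover have "\<bar>V (R U) - V (set_coord (R U) u q)\<bar> \<le> \<epsilon>'"
      proof (rule qN(3))
        show "1 \<le> R U $ w" for w using qN(1,2) L[of w] by (simp add: R_def)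
        show "N \<le> R U $ u" using insert.hyps L by (simp add: R_def)
      qed
      ultimately show ?case using insert by (simp add: algebra_simps)
    qed
    from this[of UNIV] show "\<bar>V L - V (\<chi> w. q)\<bar> \<le> \<epsilon>" by (simp add: R_def \<epsilon>'_def)
  qed
qed

lemma variance_limit:
  obtains \<sigma> where "0 \<le> \<sigma>" "(V \<longlongrightarrow> \<sigma>) min_at_top"
proof -
  define a where "a n = V (\<chi> w. n)" for n
  have "Cauchy a"
  proof (rule metric_CauchyI)
    fix e :: real assume "0 < e"
    then have e4: "0 < e / 4" by simp
    obtain N c where N: "\<And>L. (\<And>w. N \<le> L $ w) \<Longrightarrow> \<bar>V L - c\<bar> \<le> e / 4"
      using variance_near_cube[OF e4] by blast
    have "dist (a m) (a n) < e" if "N \<le> m" "N \<le> n" for m n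
    proof -
      have "\<bar>a m - c\<bar> \<le> e / 4" "\<bar>a n - c\<bar> \<le> e / 4"
        unfolding a_def by (rule N, simp add: that)+
      then show ?thesis using \<open>0 < e\<close> unfolding dist_real_def by linarith
    qed
    then show "\<exists>N. \<forall>m\<ge>N. \<forall>n\<ge>N. dist (a m) (a n) < e" by blast
  qed
  then obtain \<sigma> where \<sigma>: "a \<longlonglongrightarrow> \<sigma>" using Cauchy_convergent_iff convergent_def by metis
  have "(V \<longlongrightarrow> \<sigma>) min_at_top"
  proof (rule tendstoI)
    fix e :: real assume "0 < e"
    then have e4: "0 < e / 4" by simp
    obtain N c where N: "\<And>L. (\<And>w. N \<le> L $ w) \<Longrightarrow> \<bar>V L - c\<bar> \<le> e / 4"
      using variance_near_cube[OF e4] by blast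
    have "eventually (\<lambda>n. dist (a n) \<sigma> < e / 4) sequentially"
      using \<sigma> \<open>0 < e\<close> by (intro tendstoD) auto
    then obtain n where n: "N \<le> n" "dist (a n) \<sigma> < e / 4"
      using eventually_ge_at_top[of N] by (metis (mono_tags, lifting) eventually_at_top_linorder nat_le_linear)
    have "dist (V L) \<sigma> < e" if "\<And>w. N \<le> L $ w" for L
    proof -
      have "\<bar>V L - c\<bar> \<le> e / 4" "\<bar>a n - c\<bar> \<le> e / 4"
        unfolding a_def by (rule N, simp add: that n(1))+
      then show ?thesis using n(2) \<open>0 < e\<close> unfolding dist_real_def by linarith
    qed
    then show "eventually (\<lambda>L. dist (V L) \<sigma> < e) min_at_top"
      unfolding eventually_min_at_top by blast
  qed
  moreover have "0 \<le> \<sigma>"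
    using \<sigma> by (rule LIMSEQ_le_const) (auto simp: a_def V_def box_volume_def intro!: divide_nonneg_nonneg prod_nonneg)
  ultimately show ?thesis using that by blast
qed

end

section \<open>The central limit theorem for a scalar observable\<close>

lemma min_square_cube_split:
  fixes g h :: real
  shows "min (6 * (g + h)\<^sup>2) (\<bar>g + h\<bar> ^ 3) \<le> 8 * (\<bar>g\<bar> * g\<^sup>2) + 24 * h\<^sup>2"
proof (cases "\<bar>h\<bar> \<le> \<bar>g\<bar>")
  case True
  have "\<bar>g + h\<bar> ^ 3 \<le> (2 * \<bar>g\<bar>) ^ 3" using True by (intro power_mono) auto
  also have "\<dots> = 8 * (\<bar>g\<bar> * g\<^sup>2)" by (simp add: power3_eq_cube power2_eq_square abs_mult[symmetric])
  finally have "\<bar>g + h\<bar> ^ 3 \<le> 8 * (\<bar>g\<bar> * g\<^sup>2)" .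
  moreover have "0 \<le> h\<^sup>2" by simp
  ultimately show ?thesis by (intro min.coboundedI2) linarith
next
  case False
  have "\<bar>g + h\<bar>\<^sup>2 \<le> (2 * \<bar>h\<bar>)\<^sup>2" using False by (intro power_mono) auto
  then have "(g + h)\<^sup>2 \<le> 4 * h\<^sup>2" by (simp add: power_mult_distrib)
  moreover have "0 \<le> \<bar>g\<bar> * g\<^sup>2" by simp
  ultimately show ?thesis by (intro min.coboundedI1) linarith
qed

lemma cmod_iexp_diff_le: "cmod (iexp a - iexp b) \<le> \<bar>a - b\<bar>"
proof -
  have "iexp a - iexp b = iexp b * (iexp (a - b) - 1)"
    by (simp add: algebra_simps flip: exp_add)
  then have "cmod (iexp a - iexp b) = cmod (iexp (a - b) - 1)" by (simp add: norm_mult)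
  also have "\<dots> \<le> \<bar>a - b\<bar>" using iexp_approx1[of "a - b" 0] by simp
  finally show ?thesis .
qed

lemma abs_exp_minus_le: "\<bar>exp (- a) - exp (- b)\<bar> \<le> \<bar>a - b\<bar>" if "0 \<le> a" "0 \<le> b" for a b :: real
proof -
  have *: "exp (- a) - exp (- b) \<le> b - a" if "0 \<le> a" "a \<le> b" for a b :: real
  proof -
    have "exp (- a) - exp (- b) = exp (- a) * (1 - exp (- (b - a)))"
      by (simp add: algebra_simps flip: exp_add)
    also have "\<dots> \<le> 1 * (b - a)"
    proof (intro mult_mono)
      show "1 - exp (- (b - a)) \<le> b - a" using exp_ge_add_one_self[of "- (b - a)"] by linarith
    qed (use that in auto)
    finally show ?thesis by simp
  qed
  show ?thesis
    using *[of a b] *[of b a] that by (cases "a \<le> b") (auto simp: abs_if)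
qed

lemma abs_one_minus_sub_exp_le:
  fixes s :: real
  assumes "0 \<le> s"
  shows "\<bar>(1 - s) - exp (- s)\<bar> \<le> s\<^sup>2"
proof (cases "s \<le> 1")
  case True
  have "1 - s \<le> exp (- s)" using exp_ge_add_one_self[of "- s"] by simp
  have "0 < 1 + s" using assms by simp
  have "exp (- s) \<le> 1 / (1 + s)"
    unfolding exp_minus inverse_eq_divide using assms exp_ge_add_one_self[of s]
    by (intro divide_left_mono) auto
  also have "\<dots> \<le> 1 - s + s\<^sup>2"
  proof -
    have "1 \<le> (1 - s + s\<^sup>2) * (1 + s)" using assms by (simp add: power2_eq_square algebra_simps)
    then show ?thesis using \<open>0 < 1 + s\<close> by (simp add: pos_divide_le_eq)
  qed
  finally show ?thesis using \<open>1 - s \<le> exp (- s)\<close> by (simp add: abs_if)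
next
  case False
  then have "s \<le> s\<^sup>2" by (simp add: power2_eq_square)
  moreover have "1 - s \<le> exp (- s)" using exp_ge_add_one_self[of "- s"] by simp
  moreover have "exp (- s) \<le> 1" using assms by simp
  ultimately show ?thesis by linarith
qed

context prob_space
begin

lemma char_diff_le:
  assumes "U \<in> L2_real M M" "W \<in> L2_real M M"
  shows "cmod ((CLINT s|M. iexp (U s)) - (CLINT s|M. iexp (W s))) \<le>
    sqrt (E (\<lambda>s. (U s - W s)\<^sup>2))"
proof -
  note [measurable] = assms[THEN L2_borel]
  have L: "(\<lambda>s. U s - W s) \<in> L2_real M M" using assms by (rule L2_diff)
  have int: "integrable M (\<lambda>s. iexp (Z s))" if [measurable]: "Z \<in> borel_measurable M" for Z :: "'a \<Rightarrow> real"
    by (auto intro!: integrable_const_bound[where B=1])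
  have "(CLINT s|M. iexp (U s)) - (CLINT s|M. iexp (W s)) = (CLINT s|M. iexp (U s) - iexp (W s))"
    by (simp add: int)
  also have "cmod \<dots> \<le> E (\<lambda>s. cmod (iexp (U s) - iexp (W s)))" by (rule integral_norm_bound)
  also have "\<dots> \<le> E (\<lambda>s. \<bar>U s - W s\<bar>)"
    using L by (intro integral_mono integrable_abs integrable_norm cmod_iexp_diff_le L2_integrable) (auto simp: int)
  also have "\<dots> \<le> sqrt (E (\<lambda>s. (\<bar>U s - W s\<bar>)\<^sup>2))"
    using L2_expectation_square_le[of "\<lambda>s. \<bar>U s - W s\<bar>"] L
    by (intro real_le_rsqrt) (auto simp: L2_real_iff)
  finally show ?thesis by simp
qed

text \<open>The remainder of the second-order expansion is at most the mean of \<open>min (6 U\<^sup>2) |U|\<^sup>3\<close> up to a constant.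
  Where \<open>G\<close> dominates in \<open>U = G + R\<close> the cube is used, elsewhere the square, so that no moment of \<open>R\<close> beyond the
  second enters. The third absolute moment of \<open>G\<close> is estimated by its fourth moment.\<close>

lemma char_second_order:
  assumes GR: "G \<in> L2_real M M" "R \<in> L2_real M M" and G4: "integrable M (\<lambda>s. G s ^ 4)"
    and U: "U \<in> L2_real M M" "\<And>s. U s = G s + R s" "E U = 0"
  shows "cmod ((CLINT s|M. iexp (U s)) - (1 - mean_sq U / 2)) \<le>
    2 * (sqrt (sqrt (E (\<lambda>s. G s ^ 4))) * sqrt (E (\<lambda>s. G s ^ 4)))
      + 4 * mean_sq R"
proof -
  note [measurable] = GR[THEN L2_borel] U(1)[THEN L2_borel]
  define K where "K = E (\<lambda>s. G s ^ 4)"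
  have G2L: "(\<lambda>s. (G s)\<^sup>2) \<in> L2_real M M" using G4 by (simp add: L2_real_iff)
  have GaL: "(\<lambda>s. \<bar>G s\<bar>) \<in> L2_real M M" using GR(1) by (simp add: L2_real_iff)
  have g2: "mean_sq G \<le> sqrt K"
    using L2_expectation_square_le[OF G2L] by (intro real_le_rsqrt) (simp add: K_def)
  have "E (\<lambda>s. \<bar>G s\<bar> * (G s)\<^sup>2) \<le> sqrt (mean_sq G) * sqrt K"
    using L2_Cauchy_Schwarz_sqrt[OF GaL G2L] by (simp add: K_def)
  also have "\<dots> \<le> sqrt (sqrt K) * sqrt K" using g2 by (intro mult_right_mono real_sqrt_le_mono) (auto simp: K_def)
  finally have g3: "E (\<lambda>s. \<bar>G s\<bar> * (G s)\<^sup>2) \<le> sqrt (sqrt K) * sqrt K" .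
  have i3: "integrable M (\<lambda>s. \<bar>G s\<bar> * (G s)\<^sup>2)" by (rule L2_integrable_mult[OF GaL G2L])
  have "cmod (char (distr M borel U) 1 - (1 - 1\<^sup>2 * mean_sq U / 2)) \<le>
     (1\<^sup>2 / 6) * E (\<lambda>s. min (6 * (U s)\<^sup>2) (\<bar>1\<bar> * \<bar>U s\<bar> ^ 3))"
    by (rule char_approx3'[OF _ L2_integrable[OF U(1)] L2_integrable_square[OF U(1)] U(3)]) (simp_all add: U(3))
  also have "char (distr M borel U) 1 = (CLINT s|M. iexp (U s))"
    by (simp add: char_def integral_distr)
  finally have "cmod ((CLINT s|M. iexp (U s)) - (1 - mean_sq U / 2)) \<le>
     E (\<lambda>s. min (6 * (U s)\<^sup>2) (\<bar>U s\<bar> ^ 3)) / 6" by simp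
  also have "E (\<lambda>s. min (6 * (U s)\<^sup>2) (\<bar>U s\<bar> ^ 3)) \<le>
    E (\<lambda>s. 8 * (\<bar>G s\<bar> * (G s)\<^sup>2) + 24 * (R s)\<^sup>2)"
    unfolding U(2) using i3 L2_integrable_square[OF GR(2)]
    by (intro integral_mono' min_square_cube_split) auto
  also have "\<dots> = 8 * E (\<lambda>s. \<bar>G s\<bar> * (G s)\<^sup>2) + 24 * mean_sq R"
    using i3 L2_integrable_square[OF GR(2)] by simp
  also have "\<dots> \<le> 12 * (sqrt (sqrt K) * sqrt K) + 24 * mean_sq R"
  proof -
    have "0 \<le> sqrt (sqrt K) * sqrt K" by (simp add: K_def)
    then show ?thesis using g3 by linarith
  qed
  finally show ?thesis by (simp add: K_def add_divide_distrib mult.commute)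
qed

end

context scalar_field
begin

text \<open>Uniform integrability of the squares of the normalized sums in quantitative form: up to an error with
  normalized variance at most \<open>\<delta>\<close>, the normalized sum has a fourth moment at most \<open>H\<close>.\<close>

definition truncates :: "real \<Rightarrow> real \<Rightarrow> (int ^ 'd) set \<Rightarrow> bool" where
  "truncates \<delta> H Q \<longleftrightarrow> (\<exists>G R. G \<in> L2_real M M \<and> R \<in> L2_real M M \<and> integrable M (\<lambda>s. G s ^ 4) \<and>
      (\<forall>s. S Q s = G s + R s) \<and> E (\<lambda>s. G s ^ 4) \<le> H * (real (card Q))\<^sup>2 \<and> mean_sq R \<le> \<delta> * card Q)"

text \<open>The observable is cut off at a level \<open>b\<close>, and both parts are centered again. The fourth moment bound
  applies to the bounded part, the second moment bound to the rest, whose variance at a single site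
  is small if \<open>b\<close> is large.\<close>

lemma truncation:
  fixes \<delta> :: real
  assumes "0 < \<delta>"
  obtains K :: real where "0 < K"
    "\<And>Q. finite Q \<Longrightarrow> truncates \<delta> K Q"
proof -
  obtain C where C: "0 < C" "\<And>y v Q. y \<in> borel_measurable borel \<Longrightarrow> (\<And>k. (\<lambda>s. y (X k s)) \<in> L2_real M M) \<Longrightarrow>
      (\<And>k. E (\<lambda>s. y (X k s)) = 0) \<Longrightarrow> (\<And>k. E (\<lambda>s. (y (X k s))\<^sup>2) \<le> v) \<Longrightarrow>
      finite Q \<Longrightarrow> E (\<lambda>s. (field_sum X y Q s)\<^sup>2) \<le> C * v * card Q"
    using second_moment_bound by blast
  obtain D where D: "0 < D" "\<And>y b Q. y \<in> borel_measurable borel \<Longrightarrow> (\<And>x. \<bar>y x\<bar> \<le> b) \<Longrightarrow>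
      (\<And>k. E (\<lambda>s. y (X k s)) = 0) \<Longrightarrow>
      finite Q \<Longrightarrow> E (\<lambda>s. (field_sum X y Q s) ^ 4) \<le> D * b ^ 4 * (real (card Q))\<^sup>2"
    using fourth_moment_bound by blast
  define t where "t b x = (if \<bar>y x\<bar> \<le> b then y x else 0)" for b x
  have [measurable]: "t b \<in> borel_measurable borel" for b unfolding t_def[abs_def] by measurable
  have "(\<lambda>n. E (\<lambda>s. (y (X 0 s) - t (real n) (X 0 s))\<^sup>2)) \<longlonglongrightarrow> E (\<lambda>s. 0)"
  proof (rule integral_dominated_convergence[where w="\<lambda>s. (y (X 0 s))\<^sup>2"])
    show "integrable M (\<lambda>s. (y (X 0 s))\<^sup>2)" using L2_integrable_square[OF y_L2] .
    show "AE s in M. (\<lambda>n. (y (X 0 s) - t (real n) (X 0 s))\<^sup>2) \<longlonglongrightarrow> 0"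
    proof (rule AE_I2, rule tendsto_eventually)
      fix s
      have "eventually (\<lambda>n. \<bar>y (X 0 s)\<bar> \<le> real n) sequentially"
        using filterlim_real_sequentially by (simp add: filterlim_at_top)
      then show "eventually (\<lambda>n. (y (X 0 s) - t (real n) (X 0 s))\<^sup>2 = 0) sequentially"
        by eventually_elim (simp add: t_def)
    qed
    show "AE s in M. norm ((y (X 0 s) - t (real n) (X 0 s))\<^sup>2) \<le> (y (X 0 s))\<^sup>2" for n
      by (simp add: t_def)
  qed measurable
  then have "eventually (\<lambda>n. E (\<lambda>s. (y (X 0 s) - t (real n) (X 0 s))\<^sup>2) < \<delta> / C) sequentially"
    using assms C(1) by (intro order_tendstoD(2)) auto
  then obtain n where n: "E (\<lambda>s. (y (X 0 s) - t (real n) (X 0 s))\<^sup>2) < \<delta> / C"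
    by (auto simp: eventually_sequentially)
  define b where "b = real n"
  have b0: "0 \<le> b" by (simp add: b_def)
  have tb: "\<bar>t b x\<bar> \<le> b" for x using b0 by (simp add: t_def)
  define c where "c = E (\<lambda>s. t b (X 0 s))"
  have tL: "(\<lambda>s. t b (X k s)) \<in> L2_real M M" for k by (rule L2_bounded[OF _ tb]) measurable
  have Et: "E (\<lambda>s. t b (X k s)) = c" for k
    unfolding c_def by (rule stationary_single[of "t b" "\<lambda>x. x" k]) measurable
  have cb: "\<bar>c\<bar> \<le> b"
  proof -
    have "\<bar>c\<bar> \<le> E (\<lambda>s. \<bar>t b (X 0 s)\<bar>)" unfolding c_def by (rule integral_abs_bound)
    also have "\<dots> \<le> E (\<lambda>s. b)"
      using tb by (intro integral_mono integrable_abs[OF L2_integrable[OF tL]] integrable_const)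
    finally show ?thesis by (simp add: prob_space)
  qed
  define g where "g x = t b x - c" for x
  define h where "h x = (y x - t b x) + c" for x
  have [measurable]: "g \<in> borel_measurable borel" "h \<in> borel_measurable borel"
    unfolding g_def[abs_def] h_def[abs_def] by measurable
  have gb: "\<bar>g x\<bar> \<le> 2 * b" for x using tb[of x] cb unfolding g_def by linarith
  have Eg: "E (\<lambda>s. g (X k s)) = 0" for k
    unfolding g_def by (simp add: L2_integrable[OF tL] Et prob_space)
  have constL: "(\<lambda>s. a) \<in> L2_real M M" for a by (simp add: L2_real_iff)
  have hL: "(\<lambda>s. h (X k s)) \<in> L2_real M M" for k
    unfolding h_def by (intro L2_add L2_diff y_L2 tL constL)
  have Eh: "E (\<lambda>s. h (X k s)) = 0" for k
    unfolding h_def by (simp add: L2_integrable[OF tL] L2_integrable[OF y_L2] y_mean Et prob_space)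
  have vh: "E (\<lambda>s. (h (X k s))\<^sup>2) \<le> \<delta> / C" for k
  proof -
    have dL: "(\<lambda>s. y (X 0 s) - t b (X 0 s)) \<in> L2_real M M" by (intro L2_diff y_L2 tL)
    have "E (\<lambda>s. y (X 0 s) - t b (X 0 s)) = - c"
      by (simp add: L2_integrable[OF tL] L2_integrable[OF y_L2] y_mean Et)
    then have "E (\<lambda>s. (h (X 0 s))\<^sup>2) = variance (\<lambda>s. y (X 0 s) - t b (X 0 s))"
      by (simp add: h_def)
    also have "\<dots> \<le> E (\<lambda>s. (y (X 0 s) - t b (X 0 s))\<^sup>2)"
      by (subst variance_eq) (use L2_integrable[OF dL] L2_integrable_square[OF dL] in auto)
    also have "\<dots> \<le> \<delta> / C" using n by (simp add: b_def)
    finally show ?thesis using stationary_single[of h "\<lambda>x. x\<^sup>2" k] by simp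
  qed
  show ?thesis
  proof (rule that[of "D * (2 * b) ^ 4 + 1"])
    show "0 < D * (2 * b) ^ 4 + 1" using D(1) by (intro add_nonneg_pos) auto
    fix Q :: "(int ^ 'd) set" assume Q: "finite Q"
    have GL: "field_sum X g Q \<in> L2_real M M"
    proof -
      have "(\<lambda>s. g (X k s)) \<in> L2_real M M" for k by (rule L2_bounded[OF _ gb]) measurable
      then show ?thesis unfolding field_sum_def[abs_def] by (intro L2_sum)
    qed
    have G4: "integrable M (\<lambda>s. field_sum X g Q s ^ 4)"
    proof (rule bounded_power4_integrable)
      show "\<bar>field_sum X g Q s\<bar> \<le> card Q * (2 * b)" for s by (rule abs_field_sum_le[OF gb])
    qed measurable
    have "field_sum X h Q \<in> L2_real M M" unfolding field_sum_def[abs_def] by (intro L2_sum hL)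
    moreover have "S Q s = field_sum X g Q s + field_sum X h Q s" for s
      unfolding field_sum_def g_def h_def sum.distrib[symmetric] by (intro sum.cong) auto
    moreover have "E (\<lambda>s. field_sum X g Q s ^ 4) \<le> (D * (2 * b) ^ 4 + 1) * (real (card Q))\<^sup>2"
      using D(2)[of g "2 * b" Q] gb Eg Q by (simp add: distrib_right) (smt (verit) zero_le_power2)
    moreover have "E (\<lambda>s. (field_sum X h Q s)\<^sup>2) \<le> \<delta> * card Q"
      using C(2)[of h "\<delta> / C" Q] hL Eh vh Q C(1) by simp
    ultimately show "truncates \<delta> (D * (2 * b) ^ 4 + 1) Q"
      unfolding truncates_def using GL G4
      by (intro exI[of _ "field_sum X g Q"] exI[of _ "field_sum X h Q"]) auto
  qed
qed

text \<open>The error terms are, in this order: the sites outside the slabs; the replacement of the joint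
  characteristic function of the slabs by a product; \<open>p\<close> times the error of the second-order expansion for one
  slab, from its part with bounded fourth moment and from its truncated rest; \<open>p\<close> times the error of
  \<open>1 - s \<approx> exp (- s)\<close> with \<open>s = O(1 / p)\<close>; and the deviation of the slab variance from its limit. The
  third term is \<open>O(1 / sqrt p)\<close>, as a slab has a fraction of at most \<open>1 / p\<close> of the volume and the cube of
  its sum, normalized by the volume of the whole box, has a mean of order \<open>p\<close> to the power \<open>- 3 / 2\<close>.\<close>

lemma char_slab_step:
  fixes K H \<delta> r \<sigma> :: real and p q n :: nat
  assumes K: "0 < K" "\<And>Q. finite Q \<Longrightarrow> mean_sq (S Q) \<le> K * card Q"
    and \<delta>: "0 \<le> \<delta>" and H: "0 \<le> H"
    and trunc: "\<And>Q. finite Q \<Longrightarrow> truncates \<delta> H Q"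
    and n: "1 \<le> n" and rho: "rho' M X n \<le> ereal r" and r: "0 \<le> r"
    and pq: "p * (q + n) \<le> L $ u" "1 \<le> q" "1 \<le> p" and L: "\<And>w. 1 \<le> L $ w" and \<sigma>: "0 \<le> \<sigma>"
  shows "cmod ((CLINT s|M. iexp (S (index_box L) s / sqrt (box_volume L))) - exp (- \<sigma> / 2)) \<le>
    sqrt (K * (1 - real (p * q) / real (L $ u))) + 4 * r * p
    + 2 * (sqrt (sqrt H) * sqrt H / sqrt p) + 4 * \<delta> + K\<^sup>2 / p
    + (K * (1 - real (p * q) / real (L $ u)) + \<bar>V (set_coord L u q) - \<sigma>\<bar>) / 2"
proof -
  let ?L' = "set_coord L u q"
  define d where "d = 1 - real (p * q) / real (L $ u)"
  define vol where "vol = box_volume L"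
  have Lu: "0 < L $ u" using L[of u] by simp
  have vol: "0 < vol" "0 < box_volume ?L'"
    using L pq(2) by (auto intro!: box_volume_pos simp: set_coord_def vol_def)
  have pqL: "real (p * q) \<le> real (L $ u)"
    using pq(1) unfolding of_nat_le_iff by (simp add: algebra_simps)
  have d: "0 \<le> d" "d \<le> 1" using pqL Lu by (auto simp: d_def)
  have volp: "real p * box_volume ?L' = vol * (1 - d)"
    using box_volume_set_coord[of L u q] Lu by (simp add: d_def vol_def field_simps)
  define \<alpha> where "\<alpha> = box_volume ?L' / vol"
  have \<alpha>: "0 \<le> \<alpha>" "real p * \<alpha> = 1 - d" using vol volp by (simp_all add: \<alpha>_def)
  then have \<alpha>p: "\<alpha> \<le> 1 / real p" using d pq(3) by (simp add: field_simps)
  define U where "U s = S (index_box L) s / sqrt vol" for s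
  define \<xi> where "\<xi> j s = S (slab L u q n j) s / sqrt vol" for j s
  define W where "W s = S (index_box ?L') s / sqrt vol" for s
  define T where "T s = (\<Sum>j<p. \<xi> j s)" for s
  have scaleL: "(\<lambda>s. Z s / sqrt vol) \<in> L2_real M M" if "Z \<in> L2_real M M" for Z
    using L2_cmult[OF that, of "1 / sqrt vol"] by simp
  have scaleE: "E (\<lambda>s. (Z s / sqrt vol)\<^sup>2) = mean_sq Z / vol" for Z
    using vol by (simp add: power_divide)
  have L2: "U \<in> L2_real M M" "W \<in> L2_real M M" "\<xi> j \<in> L2_real M M" for j
    unfolding U_def[abs_def] W_def[abs_def] \<xi>_def[abs_def] by (intro scaleL S_L2)+
  have TL: "T \<in> L2_real M M" unfolding T_def[abs_def] by (intro L2_sum L2)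
  let ?e = "\<lambda>Z. CLINT s|M. iexp (Z s)"
  have step1: "cmod (?e U - ?e T) \<le> sqrt (K * d)"
  proof -
    have "U s - T s = (S (index_box L) s - (\<Sum>j<p. S (slab L u q n j) s)) / sqrt vol" for s
      by (simp add: U_def T_def \<xi>_def diff_divide_distrib sum_divide_distrib)
    then have "E (\<lambda>s. (U s - T s)\<^sup>2) =
      E (\<lambda>s. (S (index_box L) s - (\<Sum>j<p. S (slab L u q n j) s))\<^sup>2) / vol"
      using scaleE by simp
    also have "\<dots> \<le> K * (vol * d) / vol"
      using slab_remainder_second_moment[OF K(2) pq(1) Lu] vol
      by (intro divide_right_mono) (auto simp: vol_def d_def)
    also have "\<dots> = K * d" using vol by simp
    finally show ?thesis using char_diff_le[OF L2(1) TL] real_sqrt_le_mono order_trans by blast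
  qed
  have step2: "cmod (?e T - ?e W ^ p) \<le> 4 * r * p"
  proof -
    have "?e (\<xi> j) = ?e W" for j
      unfolding \<xi>_def W_def by (rule slab_expectation[of "\<lambda>x. iexp (x / sqrt vol)"]) measurable
    then have prod: "(\<Prod>j<p. ?e (\<xi> j)) = ?e W ^ p" by simp
    have scale: "corr_bound M r (\<lambda>s. Z s / sqrt vol) (\<lambda>s. Z' s / sqrt vol)" if "corr_bound M r Z Z'" for Z Z'
      unfolding corr_bound_def
    proof (intro ballI impI)
      fix f g :: "real \<Rightarrow> real"
      assume fg: "f \<in> borel_measurable borel" "g \<in> borel_measurable borel"
        "(\<lambda>s. f (Z s / sqrt vol)) \<in> L2_real M M" "(\<lambda>s. g (Z' s / sqrt vol)) \<in> L2_real M M"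
      have "(\<lambda>x. f (x / sqrt vol)) \<in> borel_measurable borel" "(\<lambda>x. g (x / sqrt vol)) \<in> borel_measurable borel"
        using fg(1,2) by (auto intro!: measurable_compose[OF _ fg(1)] measurable_compose[OF _ fg(2)])
      from corr_boundD[OF that this fg(3,4)]
      show "\<bar>E (\<lambda>s. f (Z s / sqrt vol) * g (Z' s / sqrt vol)) -
          E (\<lambda>s. f (Z s / sqrt vol)) * E (\<lambda>s. g (Z' s / sqrt vol))\<bar>
        \<le> r * (sqrt (E (\<lambda>s. (f (Z s / sqrt vol))\<^sup>2)) * sqrt (E (\<lambda>s. (g (Z' s / sqrt vol))\<^sup>2)))" .
    qed
    have "cmod (?e T - (\<Prod>j<p. ?e (\<xi> j))) \<le> 4 * r * real p"
      unfolding T_def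
    proof (rule family_char_product[OF _ r])
      fix k
      have "corr_bound M r (\<lambda>s. \<Sum>j<k. S (slab L u q n j) s) (\<lambda>s. \<Sum>j\<in>{k}. S (slab L u q n j) s)"
        by (rule slab_corr_bound[OF n rho r]) auto
      then show "corr_bound M r (\<lambda>s. \<Sum>j<k. \<xi> j s) (\<xi> k)"
        using scale by (simp add: \<xi>_def[abs_def] flip: sum_divide_distrib)
    qed (use L2 in \<open>auto intro: L2_borel\<close>)
    then show ?thesis unfolding prod by simp
  qed
  define s where "s = mean_sq W / 2"
  have cardL': "real (card (index_box ?L')) = \<alpha> * vol" using vol by (simp add: card_index_box \<alpha>_def)
  have s: "s = V ?L' * \<alpha> / 2" "0 \<le> s"
    unfolding s_def W_def scaleE using vol by (simp_all add: V_def \<alpha>_def)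
  have V': "0 \<le> V ?L'" "V ?L' \<le> K"
    using K(2)[of "index_box ?L'"] vol by (simp_all add: V_def finite_index_box card_index_box field_simps)
  have sK: "s \<le> K / p"
  proof -
    have "V ?L' * \<alpha> \<le> K * (1 / p)" using V' \<alpha> \<alpha>p K by (intro mult_mono) auto
    then have "V ?L' * \<alpha> \<le> K / p" by simp
    moreover have "0 \<le> V ?L' * \<alpha>" using V' \<alpha> by simp
    ultimately show ?thesis unfolding s by linarith
  qed
  have step3: "cmod (?e W - (1 - s)) \<le> (2 * (sqrt (sqrt H) * sqrt H / sqrt p) + 4 * \<delta>) / p"
  proof -
    obtain G R where GR: "G \<in> L2_real M M" "R \<in> L2_real M M" "integrable M (\<lambda>s. G s ^ 4)"
      "\<And>s. S (index_box ?L') s = G s + R s" "E (\<lambda>s. G s ^ 4) \<le> H * (\<alpha> * vol)\<^sup>2"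
      "mean_sq R \<le> \<delta> * (\<alpha> * vol)"
      using trunc[OF finite_index_box, of ?L'] unfolding truncates_def cardL' by blast
    define g h where "g s = G s / sqrt vol" and "h s = R s / sqrt vol" for s
    have gh: "g \<in> L2_real M M" "h \<in> L2_real M M" unfolding g_def[abs_def] h_def[abs_def] by (intro scaleL GR)+
    have sq4: "(x / sqrt vol) ^ 4 = x ^ 4 / vol\<^sup>2" for x
    proof -
      have "sqrt vol ^ 4 = ((sqrt vol)\<^sup>2)\<^sup>2" by (simp only: power_mult[symmetric]) simp
      then show ?thesis using vol by (simp add: power_divide)
    qed
    have g4: "integrable M (\<lambda>s. g s ^ 4)" using GR(3) by (simp add: g_def sq4)
    define J where "J = E (\<lambda>s. g s ^ 4)"
    have "J = E (\<lambda>s. G s ^ 4) / vol\<^sup>2" by (simp add: J_def g_def sq4)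
    also have "\<dots> \<le> H * (\<alpha> * vol)\<^sup>2 / vol\<^sup>2" using GR(5) by (intro divide_right_mono) auto
    also have "\<dots> = H * \<alpha>\<^sup>2" using vol by (simp add: power_mult_distrib)
    also have "\<dots> \<le> H * (1 / real p)\<^sup>2" using \<alpha> \<alpha>p H by (intro mult_left_mono power_mono) auto
    finally have "J \<le> H / (real p)\<^sup>2" by (simp add: power_divide)
    then have "sqrt J \<le> sqrt (H / (real p)\<^sup>2)" by (rule real_sqrt_le_mono)
    then have J1: "sqrt J \<le> sqrt H / p" by (simp add: real_sqrt_divide)
    then have "sqrt (sqrt J) \<le> sqrt (sqrt H / p)" by (rule real_sqrt_le_mono)
    then have J2: "sqrt (sqrt J) \<le> sqrt (sqrt H) / sqrt p" by (simp add: real_sqrt_divide)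
    have "sqrt (sqrt J) * sqrt J \<le> (sqrt (sqrt H) / sqrt p) * (sqrt H / p)"
      using J1 J2 H by (intro mult_mono) (auto simp: J_def)
    moreover have "mean_sq h \<le> \<delta> / p"
    proof -
      have "mean_sq h \<le> \<delta> * (\<alpha> * vol) / vol"
        unfolding h_def scaleE using GR(6) vol by (intro divide_right_mono) auto
      also have "\<dots> = \<delta> * \<alpha>" using vol by simp
      also have "\<dots> \<le> \<delta> * (1 / p)" using \<alpha>p \<delta> by (intro mult_left_mono) auto
      finally show ?thesis by simp
    qed
    moreover have "cmod (?e W - (1 - mean_sq W / 2)) \<le> 2 * (sqrt (sqrt J) * sqrt J) + 4 * mean_sq h"
      unfolding J_def
    proof (rule char_second_order[OF gh g4 L2(2)])
      show "W s = g s + h s" for s by (simp add: W_def g_def h_def GR(4) add_divide_distrib)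
      show "E W = 0" by (simp add: W_def[abs_def] S_mean)
    qed
    ultimately have "cmod (?e W - (1 - mean_sq W / 2)) \<le>
      2 * ((sqrt (sqrt H) / sqrt p) * (sqrt H / p)) + 4 * (\<delta> / p)" by linarith
    then show ?thesis by (simp add: s_def add_divide_distrib)
  qed
  have step4: "cmod (?e W ^ p - exp (- (real p * s))) \<le> 2 * (sqrt (sqrt H) * sqrt H / sqrt p) + 4 * \<delta> + K\<^sup>2 / p"
  proof -
    have "cmod (?e W) \<le> (LINT s|M. cmod (iexp (W s)))" by (rule integral_norm_bound)
    then have le1: "cmod (?e W) \<le> 1" by (simp add: prob_space)
    have "cmod (of_real (1 - s) - of_real (exp (- s)) :: complex) \<le> s\<^sup>2"
      using abs_one_minus_sub_exp_le[OF s(2)] unfolding of_real_diff[symmetric] norm_of_real .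
    also have "s\<^sup>2 \<le> (K / p)\<^sup>2" using s(2) sK by (intro power_mono) auto
    finally have "cmod ((1 - of_real s) - of_real (exp (- s)) :: complex) \<le> (K / p)\<^sup>2" by simp
    then have "cmod (?e W - of_real (exp (- s))) \<le> (2 * (sqrt (sqrt H) * sqrt H / sqrt p) + 4 * \<delta>) / p + (K / p)\<^sup>2"
      using step3 norm_triangle_ineq[of "?e W - (1 - of_real s)" "(1 - of_real s) - of_real (exp (- s))"] by simp
    then have "p * cmod (?e W - of_real (exp (- s))) \<le> p * ((2 * (sqrt (sqrt H) * sqrt H / sqrt p) + 4 * \<delta>) / p + (K / p)\<^sup>2)"
      by (intro mult_left_mono) auto
    also have "\<dots> = 2 * (sqrt (sqrt H) * sqrt H / sqrt p) + 4 * \<delta> + K\<^sup>2 / p"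
    proof -
      have "p * (x / p + (K / p)\<^sup>2) = x + K\<^sup>2 / p" for x :: real
        using pq(3) by (simp add: field_simps power2_eq_square)
      then show ?thesis .
    qed
    finally have "cmod (?e W ^ p - of_real (exp (- s)) ^ p) \<le> 2 * (sqrt (sqrt H) * sqrt H / sqrt p) + 4 * \<delta> + K\<^sup>2 / p"
      using norm_power_diff[OF le1, of "of_real (exp (- s))" p] s(2) by simp
    also have "of_real (exp (- s)) ^ p = (of_real (exp (- (real p * s))) :: complex)"
      by (simp add: exp_of_nat_mult[symmetric] flip: of_real_power)
    finally show ?thesis by (simp add: exp_of_real[symmetric])
  qed
  have step5: "cmod (of_real (exp (- (real p * s))) - of_real (exp (- \<sigma> / 2)) :: complex) \<le> (K * d + \<bar>V ?L' - \<sigma>\<bar>) / 2"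
  proof -
    have ps: "real p * s = V ?L' * (1 - d) / 2" unfolding s by (simp flip: \<alpha>(2))
    have "cmod (of_real (exp (- (real p * s))) - of_real (exp (- \<sigma> / 2)) :: complex) = \<bar>exp (- (real p * s)) - exp (- (\<sigma> / 2))\<bar>"
      unfolding of_real_diff[symmetric] norm_of_real by simp
    also have "\<dots> \<le> \<bar>real p * s - \<sigma> / 2\<bar>" using s(2) \<sigma> by (intro abs_exp_minus_le) auto
    also have "\<dots> = \<bar>(V ?L' - \<sigma>) - V ?L' * d\<bar> / 2" unfolding ps by (simp add: algebra_simps diff_divide_distrib[symmetric])
    also have "\<dots> \<le> (K * d + \<bar>V ?L' - \<sigma>\<bar>) / 2"
    proof -
      have "0 \<le> V ?L' * d" "V ?L' * d \<le> K * d" using V' d by (auto intro: mult_right_mono)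
      then show ?thesis by (intro divide_right_mono) linarith+
    qed
    finally show ?thesis .
  qed
  have "cmod (?e U - of_real (exp (- \<sigma> / 2))) \<le> cmod (?e U - ?e T) + cmod (?e T - ?e W ^ p)
     + cmod (?e W ^ p - of_real (exp (- (real p * s)))) + cmod (of_real (exp (- (real p * s))) - of_real (exp (- \<sigma> / 2)) :: complex)"
    using norm_triangle_ineq[of "?e U - ?e T" "?e T - of_real (exp (- \<sigma> / 2))"]
      norm_triangle_ineq[of "?e T - ?e W ^ p" "?e W ^ p - of_real (exp (- \<sigma> / 2))"]
      norm_triangle_ineq[of "?e W ^ p - of_real (exp (- (real p * s)))" "of_real (exp (- (real p * s))) - of_real (exp (- \<sigma> / 2)) :: complex"]
    by simp
  also have "\<dots> \<le> sqrt (K * d) + 4 * r * p + (2 * (sqrt (sqrt H) * sqrt H / sqrt p) + 4 * \<delta> + K\<^sup>2 / p) + (K * d + \<bar>V ?L' - \<sigma>\<bar>) / 2"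
    using step1 step2 step4 step5 by (intro add_mono) (simp_all add: exp_of_real)
  finally show ?thesis by (simp add: U_def vol_def d_def exp_of_real)
qed

text \<open>The truncation is chosen first, then the number \<open>p\<close> of slabs, then the gap \<open>n\<close> that makes
  \<open>p\<close> times the mixing coefficient small, and the size of the box last.\<close>

theorem scalar_clt:
  assumes \<sigma>: "0 \<le> \<sigma>" "(V \<longlongrightarrow> \<sigma>) min_at_top"
  shows "((\<lambda>L. CLINT s|M. iexp (S (index_box L) s / sqrt (box_volume L))) \<longlongrightarrow> exp (- \<sigma> / 2)) min_at_top"
proof (rule tendstoI)
  fix e :: real assume "0 < e"
  define \<epsilon> where "\<epsilon> = e / 16"
  have \<epsilon>: "0 < \<epsilon>" "e = 16 * \<epsilon>" using \<open>0 < e\<close> by (simp_all add: \<epsilon>_def)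
  obtain K :: real where K: "0 < K" "\<And>Q. finite Q \<Longrightarrow> mean_sq (S Q) \<le> K * card Q"
    using S_second_moment by blast
  obtain H :: real where H: "0 < H"
    "\<And>Q. finite Q \<Longrightarrow> truncates \<epsilon> H Q"
    using truncation[OF \<epsilon>(1)] by blast
  have "((\<lambda>p. 2 * (sqrt (sqrt H) * sqrt H / sqrt (real p)) + K\<^sup>2 / real p) \<longlongrightarrow> 2 * 0 + 0) sequentially"
    by (intro tendsto_add tendsto_mult tendsto_const real_tendsto_divide_at_top[OF tendsto_const]
      filterlim_compose[OF sqrt_at_top] filterlim_real_sequentially)
  then have "eventually (\<lambda>p. 2 * (sqrt (sqrt H) * sqrt H / sqrt (real p)) + K\<^sup>2 / real p < \<epsilon>) sequentially"
    using \<epsilon> by (intro order_tendstoD(2)) auto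
  then obtain p where p: "1 \<le> p" "2 * (sqrt (sqrt H) * sqrt H / sqrt (real p)) + K\<^sup>2 / real p < \<epsilon>"
    using eventually_happens'[OF sequentially_bot eventually_conj[OF eventually_ge_at_top[of "1::nat"]]] by blast
  define r where "r = \<epsilon> / (4 * p)"
  have r: "0 < r" "4 * r * p = \<epsilon>" using \<epsilon> p by (simp_all add: r_def)
  obtain n where n: "1 \<le> n" "rho' M X n \<le> ereal r" using ex_rho'_le[OF r(1)] by auto
  obtain N0 where N0: "\<And>L. (\<And>w. N0 \<le> L $ w) \<Longrightarrow> dist (V L) \<sigma> < \<epsilon>"
    using tendstoD[OF \<sigma>(2) \<epsilon>(1)] unfolding eventually_min_at_top by blast
  have "((\<lambda>l. sqrt (K * (real (p * (n + 1)) / real l)) + K * (real (p * (n + 1)) / real l)) \<longlongrightarrow> sqrt (K * 0) + K * 0) sequentially"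
    by (intro tendsto_add tendsto_real_sqrt tendsto_mult tendsto_const real_tendsto_divide_at_top[OF tendsto_const] filterlim_real_sequentially)
  then have "eventually (\<lambda>l. sqrt (K * (real (p * (n + 1)) / real l)) + K * (real (p * (n + 1)) / real l) < \<epsilon>) sequentially"
    using \<epsilon> by (intro order_tendstoD(2)) auto
  then obtain l0 where l0: "\<And>l. l0 \<le> l \<Longrightarrow> sqrt (K * (real (p * (n + 1)) / real l)) + K * (real (p * (n + 1)) / real l) < \<epsilon>"
    by (auto simp: eventually_sequentially)
  define N where "N = l0 + N0 + p * (n + N0 + 1) + 1"
  have "dist (CLINT s|M. iexp (S (index_box L) s / sqrt (box_volume L))) (exp (- \<sigma> / 2)) < e"
    if L: "\<And>w. N \<le> L $ w" for L
  proof -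
    \<comment> \<open>Any one direction will do.\<close>
    obtain u :: 'd where True by simp
    define q where "q = L $ u div p - n"
    have "p * (n + N0 + 1) \<le> L $ u" using L[of u] by (simp add: N_def)
    then have "n + N0 + 1 \<le> L $ u div p" using p(1) by (simp add: less_eq_div_iff_mult_less_eq mult.commute)
    then have q: "N0 + 1 \<le> q" "q + n = L $ u div p" by (auto simp: q_def)
    have pq: "p * (q + n) \<le> L $ u" unfolding q(2) by simp
    have Lu: "0 < real (L $ u)" using L[of u] by (simp add: N_def)
    have d: "1 - real (p * q) / real (L $ u) \<le> real (p * (n + 1)) / real (L $ u)"
    proof -
      have "L $ u mod p < p" using p(1) by simp
      moreover have "L $ u = p * (q + n) + L $ u mod p" unfolding q(2) by (simp only: mult_div_mod_eq)
      ultimately have "L $ u \<le> p * q + p * (n + 1)" by (simp add: algebra_simps)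
      from of_nat_mono[OF this, where 'a=real]
      have "real (L $ u) - real (p * q) \<le> real (p * (n + 1))" by (simp only: of_nat_add)
      then have "(real (L $ u) - real (p * q)) / real (L $ u) \<le> real (p * (n + 1)) / real (L $ u)"
        by (rule divide_right_mono) simp
      then show ?thesis using Lu by (simp only: diff_divide_distrib) simp
    qed
    have d0: "0 \<le> K * (1 - real (p * q) / real (L $ u))"
    proof -
      have "p * q \<le> L $ u" using pq by (simp add: algebra_simps)
      then have "real (p * q) \<le> real (L $ u)" by (rule of_nat_mono)
      then show ?thesis using K Lu by simp
    qed
    have "K * (1 - real (p * q) / real (L $ u)) \<le> K * (real (p * (n + 1)) / real (L $ u))"
      using d K by (intro mult_left_mono) auto
    moreover from this have "sqrt (K * (1 - real (p * q) / real (L $ u))) \<le> sqrt (K * (real (p * (n + 1)) / real (L $ u)))"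
      by (rule real_sqrt_le_mono)
    moreover have "sqrt (K * (real (p * (n + 1)) / real (L $ u))) + K * (real (p * (n + 1)) / real (L $ u)) < \<epsilon>"
      using L[of u] by (intro l0) (simp add: N_def)
    ultimately have A: "sqrt (K * (1 - real (p * q) / real (L $ u))) + K * (1 - real (p * q) / real (L $ u)) < \<epsilon>" by linarith
    have B: "\<bar>V (set_coord L u q) - \<sigma>\<bar> < \<epsilon>"
    proof -
      have "N0 \<le> set_coord L u q $ w" for w
        using q(1) L[of w] by (simp add: set_coord_def N_def)
      then show ?thesis using N0[of "set_coord L u q"] by (simp add: dist_real_def)
    qed
    have L1: "1 \<le> L $ w" for w using L[of w] by (simp add: N_def)
    have "cmod ((CLINT s|M. iexp (S (index_box L) s / sqrt (box_volume L))) - exp (- \<sigma> / 2)) \<le>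
      sqrt (K * (1 - real (p * q) / real (L $ u))) + 4 * r * p
      + 2 * (sqrt (sqrt H) * sqrt H / sqrt p) + 4 * \<epsilon> + K\<^sup>2 / p
      + (K * (1 - real (p * q) / real (L $ u)) + \<bar>V (set_coord L u q) - \<sigma>\<bar>) / 2"
      using q(1) by (intro char_slab_step[OF K less_imp_le[OF \<epsilon>(1)] less_imp_le[OF H(1)] H(2) n less_imp_le[OF r(1)] pq _ p(1) L1 \<sigma>(1)]) auto
    also have "\<dots> < e"
    proof -
      have "a + b + x + 4 * \<epsilon> + z + (k + v) / 2 < e"
        if "a + k < \<epsilon>" "v < \<epsilon>" "x + z < \<epsilon>" "b = \<epsilon>" "0 \<le> k" for a b x z k v
        using that \<epsilon> by (simp add: field_simps)
      from this[OF A B p(2) r(2) d0] show ?thesis .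
    qed
    finally show ?thesis by (simp add: dist_norm)
  qed
  then show "eventually (\<lambda>L. dist (CLINT s|M. iexp (S (index_box L) s / sqrt (box_volume L))) (exp (- \<sigma> / 2)) < e) min_at_top"
    unfolding eventually_min_at_top by blast
qed

end

section \<open>From characteristic functions to weak convergence in several dimensions\<close>

text \<open>The span of the functions whose integrals are read off from a characteristic function.\<close>

inductive trig_poly :: "('v::real_inner \<Rightarrow> real) \<Rightarrow> bool" where
  trig_cos: "trig_poly (\<lambda>x. cos (t \<bullet> x))"
| trig_sin: "trig_poly (\<lambda>x. sin (t \<bullet> x))"
| trig_add: "trig_poly f \<Longrightarrow> trig_poly g \<Longrightarrow> trig_poly (\<lambda>x. f x + g x)"
| trig_scale: "trig_poly f \<Longrightarrow> trig_poly (\<lambda>x. c * f x)"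

lemma trig_poly_const: "trig_poly (\<lambda>x. c)"
  using trig_scale[OF trig_cos[of 0], of c] by simp

lemma trig_poly_sum: "finite I \<Longrightarrow> (\<And>i. i \<in> I \<Longrightarrow> trig_poly (f i)) \<Longrightarrow> trig_poly (\<lambda>x. \<Sum>i\<in>I. f i x)"
  by (induction I rule: finite_induct) (auto intro: trig_poly_const trig_add)

lemma trig_poly_mult_cos_sin:
  assumes "trig_poly g"
  shows "trig_poly (\<lambda>x. cos (t \<bullet> x) * g x)" "trig_poly (\<lambda>x. sin (t \<bullet> x) * g x)"
  using assms
proof (induction rule: trig_poly.induct)
  case (trig_cos s)
  have "(\<lambda>x. cos (t \<bullet> x) * cos (s \<bullet> x)) = (\<lambda>x. 1 / 2 * (cos ((t - s) \<bullet> x) + cos ((t + s) \<bullet> x)))"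
    by (simp add: cos_times_cos inner_diff_left inner_add_left)
  moreover have "(\<lambda>x. sin (t \<bullet> x) * cos (s \<bullet> x)) = (\<lambda>x. 1 / 2 * (sin ((t + s) \<bullet> x) + sin ((t - s) \<bullet> x)))"
    by (simp add: sin_times_cos inner_diff_left inner_add_left)
  ultimately show "trig_poly (\<lambda>x. cos (t \<bullet> x) * cos (s \<bullet> x))" "trig_poly (\<lambda>x. sin (t \<bullet> x) * cos (s \<bullet> x))"
    by (simp_all only: trig_poly.intros)
next
  case (trig_sin s)
  have "(\<lambda>x. cos (t \<bullet> x) * sin (s \<bullet> x)) = (\<lambda>x. 1 / 2 * (sin ((t + s) \<bullet> x) + (-1) * sin ((t - s) \<bullet> x)))"
    by (simp add: cos_times_sin inner_diff_left inner_add_left)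
  moreover have "(\<lambda>x. sin (t \<bullet> x) * sin (s \<bullet> x)) = (\<lambda>x. 1 / 2 * (cos ((t - s) \<bullet> x) + (-1) * cos ((t + s) \<bullet> x)))"
    by (simp add: sin_times_sin inner_diff_left inner_add_left)
  ultimately show "trig_poly (\<lambda>x. cos (t \<bullet> x) * sin (s \<bullet> x))" "trig_poly (\<lambda>x. sin (t \<bullet> x) * sin (s \<bullet> x))"
    by (simp_all only: trig_poly.intros)
next
  case (trig_add f g)
  then show "trig_poly (\<lambda>x. cos (t \<bullet> x) * (f x + g x))" "trig_poly (\<lambda>x. sin (t \<bullet> x) * (f x + g x))"
    by (simp_all add: distrib_left trig_poly.trig_add)
next
  case (trig_scale f c)
  then show "trig_poly (\<lambda>x. cos (t \<bullet> x) * (c * f x))" "trig_poly (\<lambda>x. sin (t \<bullet> x) * (c * f x))"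
    using trig_poly.trig_scale[of _ c] by (simp_all add: mult.left_commute)
qed

lemma trig_poly_mult:
  assumes "trig_poly f" "trig_poly g"
  shows "trig_poly (\<lambda>x. f x * g x)"
  using assms(1)
proof (induction rule: trig_poly.induct)
  case (trig_add f h)
  then show ?case by (simp add: distrib_right trig_poly.trig_add)
next
  case (trig_scale f c)
  then show ?case by (simp add: mult.assoc trig_poly.trig_scale)
qed (use trig_poly_mult_cos_sin[OF assms(2)] in auto)

lemma trig_poly_measurable_bounded:
  fixes f :: "'v::euclidean_space \<Rightarrow> real"
  assumes "trig_poly f"
  shows "f \<in> borel_measurable borel \<and> (\<exists>B. \<forall>x. \<bar>f x\<bar> \<le> B)"
  using assms
proof (induction rule: trig_poly.induct)
  case (trig_add f g)
  then obtain A B where "\<And>x. \<bar>f x\<bar> \<le> A" "\<And>x. \<bar>g x\<bar> \<le> B" by blast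
  then have "\<bar>f x + g x\<bar> \<le> A + B" for x by (meson abs_triangle_ineq add_mono order_trans)
  then show ?case using trig_add by (auto intro: borel_measurable_add)
next
  case (trig_scale f c)
  then obtain A where "\<And>x. \<bar>f x\<bar> \<le> A" by blast
  then have "\<bar>c * f x\<bar> \<le> \<bar>c\<bar> * A" for x by (simp add: abs_mult mult_left_mono)
  then show ?case using trig_scale by (auto intro: borel_measurable_times)
qed (auto intro: exI[of _ 1])

lemma trig_poly_polynomial_sin:
  fixes P :: "real ^ 'm::finite \<Rightarrow> real"
  assumes "real_polynomial_function P"
  shows "trig_poly (\<lambda>x. P (\<chi> i. sin (x $ i / K)))"
  using assms
proof (induction rule: real_polynomial_function.induct)
  case (linear f)
  interpret f: bounded_linear f by fact
  define h where "h x = (\<chi> i. sin (x $ i / K))" for x :: "real ^ 'm"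
  have base: "trig_poly (\<lambda>x. h x \<bullet> b)" if "b \<in> Basis" for b
  proof -
    have eq: "x $ i / K = (axis i (1 / K)) \<bullet> x" for x :: "real ^ 'm" and i
      by (simp add: inner_axis')
    from that obtain i where "b = axis i 1" by (auto simp: Basis_vec_def)
    then show ?thesis by (simp add: h_def inner_axis eq trig_sin)
  qed
  have "f (h x) = (\<Sum>b\<in>Basis. f b * (h x \<bullet> b))" for x
  proof -
    have "f (h x) = f (\<Sum>b\<in>Basis. (h x \<bullet> b) *\<^sub>R b)" by (simp add: euclidean_representation)
    also have "\<dots> = (\<Sum>b\<in>Basis. (h x \<bullet> b) * f b)" by (simp add: f.sum f.scaleR)
    finally show ?thesis by (simp add: mult.commute)
  qed
  then have "(\<lambda>x. f (h x)) = (\<lambda>x. \<Sum>b\<in>Basis. f b * (h x \<bullet> b))" by blast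
  moreover have "trig_poly \<dots>" by (intro trig_poly_sum trig_scale base) auto
  ultimately show ?case by (simp add: h_def)
qed (auto intro: trig_poly_const trig_add trig_poly_mult)

lemma trig_poly_integral_tendsto:
  fixes \<mu> :: "'i \<Rightarrow> 'v::euclidean_space measure"
  assumes \<mu>: "\<And>i. prob_space (\<mu> i)" "\<And>i. sets (\<mu> i) = sets borel"
    and \<nu>: "prob_space \<nu>" "sets \<nu> = sets borel"
    and char: "\<And>t. ((\<lambda>i. CLINT x|\<mu> i. iexp (t \<bullet> x)) \<longlongrightarrow> (CLINT x|\<nu>. iexp (t \<bullet> x))) F"
    and p: "trig_poly p"
  shows "((\<lambda>i. \<integral>x. p x \<partial>\<mu> i) \<longlongrightarrow> (\<integral>x. p x \<partial>\<nu>)) F"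
proof -
  have ReIm: "Re (CLINT x|N. iexp (t \<bullet> x)) = (\<integral>x. cos (t \<bullet> x) \<partial>N)"
    "Im (CLINT x|N. iexp (t \<bullet> x)) = (\<integral>x. sin (t \<bullet> x) \<partial>N)"
    if N: "prob_space N" "sets N = sets borel" for N :: "'v measure" and t
  proof -
    interpret prob_space N by fact
    have [measurable_cong]: "sets N = sets borel" by fact
    have "integrable N (\<lambda>x. iexp (t \<bullet> x))" by (intro integrable_const_bound[where B=1]) auto
    from integral_Re[OF this] integral_Im[OF this]
    show "Re (CLINT x|N. iexp (t \<bullet> x)) = (\<integral>x. cos (t \<bullet> x) \<partial>N)"
      "Im (CLINT x|N. iexp (t \<bullet> x)) = (\<integral>x. sin (t \<bullet> x) \<partial>N)"
      by (simp_all add: Re_exp Im_exp)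
  qed
  have int: "integrable N f" if t: "trig_poly f" and N: "prob_space N" "sets N = sets borel" for f and N :: "'v measure"
  proof -
    interpret prob_space N by fact
    have [measurable_cong]: "sets N = sets borel" by fact
    obtain B where "f \<in> borel_measurable borel" "\<And>x. \<bar>f x\<bar> \<le> B" using trig_poly_measurable_bounded[OF t] by blast
    then show ?thesis by (intro integrable_const_bound[where B=B]) auto
  qed
  show ?thesis
    using p
  proof (induction rule: trig_poly.induct)
    case (trig_cos t)
    show ?case using tendsto_Re[OF char[of t]] by (simp add: ReIm \<mu> \<nu>)
  next
    case (trig_sin t)
    show ?case using tendsto_Im[OF char[of t]] by (simp add: ReIm \<mu> \<nu>)
  next
    case (trig_add f g)
    then show ?case by (simp add: int \<mu> \<nu> tendsto_add)
  next
    case (trig_scale f c)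
    then show ?case by (simp add: tendsto_mult_left)
  qed
qed

text \<open>The function \<open>f\<close> need not be periodic, so it is first replaced by a function of the sines of
  \<open>x\<^sub>i / K\<close>, from which the arcsine recovers \<open>x\<close> if all \<open>|x\<^sub>i|\<close> are at most \<open>K \<pi> / 2\<close>. Outside of this
  cube the trivial bound \<open>2 B\<close> for the error is at most \<open>2 B |x|\<^sup>2 / K\<^sup>2\<close>. The Weierstrass
  approximation theorem then replaces the function of the sines by a polynomial in them.\<close>

lemma trig_poly_approx:
  fixes f :: "real ^ 'm::finite \<Rightarrow> real"
  assumes f: "continuous_on UNIV f" and B: "\<And>x. \<bar>f x\<bar> \<le> B" and e: "0 < e" and K: "0 < K"
  obtains p where "trig_poly p" "\<And>x. \<bar>f x - p x\<bar> \<le> e + 2 * B / K\<^sup>2 * (norm x)\<^sup>2"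
proof -
  define F where "F z = f (\<chi> i. K * arcsin (z $ i))" for z :: "real ^ 'm"
  define h where "h x = (\<chi> i. sin (x $ i / K))" for x :: "real ^ 'm"
  have hQ: "h x \<in> cbox (- 1) 1" for x by (simp add: mem_box_cart h_def)
  have "continuous_on (cbox (- 1) 1) (\<lambda>z :: real ^ 'm. \<chi> i. K * arcsin (z $ i))"
    by (intro continuous_on_vec_lambda continuous_intros) (auto simp: mem_box_cart)
  then have "continuous_on (cbox (- 1) 1) F"
    unfolding F_def by (rule continuous_on_compose2[OF f]) auto
  then obtain P where P: "real_polynomial_function P" "\<And>z. z \<in> cbox (- 1) 1 \<Longrightarrow> \<bar>F z - P z\<bar> < e"
    using Stone_Weierstrass_real_polynomial_function[OF compact_cbox _ e] by blast
  have B0: "0 \<le> B" using B abs_ge_zero order_trans by blast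
  have near: "\<bar>f x - F (h x)\<bar> \<le> 2 * B / K\<^sup>2 * (norm x)\<^sup>2" for x
  proof (cases "\<forall>i. \<bar>x $ i / K\<bar> \<le> pi / 2")
    case True
    have "arcsin (sin (x $ i / K)) = x $ i / K" for i
      using True[rule_format, of i] unfolding abs_le_iff by (intro arcsin_sin) linarith+
    then have "F (h x) = f x" using K by (simp add: F_def h_def)
    then show ?thesis using B0 by simp
  next
    case False
    then obtain i where "pi / 2 < \<bar>x $ i / K\<bar>" by (meson not_le)
    then have "1 \<le> \<bar>x $ i / K\<bar>" using pi_ge_two by linarith
    then have "1\<^sup>2 \<le> \<bar>x $ i / K\<bar>\<^sup>2" by (intro power_mono) auto
    then have "1 \<le> (x $ i)\<^sup>2 / K\<^sup>2" by (simp add: power_divide)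
    also have "\<dots> \<le> (norm x)\<^sup>2 / K\<^sup>2"
      using power_mono[OF component_le_norm_cart[of x i], of 2] by (intro divide_right_mono) auto
    finally have "2 * B * 1 \<le> 2 * B * ((norm x)\<^sup>2 / K\<^sup>2)" using B0 by (intro mult_left_mono) auto
    moreover have "\<bar>f x - F (h x)\<bar> \<le> 2 * B * 1"
      using B[of x] B[of "\<chi> i. K * arcsin (h x $ i)"] unfolding F_def by linarith
    ultimately show ?thesis by simp
  qed
  show ?thesis
  proof (rule that)
    show "trig_poly (\<lambda>x. P (h x))" using trig_poly_polynomial_sin[OF P(1)] by (simp add: h_def)
    show "\<bar>f x - P (h x)\<bar> \<le> e + 2 * B / K\<^sup>2 * (norm x)\<^sup>2" for x
      using near[of x] P(2)[OF hQ, of x] by linarith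
  qed
qed

theorem weakly_converges_of_char:
  fixes \<mu> :: "'i \<Rightarrow> (real ^ 'm::finite) measure"
  assumes \<mu>: "\<And>i. prob_space (\<mu> i)" "\<And>i. sets (\<mu> i) = sets borel"
    and \<nu>: "prob_space \<nu>" "sets \<nu> = sets borel"
    and char: "\<And>t. ((\<lambda>i. CLINT x|\<mu> i. iexp (t \<bullet> x)) \<longlongrightarrow> (CLINT x|\<nu>. iexp (t \<bullet> x))) F"
    and moment: "\<And>i. integrable (\<mu> i) (\<lambda>x. (norm x)\<^sup>2)" "\<And>i. (\<integral>x. (norm x)\<^sup>2 \<partial>\<mu> i) \<le> C"
      "integrable \<nu> (\<lambda>x. (norm x)\<^sup>2)" "(\<integral>x. (norm x)\<^sup>2 \<partial>\<nu>) \<le> C"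
  shows "weakly_converges \<mu> \<nu> F"
  unfolding weakly_converges_def
proof (intro allI impI)
  fix f :: "real ^ 'm \<Rightarrow> real"
  assume "continuous_on UNIV f \<and> bounded (range f)"
  then obtain B where f: "continuous_on UNIV f" and B: "\<And>x. \<bar>f x\<bar> \<le> B"
    by (auto simp: bounded_iff)
  have B0: "0 \<le> B" using B abs_ge_zero order_trans by blast
  have "0 \<le> (\<integral>x. (norm x)\<^sup>2 \<partial>\<nu>)" by simp
  then have C0: "0 \<le> C" using moment(4) by linarith
  show "((\<lambda>i. \<integral>x. f x \<partial>\<mu> i) \<longlongrightarrow> (\<integral>x. f x \<partial>\<nu>)) F"
  proof (rule tendstoI)
    fix e :: real assume e: "0 < e"
    define K where "K = sqrt (8 * B * C / e + 1)"
    have "0 < 8 * B * C / e + 1" using B0 C0 e by (intro add_nonneg_pos) auto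
    then have K: "0 < K" "K\<^sup>2 = 8 * B * C / e + 1" by (simp_all add: K_def)
    have KC: "2 * B / K\<^sup>2 * C \<le> e / 4"
    proof -
      have "8 * B * C \<le> e * K\<^sup>2" using K(2) e by (simp add: field_simps)
      then show ?thesis using K(1) by (simp add: field_simps)
    qed
    obtain p where p: "trig_poly p" "\<And>x. \<bar>f x - p x\<bar> \<le> e / 8 + 2 * B / K\<^sup>2 * (norm x)\<^sup>2"
      using trig_poly_approx[OF f B _ K(1), of "e / 8"] e by auto
    obtain A where pA: "p \<in> borel_measurable borel" "\<And>x. \<bar>p x\<bar> \<le> A"
      using trig_poly_measurable_bounded[OF p(1)] by blast
    have approx: "\<bar>(\<integral>x. f x \<partial>N) - (\<integral>x. p x \<partial>N)\<bar> \<le> 3 * e / 8"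
      if N: "prob_space N" "sets N = sets borel" and m: "integrable N (\<lambda>x. (norm x)\<^sup>2)" "(\<integral>x. (norm x)\<^sup>2 \<partial>N) \<le> C"
      for N :: "(real ^ 'm) measure"
    proof -
      interpret N: prob_space N by fact
      have [measurable_cong]: "sets N = sets borel" by fact
      have [measurable]: "f \<in> borel_measurable borel" using f by (rule borel_measurable_continuous_onI)
      note [measurable] = pA(1)
      have i: "integrable N f" "integrable N p"
        using N.integrable_const_bound[of f B] N.integrable_const_bound[of p A] B pA(2) by auto
      have "\<bar>(\<integral>x. f x \<partial>N) - (\<integral>x. p x \<partial>N)\<bar> = \<bar>\<integral>x. f x - p x \<partial>N\<bar>" using i by simp
      also have "\<dots> \<le> (\<integral>x. \<bar>f x - p x\<bar> \<partial>N)" by (rule integral_abs_bound)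
      also have "\<dots> \<le> (\<integral>x. e / 8 + 2 * B / K\<^sup>2 * (norm x)\<^sup>2 \<partial>N)"
        using i m p(2) by (intro integral_mono) auto
      also have "\<dots> = e / 8 + 2 * B / K\<^sup>2 * (\<integral>x. (norm x)\<^sup>2 \<partial>N)" using m by (simp add: N.prob_space)
      also have "\<dots> \<le> e / 8 + 2 * B / K\<^sup>2 * C" using m(2) B0 by (intro add_left_mono mult_left_mono) auto
      finally show ?thesis using KC by linarith
    qed
    have "eventually (\<lambda>i. dist (\<integral>x. p x \<partial>\<mu> i) (\<integral>x. p x \<partial>\<nu>) < e / 4) F"
      using trig_poly_integral_tendsto[OF \<mu> \<nu> char p(1)] e by (intro tendstoD) auto
    then show "eventually (\<lambda>i. dist (\<integral>x. f x \<partial>\<mu> i) (\<integral>x. f x \<partial>\<nu>) < e) F"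
    proof eventually_elim
      case (elim i)
      then show ?case
        using approx[OF \<mu> moment(1,2), of i] approx[OF \<nu> moment(3,4)]
        unfolding dist_real_def by linarith
    qed
  qed
qed

section \<open>Centered normal laws with prescribed covariance\<close>

lemma symmetric_bilinear_swap:
  fixes A :: "real ^ 'm ^ 'm::finite"
  assumes "transpose A = A"
  shows "x \<bullet> (A *v y) = y \<bullet> (A *v x)"
proof -
  have "x \<bullet> (A *v y) = (A *v y) \<bullet> x" by (rule inner_commute)
  also have "\<dots> = y \<bullet> (transpose A *v x)"
    by (metis dot_lmul_matrix inner_commute transpose_matrix_vector vector_transpose_matrix)
  finally show ?thesis using assms by simp
qed

text \<open>The right side is the quadratic form at \<open>x + s e\<^sub>u\<close>, with \<open>e\<^sub>u\<close> the \<open>u\<close>-th unit vector. The choice of \<open>s\<close>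
  then yields the Cauchy-Schwarz inequality of the form against \<open>e\<^sub>u\<close>.\<close>

lemma nonneg_definite_row_inequality:
  fixes A :: "real ^ 'm ^ 'm::finite"
  assumes sym: "transpose A = A" and nn: "nonneg_definite A"
  shows "0 \<le> x \<bullet> (A *v x) + 2 * s * (A *v x) $ u + s\<^sup>2 * A $ u $ u"
proof -
  have "0 \<le> (x + s *\<^sub>R axis u 1) \<bullet> (A *v (x + s *\<^sub>R axis u 1))"
    using nn by (simp add: nonneg_definite_def)
  also have "\<dots> = x \<bullet> (A *v x) + s * (x \<bullet> (A *v axis u 1)) + s * (axis u 1 \<bullet> (A *v x)) + s\<^sup>2 * (axis u 1 \<bullet> (A *v axis u 1))"
    by (simp add: matrix_vector_right_distrib inner_add_left inner_add_right
      matrix_vector_mult_scaleR power2_eq_square algebra_simps)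
  also have "x \<bullet> (A *v axis u 1) = axis u 1 \<bullet> (A *v x)" by (rule symmetric_bilinear_swap[OF sym])
  finally show ?thesis
    by (simp add: inner_axis' matrix_vector_mul_component column_def matrix_vector_mult_basis)
qed

text \<open>Cholesky elimination, with \<open>U\<close> containing the indices of the nonzero rows. If the diagonal entry at \<open>u\<close> vanishes,
  then so does the whole row, because the form is nonnegative. Otherwise subtracting \<open>w w\<^sup>T\<close>, where \<open>w\<close>
  is the row divided by the square root of the diagonal entry, annihilates the row and leaves the matrix
  nonnegative definite.\<close>

lemma gram_decomposition_aux:
  "finite U \<Longrightarrow> transpose A = A \<Longrightarrow> nonneg_definite A \<Longrightarrow> (\<And>i j. i \<notin> U \<Longrightarrow> A $ i $ j = 0) \<Longrightarrow>
    \<exists>v :: 'm \<Rightarrow> real ^ 'm. \<forall>i j. A $ i $ j = (\<Sum>a\<in>U. v a $ i * v a $ j)"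
  for A :: "real ^ 'm ^ 'm::finite"
proof (induction U arbitrary: A rule: finite_induct)
  case (insert u U)
  note sym = insert.prems(1) and nn = insert.prems(2)
  have symm: "A $ i $ j = A $ j $ i" for i j
    using sym by (metis transpose_def vec_lambda_beta)
  note Q = nonneg_definite_row_inequality[OF sym nn]
  have diag: "0 \<le> A $ u $ u" using Q[of 0 1 u] by simp
  show ?case
  proof (cases "A $ u $ u = 0")
    case True
    have row: "A $ u $ j = 0" for j
    proof (rule ccontr)
      assume ne: "A $ u $ j \<noteq> 0"
      define b where "b = A $ j $ j"
      have "(A *v axis j 1) $ u = A $ u $ j" by (simp add: matrix_vector_mult_basis column_def)
      moreover have "axis j 1 \<bullet> (A *v axis j 1) = b" by (simp add: matrix_vector_mult_basis column_def inner_axis' b_def)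
      ultimately have "0 \<le> b + 2 * s * A $ u $ j" for s using Q[of "axis j 1" s u] True by simp
      \<comment> \<open>A linear function of \<open>s\<close> is bounded below only if it is constant; here its value is \<open>-1\<close>.\<close>
      from this[of "- (b + 1) / (2 * A $ u $ j)"] show False using ne by (simp add: field_simps)
    qed
    have "\<exists>v :: 'm \<Rightarrow> real ^ 'm. \<forall>i j. A $ i $ j = (\<Sum>a\<in>U. v a $ i * v a $ j)"
    proof (rule insert.IH[OF sym nn])
      show "A $ i $ j = 0" if "i \<notin> U" for i j
        using row insert.prems(3)[of i j] that by (cases "i = u") auto
    qed
    then obtain v :: "'m \<Rightarrow> real ^ 'm" where v: "\<And>i j. A $ i $ j = (\<Sum>a\<in>U. v a $ i * v a $ j)" by blast
    have "A $ i $ j = (\<Sum>a\<in>insert u U. (v(u := 0)) a $ i * (v(u := 0)) a $ j)" for i j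
    proof -
      have "(\<Sum>a\<in>U. (v(u := 0)) a $ i * (v(u := 0)) a $ j) = (\<Sum>a\<in>U. v a $ i * v a $ j)"
        using insert.hyps(2) by (intro sum.cong) auto
      then show ?thesis using insert.hyps v by simp
    qed
    then show ?thesis by blast
  next
    case False
    then have pos: "0 < A $ u $ u" using diag by simp
    define w :: "real ^ 'm" where "w = (\<chi> i. A $ u $ i / sqrt (A $ u $ u))"
    define A' :: "real ^ 'm ^ 'm" where "A' = (\<chi> i j. A $ i $ j - w $ i * w $ j)"
    have sym': "transpose A' = A'"
      by (simp add: A'_def transpose_def vec_eq_iff symm mult.commute)
    have wx: "w \<bullet> x = (A *v x) $ u / sqrt (A $ u $ u)" for x
      by (simp add: w_def inner_vec_def matrix_vector_mult_def sum_divide_distrib)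
    have A'x: "A' *v x = A *v x - (w \<bullet> x) *\<^sub>R w" for x
      by (simp add: A'_def matrix_vector_mult_def vec_eq_iff inner_vec_def sum_distrib_left
        algebra_simps flip: sum_subtractf)
    have nn': "nonneg_definite A'"
      unfolding nonneg_definite_def
    proof
      fix x
      define a where "a = (A *v x) $ u"
      have "0 \<le> x \<bullet> (A *v x) - a\<^sup>2 / A $ u $ u"
        using Q[of x "- a / A $ u $ u" u] pos by (simp add: a_def power2_eq_square)
      also have "\<dots> = x \<bullet> (A' *v x)"
        using pos by (simp add: A'x inner_diff_right wx a_def inner_commute[of x w] power2_eq_square)
      finally show "0 \<le> x \<bullet> (A' *v x)" .
    qed
    have zero': "A' $ i $ j = 0" if "i \<notin> U" for i j
    proof (cases "i = u")
      case True
      then show ?thesis using pos by (simp add: A'_def w_def)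
    next
      case False
      then have "A $ i $ j = 0" "A $ u $ i = 0" using insert.prems(3) that symm by auto
      then show ?thesis by (simp add: A'_def w_def)
    qed
    obtain v :: "'m \<Rightarrow> real ^ 'm" where v: "\<And>i j. A' $ i $ j = (\<Sum>a\<in>U. v a $ i * v a $ j)"
      using insert.IH[OF sym' nn' zero'] by blast
    have "A $ i $ j = (\<Sum>a\<in>insert u U. (v(u := w)) a $ i * (v(u := w)) a $ j)" for i j
    proof -
      have "(\<Sum>a\<in>U. (v(u := w)) a $ i * (v(u := w)) a $ j) = A' $ i $ j"
        unfolding v using insert.hyps(2) by (intro sum.cong) auto
      then show ?thesis using insert.hyps by (simp add: A'_def)
    qed
    then show ?thesis by blast
  qed
qed simp

lemma gram_decomposition:
  fixes A :: "real ^ 'm ^ 'm::finite"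
  assumes "transpose A = A" "nonneg_definite A"
  obtains v :: "'m \<Rightarrow> real ^ 'm" where "\<And>i j. A $ i $ j = (\<Sum>a\<in>UNIV. v a $ i * v a $ j)"
  using gram_decomposition_aux[OF finite assms, of UNIV] by auto

lemma std_normal_moments:
  "integrable std_normal_distribution (\<lambda>x. x ^ k)"
  "(\<integral>x. x \<partial>std_normal_distribution) = 0"
  "(\<integral>x. x\<^sup>2 \<partial>std_normal_distribution) = 1"
proof -
  show "integrable std_normal_distribution (\<lambda>x. x ^ k)"
    by (subst integrable_density) (auto simp: integrable_std_normal_moment)
  show "(\<integral>x. x \<partial>std_normal_distribution) = 0"
    using integral_std_normal_moment_odd[of 0] by (subst integral_density) auto
  show "(\<integral>x. x\<^sup>2 \<partial>std_normal_distribution) = 1"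
    using integral_std_normal_moment_even[of 1] by (subst integral_density) (auto simp: fact_numeral)
qed

lemma real_distribution_normal_law: "0 \<le> s \<Longrightarrow> real_distribution (normal_law c s)"
proof (cases "s = 0")
  case True
  interpret prob_space "return borel c" by (rule prob_space_return) simp
  show ?thesis using True by (auto simp: normal_law_def real_distribution_def real_distribution_axioms_def intro: prob_space_axioms)
next
  case False
  moreover assume "0 \<le> s"
  ultimately interpret prob_space "density lborel (normal_density c s)" by (intro prob_space_normal_density) auto
  show ?thesis using False by (auto simp: normal_law_def real_distribution_def real_distribution_axioms_def intro: prob_space_axioms)
qed

lemma char_normal_law:
  assumes "0 \<le> s"
  shows "char (normal_law 0 s) t = exp (- (s * t)\<^sup>2 / 2)"
proof (cases "s = 0")
  case True
  then show ?thesis by (simp add: normal_law_def char_def integral_return)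
next
  case False
  then have s: "0 < s" using assms by simp
  interpret N: prob_space std_normal_distribution by (intro prob_space_normal_density) simp
  have "distributed std_normal_distribution lborel (\<lambda>x. x) std_normal_density"
    by (auto simp: distributed_def distr_id2)
  from N.normal_density_affine[OF this _ False, of 0]
  have "distributed std_normal_distribution lborel (\<lambda>x. s * x) (normal_density 0 s)"
    using s by simp
  then have D: "distr std_normal_distribution lborel (\<lambda>x. s * x) = density lborel (normal_density 0 s)"
    by (simp add: distributed_def)
  have "char (normal_law 0 s) t = (CLINT x|distr std_normal_distribution lborel (\<lambda>x. s * x). iexp (t * x))"
    unfolding D using False by (simp add: normal_law_def char_def)
  also have "\<dots> = (CLINT x|std_normal_distribution. iexp (t * (s * x)))"
    by (subst integral_distr) auto
  also have "\<dots> = char std_normal_distribution (s * t)"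
    by (simp add: char_def mult_ac)
  finally show ?thesis by (simp add: char_std_normal_distribution)
qed

text \<open>The law of \<open>\<Sum>\<^sub>a z\<^sub>a v\<^sub>a\<close> with independent standard normal \<open>z\<^sub>a\<close>, for vectors \<open>v\<^sub>a\<close> with \<open>A = \<Sum>\<^sub>a v\<^sub>a v\<^sub>a\<^sup>T\<close>.
  Its projections are normal by uniqueness of characteristic functions.\<close>

theorem ex_centered_normal:
  fixes A :: "real ^ 'm ^ 'm::finite"
  assumes sym: "transpose A = A" and nn: "nonneg_definite A"
  obtains \<nu> where "is_centered_normal \<nu> A" "prob_space \<nu>" "sets \<nu> = sets borel"
    "integrable \<nu> (\<lambda>x. (norm x)\<^sup>2)"
    "\<And>t. (CLINT x|\<nu>. iexp (t \<bullet> x)) = exp (- (t \<bullet> (A *v t)) / 2)"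
proof -
  obtain v :: "'m \<Rightarrow> real ^ 'm" where v: "\<And>i j. A $ i $ j = (\<Sum>a\<in>UNIV. v a $ i * v a $ j)"
    using gram_decomposition[OF assms] by blast
  have form: "t \<bullet> (A *v t) = (\<Sum>a\<in>UNIV. (t \<bullet> v a)\<^sup>2)" for t
  proof -
    have "t \<bullet> (A *v t) = (\<Sum>i\<in>UNIV. \<Sum>j\<in>UNIV. \<Sum>a\<in>UNIV. (t $ i * v a $ i) * (t $ j * v a $ j))"
      by (simp add: inner_vec_def matrix_vector_mult_def v sum_distrib_left sum_distrib_right mult_ac)
    also have "\<dots> = (\<Sum>i\<in>UNIV. \<Sum>a\<in>UNIV. \<Sum>j\<in>UNIV. (t $ i * v a $ i) * (t $ j * v a $ j))"
      by (intro sum.cong refl sum.swap)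
    also have "\<dots> = (\<Sum>a\<in>UNIV. \<Sum>i\<in>UNIV. \<Sum>j\<in>UNIV. (t $ i * v a $ i) * (t $ j * v a $ j))"
      by (rule sum.swap)
    also have "\<dots> = (\<Sum>a\<in>UNIV. (t \<bullet> v a)\<^sup>2)"
      by (simp add: inner_vec_def power2_eq_square sum_product)
    finally show ?thesis .
  qed
  interpret N: prob_space std_normal_distribution by (intro prob_space_normal_density) simp
  define P where "P = Pi\<^sub>M (UNIV :: 'm set) (\<lambda>_. std_normal_distribution)"
  interpret PS: product_prob_space "\<lambda>_::'m. std_normal_distribution" "UNIV :: 'm set" by standard
  interpret PP: prob_space P unfolding P_def by (rule prob_space_PiM) (rule N.prob_space_axioms)
  define Z where "Z z = (\<Sum>a\<in>UNIV. z a *\<^sub>R v a)" for z :: "'m \<Rightarrow> real"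
  have [measurable]: "(\<lambda>z. z a) \<in> borel_measurable P" for a
    unfolding P_def by measurable
  have Zm [measurable]: "Z \<in> borel_measurable P" unfolding Z_def by measurable
  define \<nu> where "\<nu> = distr P borel Z"
  have \<nu>: "prob_space \<nu>" "sets \<nu> = sets borel"
    unfolding \<nu>_def by (auto intro: PP.prob_space_distr)
  have tZ: "t \<bullet> Z z = (\<Sum>a\<in>UNIV. z a * (t \<bullet> v a))" for t z
    by (simp add: Z_def inner_sum_right)
  have char: "(CLINT x|\<nu>. iexp (t \<bullet> x)) = exp (- (t \<bullet> (A *v t)) / 2)" for t
  proof -
    have "(CLINT x|\<nu>. iexp (t \<bullet> x)) = (CLINT z|P. iexp (t \<bullet> Z z))"
      unfolding \<nu>_def by (subst integral_distr) auto
    also have "\<dots> = (CLINT z|P. (\<Prod>a\<in>UNIV. iexp ((t \<bullet> v a) * z a)))"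
      by (simp add: tZ sum_distrib_left exp_sum mult.commute)
    also have "\<dots> = (\<Prod>a\<in>UNIV. CLINT x|std_normal_distribution. iexp ((t \<bullet> v a) * x))"
      unfolding P_def by (rule PS.product_integral_prod) (auto intro!: N.integrable_const_bound[where B=1])
    also have "\<dots> = (\<Prod>a\<in>UNIV. char std_normal_distribution (t \<bullet> v a))"
      by (simp add: char_def)
    also have "\<dots> = exp (\<Sum>a\<in>UNIV. - complex_of_real ((t \<bullet> v a)\<^sup>2) / 2)"
      by (simp add: char_std_normal_distribution exp_sum exp_of_real[symmetric])
    also have "(\<Sum>a\<in>UNIV. - complex_of_real ((t \<bullet> v a)\<^sup>2) / 2) = complex_of_real (- (t \<bullet> (A *v t)) / 2)"
      by (simp add: form sum_negf sum_divide_distrib)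
    finally show ?thesis unfolding exp_of_real .
  qed
  have prodint: "integrable P (\<lambda>z. \<Prod>i\<in>UNIV. z i ^ k i)"
    "(\<integral>z. (\<Prod>i\<in>UNIV. z i ^ k i) \<partial>P) = (\<Prod>i\<in>UNIV. \<integral>x. x ^ k i \<partial>std_normal_distribution)" for k :: "'m \<Rightarrow> nat"
    unfolding P_def
    by (rule PS.product_integrable_prod PS.product_integral_prod; simp add: std_normal_moments(1))+
  have coord: "(\<Prod>i\<in>UNIV. z i ^ (if i = a then 1 else 0)) = z a" for z :: "'m \<Rightarrow> real" and a
    by (subst prod.remove[of _ a]) (auto intro: prod.neutral)
  have coord2: "(\<Prod>i\<in>UNIV. z i ^ ((if i = a then 1 else 0) + (if i = b then 1 else 0))) = z a * z b" for z :: "'m \<Rightarrow> real" and a b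
    unfolding power_add prod.distrib coord ..
  have i1: "integrable P (\<lambda>z. z a)" for a
    using prodint(1)[of "\<lambda>i. if i = a then 1 else 0"] unfolding coord .
  have i2: "integrable P (\<lambda>z. z a * z b)" for a b
    using prodint(1)[of "\<lambda>i. (if i = a then 1 else 0) + (if i = b then 1 else 0)"] unfolding coord2 .
  have m1: "(\<integral>z. z a \<partial>P) = 0" for a
  proof -
    have "(\<integral>z. z a \<partial>P) = (\<Prod>i\<in>UNIV. \<integral>x. x ^ (if i = a then 1 else 0) \<partial>std_normal_distribution)"
      using prodint(2)[of "\<lambda>i. if i = a then 1 else 0"] unfolding coord .
    also have "\<dots> = 0" by (rule prod_zero) (auto intro!: bexI[of _ a] simp: std_normal_moments(2))
    finally show ?thesis .
  qed
  have m2: "(\<integral>z. z a * z b \<partial>P) = (if a = b then 1 else 0)" for a b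
  proof -
    have eq: "(\<integral>z. z a * z b \<partial>P) = (\<Prod>i\<in>UNIV. \<integral>x. x ^ ((if i = a then 1 else 0) + (if i = b then 1 else 0)) \<partial>std_normal_distribution)"
      using prodint(2)[of "\<lambda>i. (if i = a then 1 else 0) + (if i = b then 1 else 0)"] unfolding coord2 .
    show ?thesis
    proof (cases "a = b")
      case True
      have "(\<integral>x. x ^ ((if i = a then 1 else 0) + (if i = a then 1 else 0)) \<partial>std_normal_distribution) = 1" for i
        using std_normal_moments(3) N.prob_space by (cases "i = a") (simp_all add: numeral_2_eq_2)
      then show ?thesis unfolding eq using True by simp
    next
      case False
      have "(\<Prod>i\<in>UNIV. \<integral>x. x ^ ((if i = a then 1 else 0) + (if i = b then 1 else 0)) \<partial>std_normal_distribution) = 0"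
        using False by (intro prod_zero) (auto intro!: bexI[of _ a] simp: std_normal_moments(2))
      then show ?thesis unfolding eq using False by simp
    qed
  qed
  have Zi: "Z z $ i = (\<Sum>a\<in>UNIV. z a * v a $ i)" for z i by (simp add: Z_def)
  have mean: "(\<integral>x. x $ i \<partial>\<nu>) = 0" for i
  proof -
    have "(\<integral>x. x $ i \<partial>\<nu>) = (\<integral>z. Z z $ i \<partial>P)" unfolding \<nu>_def by (subst integral_distr) auto
    also have "\<dots> = 0" by (simp add: Zi i1 m1)
    finally show ?thesis .
  qed
  have ZZ: "Z z $ i * Z z $ j = (\<Sum>a\<in>UNIV. \<Sum>b\<in>UNIV. (v a $ i * v b $ j) * (z a * z b))" for z i j
    unfolding Zi sum_product by (intro sum.cong) (auto simp: mult_ac)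
  have iZZ: "integrable P (\<lambda>z. Z z $ i * Z z $ j)" for i j
    unfolding ZZ by (intro Bochner_Integration.integrable_sum integrable_mult_right i2)
  have cov: "(\<integral>x. x $ i * x $ j \<partial>\<nu>) = A $ i $ j" for i j
  proof -
    have "(\<integral>x. x $ i * x $ j \<partial>\<nu>) = (\<integral>z. Z z $ i * Z z $ j \<partial>P)" unfolding \<nu>_def by (subst integral_distr) auto
    also have "\<dots> = (\<Sum>a\<in>UNIV. \<Sum>b\<in>UNIV. (v a $ i * v b $ j) * (if a = b then 1 else 0))"
      unfolding ZZ by (simp add: i2 m2 Bochner_Integration.integral_sum)
    also have "\<dots> = (\<Sum>a\<in>UNIV. \<Sum>b\<in>UNIV. if a = b then v a $ i * v b $ j else 0)"
      by (intro sum.cong) auto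
    also have "\<dots> = A $ i $ j" by (simp add: v)
    finally show ?thesis .
  qed
  have "integrable P (\<lambda>z. (norm (Z z))\<^sup>2)"
    unfolding power2_norm_eq_inner inner_vec_def by (simp add: iZZ)
  then have norm2: "integrable \<nu> (\<lambda>x. (norm x)\<^sup>2)"
    unfolding \<nu>_def by (subst integrable_distr_eq) auto
  have "distr \<nu> borel (\<lambda>x. t \<bullet> x) = normal_law 0 (sqrt (t \<bullet> (A *v t)))" for t
  proof (rule Levy_uniqueness)
    have q: "0 \<le> t \<bullet> (A *v t)" using nn by (simp add: nonneg_definite_def)
    have m: "(\<lambda>x. t \<bullet> x) \<in> measurable \<nu> borel" using \<nu>(2) by simp
    show "real_distribution (distr \<nu> borel (\<lambda>x. t \<bullet> x))"
      using prob_space.prob_space_distr[OF \<nu>(1) m] by (simp add: real_distribution_def real_distribution_axioms_def)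
    show "real_distribution (normal_law 0 (sqrt (t \<bullet> (A *v t))))"
      using q by (intro real_distribution_normal_law) simp
    show "char (distr \<nu> borel (\<lambda>x. t \<bullet> x)) = char (normal_law 0 (sqrt (t \<bullet> (A *v t))))"
    proof
      fix s
      have "char (distr \<nu> borel (\<lambda>x. t \<bullet> x)) s = (CLINT x|\<nu>. iexp (s * (t \<bullet> x)))"
        unfolding char_def using m by (subst integral_distr) auto
      also have "\<dots> = (CLINT x|\<nu>. iexp ((s *\<^sub>R t) \<bullet> x))" by simp
      also have "\<dots> = exp (- ((s *\<^sub>R t) \<bullet> (A *v (s *\<^sub>R t))) / 2)" by (rule char)
      also have "(s *\<^sub>R t) \<bullet> (A *v (s *\<^sub>R t)) = (sqrt (t \<bullet> (A *v t)) * s)\<^sup>2"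
        using q unfolding form by (simp add: power_mult_distrib sum_distrib_left[symmetric] mult.commute)
      finally show "char (distr \<nu> borel (\<lambda>x. t \<bullet> x)) s = char (normal_law 0 (sqrt (t \<bullet> (A *v t)))) s"
        using q by (simp add: char_normal_law)
    qed
  qed
  moreover have "0 \<le> sqrt (t \<bullet> (A *v t))" for t using nn by (simp add: nonneg_definite_def)
  ultimately have "multivariate_normal \<nu>"
    unfolding multivariate_normal_def using \<nu> by blast
  then have "is_centered_normal \<nu> A" unfolding is_centered_normal_def using mean cov by blast
  then show ?thesis using that \<nu> norm2 char by blast
qed

section \<open>The vector-valued central limit theorem\<close>

lemma inner_partial_sum:
  "t \<bullet> partial_sum X L s = field_sum X (\<lambda>x. t \<bullet> x) (index_box L) s"
  by (simp add: partial_sum_def field_sum_def inner_sum_right)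

text \<open>By polarization the limits of the variances for all \<open>x \<mapsto> t \<bullet> x\<close> assemble to the quadratic form of \<open>\<Sigma>\<close>;
  being limits of variances, its values are nonnegative. So the limits of the characteristic
  functions are those of the centered normal law with covariance \<open>\<Sigma>\<close>.\<close>

theorem theorem3p2:
  fixes M :: "'a measure"
    and X :: "int ^ 'd::finite \<Rightarrow> 'a \<Rightarrow> real ^ 'm::finite"
  assumes "prob_space M"
    and "strictly_stationary M X"
    and "rho'_mixing M X"
    and "\<And>k i. integrable M (\<lambda>\<omega>. (X k \<omega> $ i)\<^sup>2)"
    and "\<And>k i. (\<integral>\<omega>. X k \<omega> $ i \<partial>M) = 0"
  shows "\<exists>(\<sigma> :: 'm \<Rightarrow> real) (\<gamma> :: 'm \<Rightarrow> 'm \<Rightarrow> real).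
    (\<forall>i. 0 \<le> \<sigma> i \<and>
       ((\<lambda>L. (\<integral>\<omega>. (partial_sum X L \<omega> $ i)\<^sup>2 \<partial>M) / box_volume L) \<longlongrightarrow> \<sigma> i) min_at_top) \<and>
    (\<forall>i j. i \<noteq> j \<longrightarrow> 0 \<le> \<gamma> i j \<and>
       ((\<lambda>L. (\<integral>\<omega>. (partial_sum X L \<omega> $ i - partial_sum X L \<omega> $ j)\<^sup>2 \<partial>M) / box_volume L)
          \<longlongrightarrow> \<gamma> i j) min_at_top) \<and>
    (let \<Sigma> = (\<chi> i j. if i = j then \<sigma> i else (\<sigma> i + \<sigma> j - \<gamma> i j) / 2) :: real ^ 'm ^ 'm
     in transpose \<Sigma> = \<Sigma> \<and> nonneg_definite \<Sigma> \<and>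
        (\<exists>\<nu>. is_centered_normal \<nu> \<Sigma> \<and>
           weakly_converges
             (\<lambda>L. distr M borel (\<lambda>\<omega>. partial_sum X L \<omega> /\<^sub>R sqrt (box_volume L)))
             \<nu> min_at_top))"
proof -
  interpret mixing_field M X
    using assms(1-3) by (simp add: mixing_field_def mixing_field_axioms_def)
  have comp_L2: "(\<lambda>s. X k s $ i) \<in> L2_real M M" for k i
  proof -
    have "(\<lambda>s. X k s $ i) \<in> borel_measurable M"
      using measurable_compose[OF X_measurable borel_measurable_nth] .
    then show ?thesis using assms(4) by (simp add: L2_real_iff)
  qed
  have scalar: "scalar_field M X (\<lambda>x. t \<bullet> x)" for t
  proof
    show "(\<lambda>s. t \<bullet> X k s) \<in> L2_real M M" for k
      unfolding inner_vec_def inner_real_def by (intro L2_sum L2_cmult comp_L2)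
    show "E (\<lambda>s. t \<bullet> X k s) = 0" for k
      unfolding inner_vec_def inner_real_def by (simp add: L2_integrable[OF comp_L2] assms(5))
  qed simp
  define V where "V t L = E (\<lambda>s. (t \<bullet> partial_sum X L s)\<^sup>2) / box_volume L" for t L
  have V_eq: "scalar_field.V M X (\<lambda>x. t \<bullet> x) = V t" for t
    by (simp add: fun_eq_iff scalar_field.V_def[OF scalar] V_def inner_partial_sum)
  have "\<exists>s. 0 \<le> s \<and> (V t \<longlongrightarrow> s) min_at_top" for t
    using scalar_field.variance_limit[OF scalar[of t]] unfolding V_eq by blast
  then obtain s where s: "\<And>t. 0 \<le> s t" "\<And>t. (V t \<longlongrightarrow> s t) min_at_top" by metis
  define e where "e i = (axis i 1 :: real ^ 'm)" for i
  have e: "e i \<bullet> x = x $ i" for i x by (simp add: e_def inner_axis')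
  define \<sigma> where "\<sigma> i = s (e i)" for i
  define \<gamma> where "\<gamma> i j = s (e i - e j)" for i j
  define A :: "real ^ 'm ^ 'm" where "A = (\<chi> i j. if i = j then \<sigma> i else (\<sigma> i + \<sigma> j - \<gamma> i j) / 2)"
  have part1: "0 \<le> \<sigma> i \<and> ((\<lambda>L. (\<integral>s. (partial_sum X L s $ i)\<^sup>2 \<partial>M) / box_volume L) \<longlongrightarrow> \<sigma> i) min_at_top" for i
    using s(1)[of "e i"] s(2)[of "e i"] by (simp add: \<sigma>_def V_def[abs_def] e)
  have part2: "0 \<le> \<gamma> i j \<and> ((\<lambda>L. (\<integral>s. (partial_sum X L s $ i - partial_sum X L s $ j)\<^sup>2 \<partial>M) / box_volume L)
          \<longlongrightarrow> \<gamma> i j) min_at_top" for i j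
    using s(1)[of "e i - e j"] s(2)[of "e i - e j"] by (simp add: \<gamma>_def V_def[abs_def] e inner_diff_left)
  have part_L2: "(\<lambda>s. partial_sum X L s $ i) \<in> L2_real M M" for L i
    unfolding partial_sum_def sum_component by (intro L2_sum comp_L2)
  define c where "c i j L = E (\<lambda>s. partial_sum X L s $ i * partial_sum X L s $ j) / box_volume L" for i j L
  have c_lim: "(c i j \<longlongrightarrow> A $ i $ j) min_at_top" for i j
  proof (cases "i = j")
    case True
    then show ?thesis using part1[of i] by (simp add: c_def[abs_def] A_def power2_eq_square)
  next
    case False
    have "c i j L = (E (\<lambda>s. (partial_sum X L s $ i)\<^sup>2) / box_volume L
      + E (\<lambda>s. (partial_sum X L s $ j)\<^sup>2) / box_volume L
      - E (\<lambda>s. (partial_sum X L s $ i - partial_sum X L s $ j)\<^sup>2) / box_volume L) / 2" for L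
    proof -
      have "E (\<lambda>s. (partial_sum X L s $ i - partial_sum X L s $ j)\<^sup>2) =
        E (\<lambda>s. (partial_sum X L s $ i)\<^sup>2) + E (\<lambda>s. (partial_sum X L s $ j)\<^sup>2)
        - 2 * E (\<lambda>s. partial_sum X L s $ i * partial_sum X L s $ j)"
        using L2_integrable_square[OF part_L2] L2_integrable_mult[OF part_L2 part_L2]
        by (simp add: power2_diff mult.assoc)
      then show ?thesis by (simp add: c_def diff_divide_distrib add_divide_distrib)
    qed
    then have "c i j = (\<lambda>L. (E (\<lambda>s. (partial_sum X L s $ i)\<^sup>2) / box_volume L
      + E (\<lambda>s. (partial_sum X L s $ j)\<^sup>2) / box_volume L
      - E (\<lambda>s. (partial_sum X L s $ i - partial_sum X L s $ j)\<^sup>2) / box_volume L) / 2)" by blast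
    moreover have "((\<lambda>L. (E (\<lambda>s. (partial_sum X L s $ i)\<^sup>2) / box_volume L
      + E (\<lambda>s. (partial_sum X L s $ j)\<^sup>2) / box_volume L
      - E (\<lambda>s. (partial_sum X L s $ i - partial_sum X L s $ j)\<^sup>2) / box_volume L) / 2)
       \<longlongrightarrow> (\<sigma> i + \<sigma> j - \<gamma> i j) / 2) min_at_top"
      by (intro tendsto_intros conjunct2[OF part1] conjunct2[OF part2]) simp
    ultimately show ?thesis using False by (simp add: A_def)
  qed
  have sym: "transpose A = A"
  proof -
    have "c i j = c j i" for i j by (simp add: c_def[abs_def] mult.commute)
    then have "A $ i $ j = A $ j $ i" for i j
      using tendsto_unique[OF min_at_top_neq_bot c_lim[of i j]] c_lim[of j i] by metis
    then show ?thesis by (simp add: transpose_def vec_eq_iff)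
  qed
  have s_form: "s t = t \<bullet> (A *v t)" for t
  proof -
    have "V t L = (\<Sum>i\<in>UNIV. \<Sum>j\<in>UNIV. (t $ i * t $ j) * c i j L)" for L
    proof -
      have "(t \<bullet> partial_sum X L s)\<^sup>2 = (\<Sum>i\<in>UNIV. \<Sum>j\<in>UNIV. (t $ i * t $ j) * (partial_sum X L s $ i * partial_sum X L s $ j))" for s
        by (simp add: inner_vec_def power2_eq_square sum_product mult_ac)
      then have "E (\<lambda>s. (t \<bullet> partial_sum X L s)\<^sup>2) =
         (\<Sum>i\<in>UNIV. \<Sum>j\<in>UNIV. (t $ i * t $ j) * E (\<lambda>s. partial_sum X L s $ i * partial_sum X L s $ j))"
        using L2_integrable_mult[OF part_L2 part_L2] by (simp add: Bochner_Integration.integral_sum)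
      then show ?thesis by (simp add: V_def c_def sum_divide_distrib)
    qed
    then have "V t = (\<lambda>L. \<Sum>i\<in>UNIV. \<Sum>j\<in>UNIV. (t $ i * t $ j) * c i j L)" by blast
    moreover have "(\<dots> \<longlongrightarrow> (\<Sum>i\<in>UNIV. \<Sum>j\<in>UNIV. (t $ i * t $ j) * A $ i $ j)) min_at_top"
      by (intro tendsto_intros c_lim)
    moreover have "(\<Sum>i\<in>UNIV. \<Sum>j\<in>UNIV. (t $ i * t $ j) * A $ i $ j) = t \<bullet> (A *v t)"
      by (simp add: inner_vec_def matrix_vector_mult_def sum_distrib_left mult_ac)
    ultimately show ?thesis using tendsto_unique[OF min_at_top_neq_bot s(2)[of t]] by simp
  qed
  have nn: "nonneg_definite A" using s(1) by (simp add: nonneg_definite_def flip: s_form)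
  obtain \<nu> where \<nu>: "is_centered_normal \<nu> A" "prob_space \<nu>" "sets \<nu> = sets borel"
    "integrable \<nu> (\<lambda>x. (norm x)\<^sup>2)" "\<And>t. (CLINT x|\<nu>. iexp (t \<bullet> x)) = exp (- (t \<bullet> (A *v t)) / 2)"
    using ex_centered_normal[OF sym nn] by blast
  define Y where "Y L s = partial_sum X L s /\<^sub>R sqrt (box_volume L)" for L s
  have [measurable]: "partial_sum X L \<in> borel_measurable M" for L
    unfolding partial_sum_def[abs_def] by measurable
  have Ym [measurable]: "Y L \<in> borel_measurable M" for L unfolding Y_def[abs_def] by measurable
  have Yt: "t \<bullet> Y L s = field_sum X (\<lambda>x. t \<bullet> x) (index_box L) s / sqrt (box_volume L)" for t L s
    by (simp add: Y_def inner_partial_sum divide_inverse mult.commute)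
  have "\<exists>K. \<forall>L. E (\<lambda>s. (partial_sum X L s $ i)\<^sup>2) \<le> K * box_volume L \<and> 0 < K" for i
  proof -
    obtain K :: real where "0 < K" "\<And>Q. finite Q \<Longrightarrow> E (\<lambda>s. (field_sum X (\<lambda>x. e i \<bullet> x) Q s)\<^sup>2) \<le> K * card Q"
      using scalar_field.S_second_moment[OF scalar[of "e i"]] by blast
    then have "E (\<lambda>s. (partial_sum X L s $ i)\<^sup>2) \<le> K * box_volume L" for L
      using finite_index_box[of L] unfolding card_index_box[symmetric] e[symmetric] inner_partial_sum by blast
    then show ?thesis using \<open>0 < K\<close> by blast
  qed
  then obtain K where K: "\<And>i L. E (\<lambda>s. (partial_sum X L s $ i)\<^sup>2) \<le> K i * box_volume L" "\<And>i. 0 < K i"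
    by metis
  have Yi: "(Y L s $ i)\<^sup>2 = (partial_sum X L s $ i)\<^sup>2 / box_volume L" for L s i
  proof -
    have "0 \<le> box_volume L" by (simp add: box_volume_def prod_nonneg)
    then show ?thesis by (simp add: Y_def power_mult_distrib power_inverse divide_inverse mult.commute)
  qed
  have normY: "(norm (Y L s))\<^sup>2 = (\<Sum>i\<in>UNIV. (partial_sum X L s $ i)\<^sup>2 / box_volume L)" for L s
    unfolding power2_norm_eq_inner inner_vec_def by (simp add: Yi flip: power2_eq_square)
  have intY: "integrable M (\<lambda>s. (norm (Y L s))\<^sup>2)" for L
    unfolding normY using L2_integrable_square[OF part_L2] by simp
  have EY: "E (\<lambda>s. (norm (Y L s))\<^sup>2) \<le> (\<Sum>i\<in>UNIV. K i)" for L
  proof -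
    have "E (\<lambda>s. (norm (Y L s))\<^sup>2) = (\<Sum>i\<in>UNIV. E (\<lambda>s. (partial_sum X L s $ i)\<^sup>2) / box_volume L)"
      unfolding normY using L2_integrable_square[OF part_L2] by simp
    also have "\<dots> \<le> (\<Sum>i\<in>UNIV. K i)"
    proof (intro sum_mono)
      fix i
      have "0 \<le> box_volume L" by (simp add: box_volume_def prod_nonneg)
      then consider "box_volume L = 0" | "0 < box_volume L" by linarith
      then show "E (\<lambda>s. (partial_sum X L s $ i)\<^sup>2) / box_volume L \<le> K i"
        using K(1)[of L i] K(2)[of i] by cases (simp_all add: divide_le_eq)
    qed
    finally show ?thesis .
  qed
  have "weakly_converges (\<lambda>L. distr M borel (Y L)) \<nu> min_at_top"
  proof (rule weakly_converges_of_char[where C="max (\<Sum>i\<in>UNIV. K i) (\<integral>x. (norm x)\<^sup>2 \<partial>\<nu>)"])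
    show "prob_space (distr M borel (Y L))" for L by (rule prob_space_distr) (rule Ym)
    fix t
    have "(CLINT x|distr M borel (Y L). iexp (t \<bullet> x)) =
        (CLINT s|M. iexp (field_sum X (\<lambda>x. t \<bullet> x) (index_box L) s / sqrt (box_volume L)))" for L
      unfolding Yt[symmetric] by (subst integral_distr) auto
    moreover have "((\<lambda>L. CLINT s|M. iexp (field_sum X (\<lambda>x. t \<bullet> x) (index_box L) s / sqrt (box_volume L)))
        \<longlongrightarrow> exp (- (s t) / 2)) min_at_top"
      using scalar_field.scalar_clt[OF scalar[of t] s(1)[of t]] s(2)[of t] unfolding V_eq by blast
    ultimately show "((\<lambda>L. CLINT x|distr M borel (Y L). iexp (t \<bullet> x)) \<longlongrightarrow> (CLINT x|\<nu>. iexp (t \<bullet> x))) min_at_top"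
      by (simp only: \<nu>(5) s_form)
  next
    show "integrable (distr M borel (Y L)) (\<lambda>x. (norm x)\<^sup>2)" for L
      using intY by (subst integrable_distr_eq) auto
    show "(\<integral>x. (norm x)\<^sup>2 \<partial>distr M borel (Y L)) \<le> max (\<Sum>i\<in>UNIV. K i) (\<integral>x. (norm x)\<^sup>2 \<partial>\<nu>)" for L
      using EY[of L] by (subst integral_distr) auto
  qed (use \<nu> in auto)
  then have part3: "transpose A = A \<and> nonneg_definite A \<and> (\<exists>\<nu>. is_centered_normal \<nu> A \<and>
      weakly_converges (\<lambda>L. distr M borel (\<lambda>s. partial_sum X L s /\<^sub>R sqrt (box_volume L))) \<nu> min_at_top)"
    using sym nn \<nu>(1) unfolding Y_def[abs_def] by blast
  show ?thesis
    unfolding Let_def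
    by (rule exI[of _ \<sigma>], rule exI[of _ \<gamma>]) (use part1 part2 part3[unfolded A_def] in blast)
qed

end
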